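(* Let $\Gamma$ be a finite simplicial graph, let $\Delta$ be a finite $\Gamma$-partite graph with cycle connectors, and let $H$ be a non-quasiconvex subgroup of $W_\Gamma$ generated by a finite set $T$ of words in $V(\Gamma)$. Let $\overline H<W_\Delta$ be the generalization of $H$ with respect to $\Delta$ and $T$. Then $\overline H$ is not quasiconvex in $W_\Delta$ and contains a closed surface subgroup.
   Context: Right-angled Coxeter group (RACG): for a simplicial graph $\Gamma$ with vertex set $V(\Gamma)$ and edge set $E(\Gamma)$, $W_\Gamma=\langle s\in V(\Gamma) \mid s^2=1 \text{ for all } s\in V(\Gamma),\ st=ts \text{ for all } (s,t)\in E(\Gamma)\rangle$; $V(\Gamma)$ is its standard generating set. Quasiconvexity: a subgroup $H$ of a group $G$ with generating set $S$ is quasiconvex (with respect to $S$) if some finite-radius neighborhood of $H$ in the Cayley graph of $(G,S)$ contains every geodesic connecting a pair of vertices in $H$. Quasiconvexity in a RACG is always with respect to the standard generating set. $\Gamma$-partite graphs: let $\Gamma$ have vertex set $\{s_1,\dots,s_n\}$. A simplicial graph $\Delta$ is $\Gamma$-partite if its vertex set can be partitioned into $n$ non-empty disjoint sets $A_1,\dots,A_n$ (the decomposition of $\Delta$) such that (1) no two vertices of $A_i$ are adjacent; (2) for all $1\le i<j\le n$, the subgraph $\Delta_{ij}$ of $\Delta$ induced by $A_i\cup A_j$ is connected if $s_i$ is adjacent to $s_j$ in $\Gamma$, and otherwise has no edges. $\Delta$ has cycle connectors if each $\Delta_{ij}$ is either edgeless or a (simple) cycle. Generalization of a subgroup: let $\Delta$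 be a finite $\Gamma$-partite graph with decomposition $A_1,\dots,A_n$ and let $H<W_\Gamma$ be generated by a finite set $T=\{w_1,\dots,w_m\}$ of words in $V(\Gamma)$. The rose graph $R$ associated to $T$ is the graph with edges labeled by vertices of $\Gamma$ consisting of a base vertex $B$ together with, for each $i$, a cycle of length $|w_i|$ attached at $B$ with label $w_i$. Let $\overline R$ be the graph with the same vertices as $R$, obtained by replacing each edge of $R$ labeled $s_i$ by $|A_i|$ parallel edges with the same endpoints, whose labels are in bijection with the elements of $A_i$. Choose a finite set of loops in $\overline R$ based at $B$ which generate $\pi_1(\overline R,B)$, and let $\overline T$ be the set of their labels (the label of an edge path is the word of labels of the edges successively traversed, in whichever direction). The generalization $\overline H$ of $H$ with respect to $\Delta$ and $T$ is the subgroup of $W_\Delta$ generated by $\overline T$; it does not depend on the choice of loops. A closed surface subgroup is a subgroup isomorphic to the fundamental group of a closed surface with infinite fundamental group. *)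

theory Defs
  imports
    "Graph_Theory.Digraph_Component"
    "HOL-Algebra.Generated_Groups"
    "HOL-Analysis.Analysis"
begin

text \<open>
  Finite simplicial graphs are the symmetric loop-free digraphs without parallel arcs of
  the locale \<^locale>\<open>pair_graph\<close>: an edge between \<open>s\<close> and \<open>t\<close> is the pair of arcs
  \<open>(s, t)\<close>, \<open>(t, s)\<close>.
\<close>

section \<open>Group presentations and right-angled Coxeter groups\<close>

definition list_quotient :: "'x list set \<Rightarrow> ('x list \<times> 'x list) set \<Rightarrow> 'x list set monoid" where
  "list_quotient L r =
     \<lparr> carrier = L // r,
       mult = (\<lambda>X Y. \<Union>x\<in>X. \<Union>y\<in>Y. r `` {x @ y}),
       one = r `` {[]} \<rparr>"

text \<open>The letter \<open>(s, True)\<close> stands for \<open>s\<close>, the letter \<open>(s, False)\<close> for its inverse.\<close>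

type_synonym 'a sword = "('a \<times> bool) list"

text \<open>A pair \<open>(l, r)\<close> in \<open>R\<close> is the relation \<open>l = r\<close> of the presentation.\<close>

inductive_set pres_eq :: "'a set \<Rightarrow> ('a sword \<times> 'a sword) set \<Rightarrow> ('a sword \<times> 'a sword) set"
  for S :: "'a set" and R :: "('a sword \<times> 'a sword) set"
where
  refl: "u \<in> lists (S \<times> UNIV) \<Longrightarrow> (u, u) \<in> pres_eq S R"
| sym: "(u, v) \<in> pres_eq S R \<Longrightarrow> (v, u) \<in> pres_eq S R"
| trans: "(u, v) \<in> pres_eq S R \<Longrightarrow> (v, w) \<in> pres_eq S R \<Longrightarrow> (u, w) \<in> pres_eq S R"
| cancel: "u \<in> lists (S \<times> UNIV) \<Longrightarrow> v \<in> lists (S \<times> UNIV) \<Longrightarrow> s \<in> S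
    \<Longrightarrow> (u @ [(s, b), (s, \<not> b)] @ v, u @ v) \<in> pres_eq S R"
| rel: "u \<in> lists (S \<times> UNIV) \<Longrightarrow> v \<in> lists (S \<times> UNIV) \<Longrightarrow> (l, r) \<in> R
    \<Longrightarrow> l \<in> lists (S \<times> UNIV) \<Longrightarrow> r \<in> lists (S \<times> UNIV)
    \<Longrightarrow> (u @ l @ v, u @ r @ v) \<in> pres_eq S R"

definition presented_group :: "'a set \<Rightarrow> ('a sword \<times> 'a sword) set \<Rightarrow> 'a sword set monoid" where
  "presented_group S R = list_quotient (lists (S \<times> UNIV)) (pres_eq S R)"

definition racg_relations :: "'a pair_pre_digraph \<Rightarrow> ('a sword \<times> 'a sword) set" where
  "racg_relations \<Gamma> =
     {([(s, True), (s, True)], []) | s. s \<in> pverts \<Gamma>} \<union>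
     {([(s, True), (t, True)], [(t, True), (s, True)]) | s t. (s, t) \<in> parcs \<Gamma>}"

definition racg :: "'a pair_pre_digraph \<Rightarrow> 'a sword set monoid" where
  "racg \<Gamma> = presented_group (pverts \<Gamma>) (racg_relations \<Gamma>)"

text \<open>The element of the group represented by a word in the vertices.\<close>

definition racg_word :: "'a pair_pre_digraph \<Rightarrow> 'a list \<Rightarrow> 'a sword set" where
  "racg_word \<Gamma> w = pres_eq (pverts \<Gamma>) (racg_relations \<Gamma>) `` {map (\<lambda>s. (s, True)) w}"

definition racg_gens :: "'a pair_pre_digraph \<Rightarrow> 'a sword set set" where
  "racg_gens \<Gamma> = (\<lambda>s. racg_word \<Gamma> [s]) ` pverts \<Gamma>"

section \<open>Quasiconvexity\<close>

definition cayley_graph :: "('g, 'm) monoid_scheme \<Rightarrow> 'g set \<Rightarrow> 'g pair_pre_digraph" where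
  "cayley_graph G S =
     \<lparr> pverts = carrier G,
       parcs = {(g, h). g \<in> carrier G \<and> h \<in> carrier G \<and>
                        (\<exists>s\<in>S. h = g \<otimes>\<^bsub>G\<^esub> s \<or> g = h \<otimes>\<^bsub>G\<^esub> s)} \<rparr>"

definition geodesic :: "('v, 'e) pre_digraph \<Rightarrow> 'v \<Rightarrow> 'e list \<Rightarrow> 'v \<Rightarrow> bool" where
  "geodesic C u p v \<longleftrightarrow>
     pre_digraph.awalk C u p v \<and> (\<forall>q. pre_digraph.awalk C u q v \<longrightarrow> length p \<le> length q)"

definition graph_nbhd :: "('v, 'e) pre_digraph \<Rightarrow> 'v set \<Rightarrow> nat \<Rightarrow> 'v set" where
  "graph_nbhd C U r = {v. \<exists>u\<in>U. \<exists>p. pre_digraph.awalk C u p v \<and> length p \<le> r}"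

text \<open>
  Only the vertices of geodesics are required to lie in the neighbourhood; as points on an
  edge are within distance 1 of its endpoints, this only affects the radius.
\<close>

definition quasiconvex :: "('g, 'm) monoid_scheme \<Rightarrow> 'g set \<Rightarrow> 'g set \<Rightarrow> bool" where
  "quasiconvex G S H \<longleftrightarrow>
     (\<exists>r. \<forall>g\<in>H. \<forall>h\<in>H. \<forall>p. geodesic (with_proj (cayley_graph G S)) g p h \<longrightarrow>
        set (pre_digraph.awalk_verts (with_proj (cayley_graph G S)) g p)
          \<subseteq> graph_nbhd (with_proj (cayley_graph G S)) H r)"

section \<open>\<open>\<Gamma>\<close>-partite graphs\<close>

text \<open>
  A decomposition is indexed by the vertices of \<open>\<Gamma>\<close> themselves rather than by an
  enumeration of them: \<open>A s\<close> is the part belonging to \<open>s\<close>.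
\<close>

definition part_subgraph ::
  "'b pair_pre_digraph \<Rightarrow> ('a \<Rightarrow> 'b set) \<Rightarrow> 'a \<Rightarrow> 'a \<Rightarrow> ('b, 'b \<times> 'b) pre_digraph" where
  "part_subgraph \<Delta> A s t = with_proj \<Delta> \<restriction> (A s \<union> A t)"

definition gamma_partite ::
  "'a pair_pre_digraph \<Rightarrow> 'b pair_pre_digraph \<Rightarrow> ('a \<Rightarrow> 'b set) \<Rightarrow> bool" where
  "gamma_partite \<Gamma> \<Delta> A \<longleftrightarrow>
     (\<forall>s\<in>pverts \<Gamma>. A s \<noteq> {}) \<and>
     disjoint_family_on A (pverts \<Gamma>) \<and>
     (\<Union>s\<in>pverts \<Gamma>. A s) = pverts \<Delta> \<and>
     (\<forall>s\<in>pverts \<Gamma>. \<forall>x\<in>A s. \<forall>y\<in>A s. (x, y) \<notin> parcs \<Delta>) \<and>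
     (\<forall>s\<in>pverts \<Gamma>. \<forall>t\<in>pverts \<Gamma>. s \<noteq> t \<longrightarrow>
        (if (s, t) \<in> parcs \<Gamma> then Digraph_Component.connected (part_subgraph \<Delta> A s t)
         else arcs (part_subgraph \<Delta> A s t) = {}))"

definition cycle_graph :: "('b, 'b \<times> 'b) pre_digraph \<Rightarrow> bool" where
  "cycle_graph G \<longleftrightarrow>
     (\<exists>p. pre_digraph.cycle G p \<and> 3 \<le> length p \<and>
          verts G = tail G ` set p \<and> arcs G = set p \<union> (set p)\<inverse>)"

definition cycle_connectors ::
  "'a pair_pre_digraph \<Rightarrow> 'b pair_pre_digraph \<Rightarrow> ('a \<Rightarrow> 'b set) \<Rightarrow> bool" where
  "cycle_connectors \<Gamma> \<Delta> A \<longleftrightarrow>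
     (\<forall>s\<in>pverts \<Gamma>. \<forall>t\<in>pverts \<Gamma>. s \<noteq> t \<longrightarrow>
        arcs (part_subgraph \<Delta> A s t) = {} \<or> cycle_graph (part_subgraph \<Delta> A s t))"

section \<open>Edge paths and the combinatorial fundamental group of a graph\<close>

text \<open>
  Here a graph, possibly with loops and parallel edges, is a digraph with one arc for each
  edge. The arcs of \<open>bidirect G\<close> are the edges of \<open>G\<close> with a direction of traversal, so
  that its arc walks are the edge paths of \<open>G\<close>.
\<close>

definition bidirect :: "('v, 'e) pre_digraph \<Rightarrow> ('v, 'e \<times> bool) pre_digraph" where
  "bidirect G =
     \<lparr> verts = verts G,
       arcs = arcs G \<times> UNIV,
       tail = (\<lambda>(e, b). if b then tail G e else head G e),
       head = (\<lambda>(e, b). if b then head G e else tail G e) \<rparr>"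

definition edge_loops :: "('v, 'e) pre_digraph \<Rightarrow> 'v \<Rightarrow> ('e \<times> bool) list set" where
  "edge_loops G x = {p. pre_digraph.awalk (bidirect G) x p x}"

inductive_set edge_homotopy ::
  "('v, 'e) pre_digraph \<Rightarrow> 'v \<Rightarrow> (('e \<times> bool) list \<times> ('e \<times> bool) list) set"
  for G :: "('v, 'e) pre_digraph" and x :: 'v
where
  refl: "p \<in> edge_loops G x \<Longrightarrow> (p, p) \<in> edge_homotopy G x"
| sym: "(p, q) \<in> edge_homotopy G x \<Longrightarrow> (q, p) \<in> edge_homotopy G x"
| trans: "(p, q) \<in> edge_homotopy G x \<Longrightarrow> (q, r) \<in> edge_homotopy G x
    \<Longrightarrow> (p, r) \<in> edge_homotopy G x"
| backtrack: "p @ [(e, b), (e, \<not> b)] @ q \<in> edge_loops G x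
    \<Longrightarrow> (p @ [(e, b), (e, \<not> b)] @ q, p @ q) \<in> edge_homotopy G x"

definition graph_pi1 :: "('v, 'e) pre_digraph \<Rightarrow> 'v \<Rightarrow> ('e \<times> bool) list set monoid" where
  "graph_pi1 G x = list_quotient (edge_loops G x) (edge_homotopy G x)"

section \<open>Rose graphs and generalizations of subgroups\<close>

datatype 'a rose_vertex = Base | Inner "'a list" nat

definition rose_pos :: "'a list \<Rightarrow> nat \<Rightarrow> 'a rose_vertex" where
  "rose_pos w k = (if k = 0 \<or> k = length w then Base else Inner w k)"

text \<open>The arc \<open>(w, k)\<close> is the edge of the cycle of \<open>w\<close> that carries the letter \<open>w ! k\<close>.\<close>

definition rose :: "'a list set \<Rightarrow> ('a rose_vertex, 'a list \<times> nat) pre_digraph" where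
  "rose T =
     \<lparr> verts = {Base} \<union> {rose_pos w k | w k. w \<in> T \<and> k \<le> length w},
       arcs = {(w, k). w \<in> T \<and> k < length w},
       tail = (\<lambda>(w, k). rose_pos w k),
       head = (\<lambda>(w, k). rose_pos w (Suc k)) \<rparr>"

definition rose_label :: "'a list \<times> nat \<Rightarrow> 'a" where
  "rose_label = (\<lambda>(w, k). w ! k)"

text \<open>The arc \<open>(e, a)\<close> is the parallel copy of \<open>e\<close> with label \<open>a\<close>.\<close>

definition rose_bar ::
  "('a \<Rightarrow> 'b set) \<Rightarrow> 'a list set \<Rightarrow> ('a rose_vertex, ('a list \<times> nat) \<times> 'b) pre_digraph" where
  "rose_bar A T =
     \<lparr> verts = verts (rose T),
       arcs = {(e, a). e \<in> arcs (rose T) \<and> a \<in> A (rose_label e)},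
       tail = (\<lambda>(e, a). tail (rose T) e),
       head = (\<lambda>(e, a). head (rose T) e) \<rparr>"

definition rose_bar_label :: "((('a list \<times> nat) \<times> 'b) \<times> bool) list \<Rightarrow> 'b list" where
  "rose_bar_label p = map (\<lambda>((e, a), b). a) p"

text \<open>
  \<open>K\<close> arises as the generalization with respect to \<open>\<Delta>\<close> (with decomposition \<open>A\<close>) and \<open>T\<close>
  from some choice \<open>L\<close> of a finite generating set of loops.
\<close>

definition is_generalization ::
  "'b pair_pre_digraph \<Rightarrow> ('a \<Rightarrow> 'b set) \<Rightarrow> 'a list set \<Rightarrow> 'b sword set set \<Rightarrow> bool" where
  "is_generalization \<Delta> A T K \<longleftrightarrow>
     (\<exists>L. finite L \<and> L \<subseteq> edge_loops (rose_bar A T) Base \<and>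
          generate (graph_pi1 (rose_bar A T) Base)
              ((\<lambda>p. edge_homotopy (rose_bar A T) Base `` {p}) ` L)
            = carrier (graph_pi1 (rose_bar A T) Base) \<and>
          K = generate (racg \<Delta>) ((\<lambda>p. racg_word \<Delta> (rose_bar_label p)) ` L))"

section \<open>Closed surface subgroups\<close>

definition closed_surface :: "'a::t2_space set \<Rightarrow> bool" where
  "closed_surface S \<longleftrightarrow>
     S \<noteq> {} \<and> compact S \<and> Topological_Spaces.connected S \<and>
     (\<forall>x\<in>S. \<exists>U. openin (top_of_set S) U \<and> x \<in> U \<and> U homeomorphic (UNIV :: (real^2) set))"

definition loops_at :: "'a::topological_space set \<Rightarrow> 'a \<Rightarrow> (real \<Rightarrow> 'a) set" where
  "loops_at S x = {p. path p \<and> path_image p \<subseteq> S \<and> pathstart p = x \<and> pathfinish p = x}"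

definition fundamental_group ::
  "'a::topological_space set \<Rightarrow> 'a \<Rightarrow> (real \<Rightarrow> 'a) set monoid" where
  "fundamental_group S x =
     \<lparr> carrier = loops_at S x // {(p, q). homotopic_paths S p q},
       mult = (\<lambda>P Q. \<Union>p\<in>P. \<Union>q\<in>Q. {r. homotopic_paths S (p +++ q) r}),
       one = {r. homotopic_paths S (\<lambda>_. x) r} \<rparr>"

text \<open>
  A closed surface is a compact metrizable space, and every such space embeds into the
  Banach space of bounded real sequences. Hence, up to homeomorphism, the subsets of
  \<open>nat \<Rightarrow>\<^sub>C real\<close> below range over all closed surfaces.
\<close>

definition closed_surface_subgroup :: "('g, 'm) monoid_scheme \<Rightarrow> 'g set \<Rightarrow> bool" where
  "closed_surface_subgroup G K \<longleftrightarrow>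
     subgroup K G \<and>
     (\<exists>(S :: (nat \<Rightarrow>\<^sub>C real) set) x. closed_surface S \<and> x \<in> S \<and>
        infinite (carrier (fundamental_group S x)) \<and>
        G\<lparr>carrier := K\<rparr> \<cong> fundamental_group S x)"

end

theory Submission
  imports Defs
begin

text \<open>
  Write \<open>W\<^sub>\<Gamma>\<close> and \<open>W\<^sub>\<Delta>\<close> for the two Coxeter groups, and call a word over \<open>\<Delta>\<close> a \<^emph>\<open>lift\<close> of a
  word over \<open>\<Gamma>\<close> if its letters belong to the parts indexed by the letters of the latter. Sending
  each vertex of \<open>\<Delta>\<close> to its part induces a homomorphism \<open>W\<^sub>\<Delta> \<rightarrow> W\<^sub>\<Gamma>\<close> that takes the generalization
  \<open>K\<close> of \<open>H\<close> into \<open>H\<close>. The proof revolves around the words \<^emph>\<open>all\<close> of whose lifts lie in \<open>K\<close>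
  (\<open>all_lifts\<close>). Products of the given generators and their inverses have this property, because
  the edges of a petal of the rose can be replaced by arbitrary parallel ones. It survives the
  deletion of a square \<open>s s\<close>, and, which is the point, the exchange of two commuting letters \<open>s t\<close>:
  comparing the lifts of \<open>x s t y\<close> shows that a conjugate of \<open>K\<close> contains all products
  \<open>a b b' a'\<close> with \<open>a\<close>, \<open>a'\<close> in the part of \<open>s\<close> and \<open>b\<close>, \<open>b'\<close> in the part of \<open>t\<close>, and since the
  two parts span a connected graph these generate the kernel of the map of \<open>W\<^bsub>\<Delta>(s,t)\<^esub>\<close> onto the
  Klein four-group that records the numbers of letters of the two kinds modulo 2
  (\<open>commuting_squares\<close>), in particular the commutators \<open>b a b a\<close>.

  By Tits' solution of the word problem (\<open>tits_word_problem\<close>) such exchanges and deletions lead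
  from any word to every shortest word for the same element. So every lift of a shortest word for an
  element of \<open>H\<close> lies in \<open>K\<close>; it is again shortest, since the homomorphism to \<open>W\<^sub>\<Gamma>\<close> does not
  increase length. A quasiconvexity constant for \<open>K\<close> therefore projects to one for \<open>H\<close>
  (\<open>quasiconvex_descends\<close>), which settles the first claim. If no word with all lifts in \<open>K\<close> had
  two commuting neighbours, then only deletions would ever occur. These do not create new prefixes
  as group elements, so shortest words would stay close to \<open>H\<close> and \<open>H\<close> would be quasiconvex
  (\<open>commuting_pair_exists\<close>). Hence \<open>K\<close> contains a conjugate of the kernel mentioned above for some
  edge \<open>(s, t)\<close> of \<open>\<Gamma>\<close>.

  When \<open>\<Delta>(s,t)\<close> is a cycle of length \<open>n\<close>, this kernel is a surface group. Take a convex \<open>n\<close>-gon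
  whose sides are indexed by the vertices of the cycle, so that adjacent sides have commuting letters
  and belong to different parts. Doubling it along the sides of one kind and then along the sides of
  the other kind gives a closed surface \<open>S\<close> tiled by four copies of the polygon
  (\<open>mirrored_polygon\<close>). The union of the tiles around a corner is an open disc. A word over the cycle
  determines a gallery, that is, a path in \<open>S\<close> that crosses the sides named by its letters. Both sides of
  a defining relation can be compared inside the disc around one corner, so the homotopy class of a
  gallery depends on the group element only (\<open>gallery_cong\<close>), and a subdivision argument shows that every loop is
  homotopic to a gallery (\<open>loop_homotopic_gallery\<close>). Galleries of different elements are not
  homotopic: they lift to paths with different ends in the covering space of \<open>S\<close> that is
  assembled from one copy of the polygon for each element of \<open>W\<^sub>\<Delta>\<close> (\<open>covering_space_tiling\<close>).
\<close>


section \<open>Quotients of words by congruences\<close>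

text \<open>Both the group given by a presentation and the fundamental group of a graph arise in
  this way from a set of words that is closed under concatenation: by generators with signs
  in one case, by edge loops in the other. Left inverses of words are the only further
  ingredient that makes the quotient a group.\<close>

locale list_congruence =
  fixes L :: "'x list set" and r :: "('x list \<times> 'x list) set"
  assumes equiv: "equiv L r"
    and Nil_mem: "[] \<in> L"
    and append_mem: "u \<in> L \<Longrightarrow> v \<in> L \<Longrightarrow> u @ v \<in> L"
    and congr: "(u, u') \<in> r \<Longrightarrow> (v, v') \<in> r \<Longrightarrow> (u @ v, u' @ v') \<in> r"
    and left_inverse: "u \<in> L \<Longrightarrow> \<exists>v\<in>L. (v @ u, []) \<in> r"
begin

lemma carrier_list_quotient [simp]: "carrier (list_quotient L r) = L // r"
  by (simp add: list_quotient_def)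

lemma one_list_quotient [simp]: "\<one>\<^bsub>list_quotient L r\<^esub> = r `` {[]}"
  by (simp add: list_quotient_def)

lemma class_mem: "u \<in> L \<Longrightarrow> u \<in> r `` {u}"
  by (rule equiv_class_self[OF equiv])

lemma class_eq_iff: "u \<in> L \<Longrightarrow> v \<in> L \<Longrightarrow> r `` {u} = r `` {v} \<longleftrightarrow> (u, v) \<in> r"
  by (rule eq_equiv_class_iff[OF equiv])

lemma class_eqI: "(u, v) \<in> r \<Longrightarrow> r `` {u} = r `` {v}"
  by (rule equiv_class_eq[OF equiv])

lemma mult_class:
  assumes "u \<in> L" "v \<in> L"
  shows "r `` {u} \<otimes>\<^bsub>list_quotient L r\<^esub> r `` {v} = r `` {u @ v}"
proof -
  have "r `` {x @ y} = r `` {u @ v}" if "x \<in> r `` {u}" "y \<in> r `` {v}" for x y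
    using that congr[of u x v y] class_eqI[of "u @ v" "x @ y"] by simp
  moreover have "u \<in> r `` {u}" "v \<in> r `` {v}" using assms class_mem by auto
  ultimately have "(\<Union>x\<in>r `` {u}. \<Union>y\<in>r `` {v}. r `` {x @ y}) = r `` {u @ v}" by blast
  thus ?thesis by (simp add: list_quotient_def)
qed

lemma group_list_quotient: "Group.group (list_quotient L r)"
proof (rule groupI)
  fix X Y assume "X \<in> carrier (list_quotient L r)" "Y \<in> carrier (list_quotient L r)"
  then show "X \<otimes>\<^bsub>list_quotient L r\<^esub> Y \<in> carrier (list_quotient L r)"
    by (auto elim!: quotientE simp: mult_class append_mem intro!: quotientI)
next
  show "\<one>\<^bsub>list_quotient L r\<^esub> \<in> carrier (list_quotient L r)"
    by (auto intro: quotientI Nil_mem)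
next
  fix X Y Z assume "X \<in> carrier (list_quotient L r)" "Y \<in> carrier (list_quotient L r)"
    "Z \<in> carrier (list_quotient L r)"
  then show "X \<otimes>\<^bsub>list_quotient L r\<^esub> Y \<otimes>\<^bsub>list_quotient L r\<^esub> Z =
      X \<otimes>\<^bsub>list_quotient L r\<^esub> (Y \<otimes>\<^bsub>list_quotient L r\<^esub> Z)"
    by (auto elim!: quotientE simp: mult_class append_mem)
next
  fix X assume "X \<in> carrier (list_quotient L r)"
  then show "\<one>\<^bsub>list_quotient L r\<^esub> \<otimes>\<^bsub>list_quotient L r\<^esub> X = X"
    by (auto elim!: quotientE simp: mult_class Nil_mem)
next
  fix X assume "X \<in> carrier (list_quotient L r)"
  then obtain u where u: "u \<in> L" "X = r `` {u}" by (auto elim!: quotientE)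
  then obtain v where "v \<in> L" "(v @ u, []) \<in> r" using left_inverse by blast
  with u show "\<exists>Y\<in>carrier (list_quotient L r). Y \<otimes>\<^bsub>list_quotient L r\<^esub> X = \<one>\<^bsub>list_quotient L r\<^esub>"
    by (intro bexI[of _ "r `` {v}"]) (auto simp: mult_class class_eqI intro: quotientI)
qed

end

section \<open>Words in a right-angled Coxeter group\<close>

lemma pres_eq_mem: "(u, v) \<in> pres_eq S R \<Longrightarrow> u \<in> lists (S \<times> UNIV) \<and> v \<in> lists (S \<times> UNIV)"
  by (induction rule: pres_eq.induct) auto

lemma equiv_pres_eq: "equiv (lists (S \<times> UNIV)) (pres_eq S R)"
proof (rule equivI)
  show "pres_eq S R \<subseteq> lists (S \<times> UNIV) \<times> lists (S \<times> UNIV)" by (auto dest: pres_eq_mem)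
  show "refl_on (lists (S \<times> UNIV)) (pres_eq S R)" by (intro refl_onI pres_eq.refl)
  show "sym (pres_eq S R)" by (rule symI) (rule pres_eq.sym)
  show "trans (pres_eq S R)" by (rule transI) (rule pres_eq.trans)
qed

lemma pres_eq_context:
  assumes "(u, v) \<in> pres_eq S R" "x \<in> lists (S \<times> UNIV)" "y \<in> lists (S \<times> UNIV)"
  shows "(x @ u @ y, x @ v @ y) \<in> pres_eq S R"
  using assms(1)
proof (induction rule: pres_eq.induct)
  case (refl u)
  then show ?case using assms by (intro pres_eq.refl) auto
next
  case (cancel u v s b)
  then show ?case using assms pres_eq.cancel[of "x @ u" S "v @ y" s b R] by simp
next
  case (rel u v l r)
  then show ?case using assms pres_eq.rel[of "x @ u" S "v @ y" l r R] by simp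
next
  case (sym u v)
  show ?case by (rule pres_eq.sym) (rule sym.IH)
next
  case (trans u v w)
  show ?case by (rule pres_eq.trans) (rule trans.IH)+
qed

lemma pres_eq_append:
  assumes "(u, u') \<in> pres_eq S R" "(v, v') \<in> pres_eq S R"
  shows "(u @ v, u' @ v') \<in> pres_eq S R"
proof -
  have "(u @ v, u' @ v) \<in> pres_eq S R"
    using pres_eq_context[OF assms(1), of "[]" v] pres_eq_mem[OF assms(2)] by simp
  moreover have "(u' @ v, u' @ v') \<in> pres_eq S R"
    using pres_eq_context[OF assms(2), of u' "[]"] pres_eq_mem[OF assms(1)] by simp
  ultimately show ?thesis by (rule pres_eq.trans)
qed

lemma list_congruence_pres_eq: "list_congruence (lists (S \<times> UNIV)) (pres_eq S R)"
proof (intro list_congruence.intro equiv_pres_eq pres_eq_append)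
  fix u :: "('a \<times> bool) list" assume "u \<in> lists (S \<times> UNIV)"
  then show "\<exists>v\<in>lists (S \<times> UNIV). (v @ u, []) \<in> pres_eq S R"
  proof (induction u)
    case Nil
    then show ?case by (auto intro: pres_eq.refl)
  next
    case (Cons e u)
    then obtain v where v: "v \<in> lists (S \<times> UNIV)" "(v @ u, []) \<in> pres_eq S R" by auto
    obtain s b where e: "e = (s, b)" "s \<in> S" using Cons by (cases e) auto
    have "(v @ [(s, \<not> b), (s, \<not> \<not> b)] @ u, v @ u) \<in> pres_eq S R"
      using v e Cons by (intro pres_eq.cancel) auto
    from pres_eq.trans[OF this v(2)] show ?case
      using v(1) e by (intro bexI[of _ "v @ [(s, \<not> b)]"]) auto
  qed
qed simp_all

lemma group_racg: "Group.group (racg \<Gamma>)"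
  unfolding racg_def presented_group_def
  by (rule list_congruence.group_list_quotient[OF list_congruence_pres_eq])

abbreviation racg_rel where
  "racg_rel \<Gamma> \<equiv> pres_eq (pverts \<Gamma>) (racg_relations \<Gamma>)"

lemma map_True_lists [simp]: "map (\<lambda>s. (s, True)) w \<in> lists (V \<times> UNIV) \<longleftrightarrow> w \<in> lists V"
  by (auto simp: in_lists_conv_set)

lemma racg_word_append:
  assumes "u \<in> lists (pverts \<Gamma>)" "v \<in> lists (pverts \<Gamma>)"
  shows "racg_word \<Gamma> (u @ v) = racg_word \<Gamma> u \<otimes>\<^bsub>racg \<Gamma>\<^esub> racg_word \<Gamma> v"
  using list_congruence.mult_class[OF list_congruence_pres_eq, of "map (\<lambda>s. (s, True)) u"
      "pverts \<Gamma>" "map (\<lambda>s. (s, True)) v" "racg_relations \<Gamma>"] assms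
  by (simp add: racg_def presented_group_def racg_word_def)

lemma racg_word_Nil: "racg_word \<Gamma> [] = \<one>\<^bsub>racg \<Gamma>\<^esub>"
  by (simp add: racg_def presented_group_def racg_word_def list_quotient_def)

lemma racg_word_eq_iff:
  assumes "u \<in> lists (pverts \<Gamma>)" "v \<in> lists (pverts \<Gamma>)"
  shows "racg_word \<Gamma> u = racg_word \<Gamma> v \<longleftrightarrow>
    (map (\<lambda>s. (s, True)) u, map (\<lambda>s. (s, True)) v) \<in> racg_rel \<Gamma>"
  unfolding racg_word_def using assms
  by (intro list_congruence.class_eq_iff[OF list_congruence_pres_eq]) auto

text \<open>The signs of letters can be dropped, because a generator is its own inverse: \<open>s\<^sup>-\<^sup>1\<close>
  equals \<open>s\<^sup>-\<^sup>1 s s\<close> by the relation \<open>s s = 1\<close> and then \<open>s\<close> by free cancellation.\<close>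

lemma racg_rel_map_True:
  "u \<in> lists (pverts \<Gamma> \<times> UNIV) \<Longrightarrow> (u, map (\<lambda>s. (s, True)) (map fst u)) \<in> racg_rel \<Gamma>"
proof (induction u)
  case Nil
  then show ?case by (auto intro: pres_eq.refl)
next
  case (Cons e u)
  obtain s b where e: "e = (s, b)" "s \<in> pverts \<Gamma>" using Cons by (cases e) auto
  have "([(s, b)], [(s, True)]) \<in> racg_rel \<Gamma>"
  proof (cases b)
    case True then show ?thesis using e by (auto intro: pres_eq.refl)
  next
    case False
    have "([(s, False)] @ [(s, True), (s, True)] @ [], [(s, False)] @ [] @ []) \<in> racg_rel \<Gamma>"
      using e by (intro pres_eq.rel) (auto simp: racg_relations_def)
    moreover have "([] @ [(s, False), (s, \<not> False)] @ [(s, True)], [] @ [(s, True)]) \<in> racg_rel \<Gamma>"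
      using e by (intro pres_eq.cancel) auto
    ultimately show ?thesis using False pres_eq.trans[OF pres_eq.sym] by fastforce
  qed
  then have "([(s, b)] @ u, [(s, True)] @ map (\<lambda>s. (s, True)) (map fst u)) \<in> racg_rel \<Gamma>"
    using Cons by (intro pres_eq_append) auto
  then show ?case using e by simp
qed

lemma racg_carrier: "carrier (racg \<Gamma>) = racg_word \<Gamma> ` lists (pverts \<Gamma>)"
proof -
  have "racg_rel \<Gamma> `` {u} \<in> racg_word \<Gamma> ` lists (pverts \<Gamma>)"
    if "u \<in> lists (pverts \<Gamma> \<times> UNIV)" for u
    using list_congruence.class_eqI[OF list_congruence_pres_eq racg_rel_map_True[OF that]] that
    by (intro image_eqI[of _ _ "map fst u"]) (auto simp: racg_word_def in_lists_conv_set)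
  then have "lists (pverts \<Gamma> \<times> UNIV) // racg_rel \<Gamma> \<subseteq> racg_word \<Gamma> ` lists (pverts \<Gamma>)"
    by (auto elim!: quotientE)
  moreover have "racg_word \<Gamma> ` lists (pverts \<Gamma>) \<subseteq> lists (pverts \<Gamma> \<times> UNIV) // racg_rel \<Gamma>"
    by (auto simp: racg_word_def intro!: quotientI)
  ultimately show ?thesis by (simp add: racg_def presented_group_def list_quotient_def)
qed

lemma racg_word_carrier: "u \<in> lists (pverts \<Gamma>) \<Longrightarrow> racg_word \<Gamma> u \<in> carrier (racg \<Gamma>)"
  by (simp add: racg_carrier)

lemma racg_word_square:
  assumes "s \<in> pverts \<Gamma>" "u \<in> lists (pverts \<Gamma>)" "v \<in> lists (pverts \<Gamma>)"
  shows "racg_word \<Gamma> (u @ [s, s] @ v) = racg_word \<Gamma> (u @ v)"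
proof (subst racg_word_eq_iff)
  have "(map (\<lambda>s. (s, True)) u @ [(s, True), (s, True)] @ map (\<lambda>s. (s, True)) v,
      map (\<lambda>s. (s, True)) u @ [] @ map (\<lambda>s. (s, True)) v) \<in> racg_rel \<Gamma>"
    using assms by (intro pres_eq.rel) (auto simp: racg_relations_def)
  then show "(map (\<lambda>s. (s, True)) (u @ [s, s] @ v), map (\<lambda>s. (s, True)) (u @ v)) \<in> racg_rel \<Gamma>"
    by simp
qed (use assms in auto)

lemma racg_word_swap:
  assumes "(s, t) \<in> parcs \<Gamma>" "s \<in> pverts \<Gamma>" "t \<in> pverts \<Gamma>"
    and "u \<in> lists (pverts \<Gamma>)" "v \<in> lists (pverts \<Gamma>)"
  shows "racg_word \<Gamma> (u @ [s, t] @ v) = racg_word \<Gamma> (u @ [t, s] @ v)"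
proof (subst racg_word_eq_iff)
  have "(map (\<lambda>s. (s, True)) u @ [(s, True), (t, True)] @ map (\<lambda>s. (s, True)) v,
      map (\<lambda>s. (s, True)) u @ [(t, True), (s, True)] @ map (\<lambda>s. (s, True)) v) \<in> racg_rel \<Gamma>"
    using assms by (intro pres_eq.rel) (auto simp: racg_relations_def)
  then show "(map (\<lambda>s. (s, True)) (u @ [s, t] @ v), map (\<lambda>s. (s, True)) (u @ [t, s] @ v)) \<in> racg_rel \<Gamma>"
    by simp
qed (use assms in auto)

text \<open>Two words represent the same element only if they are related by every equivalence
  that absorbs the defining relations; invariants of elements are obtained in this way.\<close>

lemma racg_word_eq_induct:
  assumes eq: "racg_word \<Gamma> u = racg_word \<Gamma> v"
    and mem: "u \<in> lists (pverts \<Gamma>)" "v \<in> lists (pverts \<Gamma>)"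
    and refl: "\<And>u. u \<in> lists (pverts \<Gamma>) \<Longrightarrow> Q u u"
    and sym: "\<And>u v. Q u v \<Longrightarrow> Q v u"
    and trans: "\<And>u v w. Q u v \<Longrightarrow> Q v w \<Longrightarrow> Q u w"
    and square: "\<And>u v s. u \<in> lists (pverts \<Gamma>) \<Longrightarrow> v \<in> lists (pverts \<Gamma>) \<Longrightarrow> s \<in> pverts \<Gamma>
        \<Longrightarrow> Q (u @ [s, s] @ v) (u @ v)"
    and swap: "\<And>u v s t. u \<in> lists (pverts \<Gamma>) \<Longrightarrow> v \<in> lists (pverts \<Gamma>) \<Longrightarrow> (s, t) \<in> parcs \<Gamma>
        \<Longrightarrow> s \<in> pverts \<Gamma> \<Longrightarrow> t \<in> pverts \<Gamma> \<Longrightarrow> Q (u @ [s, t] @ v) (u @ [t, s] @ v)"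
  shows "Q u v"
proof -
  have "Q (map fst u) (map fst v)" if "(u, v) \<in> racg_rel \<Gamma>" for u v
    using that
  proof (induction rule: pres_eq.induct)
    case (refl u)
    then show ?case by (intro assms) (auto simp: in_lists_conv_set)
  next
    case (cancel u v s b)
    then show ?case using square[of "map fst u" "map fst v" s] by (force simp: in_lists_conv_set)
  next
    case (rel u v l r)
    then have "map fst u \<in> lists (pverts \<Gamma>)" "map fst v \<in> lists (pverts \<Gamma>)"
      by (force simp: in_lists_conv_set)+
    with rel square[of "map fst u" "map fst v"] swap[of "map fst u" "map fst v"] show ?case
      by (auto simp: racg_relations_def)
  next
    case (sym u v)
    show ?case by (rule assms(5)) (rule sym.IH)
  next
    case (trans u v w)
    show ?case by (rule assms(6)) (rule trans.IH)+
  qed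
  from this[OF eq[unfolded racg_word_eq_iff[OF mem]]] show ?thesis by (simp add: comp_def)
qed

lemma racg_word_rev:
  assumes "u \<in> lists (pverts \<Gamma>)"
  shows "racg_word \<Gamma> (rev u) = inv\<^bsub>racg \<Gamma>\<^esub> (racg_word \<Gamma> u)"
proof -
  interpret Group.group "racg \<Gamma>" by (rule group_racg)
  have "racg_word \<Gamma> (rev u @ u) = racg_word \<Gamma> []" using assms
  proof (induction u)
    case (Cons s u)
    then show ?case using racg_word_square[of s \<Gamma> "rev u" u] by (simp add: in_lists_conv_set)
  qed simp
  then have "racg_word \<Gamma> (rev u) \<otimes>\<^bsub>racg \<Gamma>\<^esub> racg_word \<Gamma> u = \<one>\<^bsub>racg \<Gamma>\<^esub>"
    using assms racg_word_append[of "rev u" \<Gamma> u] by (simp add: racg_word_Nil in_lists_conv_set)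
  then show ?thesis using assms
    by (intro inv_equality[symmetric]) (auto intro: racg_word_carrier simp: in_lists_conv_set)
qed

section \<open>The word problem\<close>

text \<open>To compare words, the letters of a word act one after the other, from right to left,
  on reduced words. A letter cancels an occurrence of itself that can be moved to the front
  by swaps of commuting neighbours, and is put in front if there is none. Up to swaps, this
  is an action of the Coxeter group, so the result of acting on the empty word is a normal
  form.\<close>

inductive swap_step :: "('a \<times> 'a) set \<Rightarrow> 'a list \<Rightarrow> 'a list \<Rightarrow> bool" for E where
  "(s, t) \<in> E \<Longrightarrow> swap_step E (x @ [s, t] @ y) (x @ [t, s] @ y)"

inductive tits_step :: "('a \<times> 'a) set \<Rightarrow> 'a list \<Rightarrow> 'a list \<Rightarrow> bool" for E where
  swap: "(s, t) \<in> E \<Longrightarrow> tits_step E (x @ [s, t] @ y) (x @ [t, s] @ y)"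
| delete: "tits_step E (x @ [s, s] @ y) (x @ y)"

text \<open>The occurrence that is removed is the first one, and it can be moved to the front
  exactly if \<open>s\<close> commutes with all letters before it.\<close>

fun cancel_letter :: "('a \<times> 'a) set \<Rightarrow> 'a \<Rightarrow> 'a list \<Rightarrow> 'a list option" where
  "cancel_letter E s [] = None"
| "cancel_letter E s (t # w) =
    (if t = s then Some w else if (s, t) \<in> E then map_option ((#) t) (cancel_letter E s w) else None)"

definition act_letter :: "('a \<times> 'a) set \<Rightarrow> 'a \<Rightarrow> 'a list \<Rightarrow> 'a list" where
  "act_letter E s w = (case cancel_letter E s w of Some w' \<Rightarrow> w' | None \<Rightarrow> s # w)"

definition normal_word :: "('a \<times> 'a) set \<Rightarrow> 'a list \<Rightarrow> 'a list" where
  "normal_word E u = foldr (act_letter E) u []"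

fun reduced :: "('a \<times> 'a) set \<Rightarrow> 'a list \<Rightarrow> bool" where
  "reduced E [] = True"
| "reduced E (s # w) \<longleftrightarrow> cancel_letter E s w = None \<and> reduced E w"

lemma swap_step_Cons: "swap_step E u v \<Longrightarrow> swap_step E (s # u) (s # v)"
proof (erule swap_step.cases)
  fix a b x y assume "u = x @ [a, b] @ y" "v = x @ [b, a] @ y" "(a, b) \<in> E"
  then show ?thesis using swap_step.intros[of a b E "s # x" y] by simp
qed

lemma tits_step_Cons: "tits_step E u v \<Longrightarrow> tits_step E (s # u) (s # v)"
proof (erule tits_step.cases)
  fix a b x y assume "u = x @ [a, b] @ y" "v = x @ [b, a] @ y" "(a, b) \<in> E"
  then show ?thesis using tits_step.swap[of a b E "s # x" y] by simp
next
  fix a x y assume "u = x @ [a, a] @ y" "v = x @ y"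
  then show ?thesis using tits_step.delete[of E "s # x" a y] by simp
qed

lemma swap_steps_Cons: "(swap_step E)\<^sup>*\<^sup>* u v \<Longrightarrow> (swap_step E)\<^sup>*\<^sup>* (s # u) (s # v)"
  by (induction rule: rtranclp_induct) (auto intro: swap_step_Cons rtranclp.rtrancl_into_rtrancl)

lemma tits_steps_Cons: "(tits_step E)\<^sup>*\<^sup>* u v \<Longrightarrow> (tits_step E)\<^sup>*\<^sup>* (s # u) (s # v)"
  by (induction rule: rtranclp_induct) (auto intro: tits_step_Cons rtranclp.rtrancl_into_rtrancl)

lemma swap_steps_imp_tits_steps: "(swap_step E)\<^sup>*\<^sup>* u v \<Longrightarrow> (tits_step E)\<^sup>*\<^sup>* u v"
proof (induction rule: rtranclp_induct)
  case (step v w)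
  from step(2) have "tits_step E v w" by cases (simp only: tits_step.swap)
  with step.IH show ?case by (rule rtranclp.rtrancl_into_rtrancl)
qed simp

lemma swap_steps_sym:
  assumes "sym E" "(swap_step E)\<^sup>*\<^sup>* u v"
  shows "(swap_step E)\<^sup>*\<^sup>* v u"
proof -
  have "symp (swap_step E)"
    by (rule sympI, erule swap_step.cases) (auto intro: swap_step.intros[simplified] symD[OF assms(1)])
  then have "symp (swap_step E)\<^sup>*\<^sup>*" by (rule symp_rtranclp)
  then show ?thesis using assms(2) by (rule sympD)
qed

lemma swap_steps_length: "(swap_step E)\<^sup>*\<^sup>* u v \<Longrightarrow> length u = length v"
  by (induction rule: rtranclp_induct) (auto elim!: swap_step.cases)

locale commutation =
  fixes E :: "('a \<times> 'a) set"
  assumes sym_E: "sym E" and irrefl_E: "irrefl E"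
begin

lemma E_sym: "(s, t) \<in> E \<Longrightarrow> (t, s) \<in> E"
  using sym_E by (rule symD)

lemma E_neq: "(s, t) \<in> E \<Longrightarrow> s \<noteq> t"
  using irrefl_E by (auto simp: irrefl_def)

abbreviation swaps (infix "\<simeq>" 50) where "swaps \<equiv> (swap_step E)\<^sup>*\<^sup>*"

lemma cancel_letter_swaps: "cancel_letter E s w = Some w' \<Longrightarrow> w \<simeq> s # w'"
proof (induction w arbitrary: w')
  case (Cons t w)
  show ?case
  proof (cases "t = s")
    case False
    with Cons.prems obtain v where v: "(s, t) \<in> E" "cancel_letter E s w = Some v" "w' = t # v"
      by (auto split: if_splits)
    then have "t # w \<simeq> t # s # v" by (intro swap_steps_Cons Cons.IH)
    moreover have "swap_step E ([] @ [t, s] @ v) ([] @ [s, t] @ v)"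
      using E_sym[OF v(1)] by (rule swap_step.intros)
    ultimately show ?thesis using v by (simp add: rtranclp.rtrancl_into_rtrancl)
  qed (use Cons in auto)
qed simp

lemma cancel_letter_swap_step:
  assumes "swap_step E u v"
  shows "rel_option (\<simeq>) (cancel_letter E s u) (cancel_letter E s v)"
  using assms
proof (cases rule: swap_step.cases)
  case (1 a b x y)
  have "rel_option (\<simeq>) (cancel_letter E s (x @ [a, b] @ y)) (cancel_letter E s (x @ [b, a] @ y))"
  proof (induction x)
    case Nil
    have "a \<noteq> b" "(b, a) \<in> E" using 1 E_sym E_neq by auto
    moreover have "a # b # w \<simeq> b # a # w" for w
      using swap_step.intros[of a b E "[]" w] 1 by auto
    moreover have "a = s \<or> b = s \<or> a \<noteq> s \<and> b \<noteq> s" by blast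
    ultimately show ?case using 1
      by (cases "cancel_letter E s y") (elim disjE; simp)+
  next
    case (Cons t x)
    have "t # x @ a # b # y \<simeq> t # x @ b # a # y" "x @ a # b # y \<simeq> x @ b # a # y"
      using swap_step.intros[of a b E "t # x" y] swap_step.intros[of a b E x y] 1 by auto
    with Cons show ?case
      by (auto simp: option.rel_map intro: swap_steps_Cons option.rel_mono_strong)
  qed
  with 1 show ?thesis by simp
qed

lemma cancel_letter_swaps_cong:
  "u \<simeq> v \<Longrightarrow> rel_option (\<simeq>) (cancel_letter E s u) (cancel_letter E s v)"
proof (induction rule: rtranclp_induct)
  case base
  show ?case by (auto intro: option.rel_refl)
next
  case (step v w)
  show ?case using step.IH cancel_letter_swap_step[OF step(2), of s]
    by (auto simp: option_rel_Some1 option_rel_Some2 rel_option_iff split: option.splits)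
qed

lemma act_letter_cong: "u \<simeq> v \<Longrightarrow> act_letter E s u \<simeq> act_letter E s v"
  using cancel_letter_swaps_cong[of u v s]
  by (auto simp: act_letter_def rel_option_iff split: option.splits intro: swap_steps_Cons)

lemma foldr_act_letter_cong: "u \<simeq> v \<Longrightarrow> foldr (act_letter E) x u \<simeq> foldr (act_letter E) x v"
  by (induction x) (auto intro: act_letter_cong)

lemma reduced_swap_step:
  assumes "swap_step E u v" "reduced E u"
  shows "reduced E v"
  using assms(1)
proof (cases rule: swap_step.cases)
  case (1 a b x y)
  have "a \<noteq> b" "(b, a) \<in> E" using 1 E_sym E_neq by auto
  have "reduced E (x @ [a, b] @ y) \<Longrightarrow> reduced E (x @ [b, a] @ y)"
  proof (induction x)
    case Nil
    then show ?case using \<open>a \<noteq> b\<close> 1 \<open>(b, a) \<in> E\<close> by (auto split: if_splits)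
  next
    case (Cons t x)
    have "swap_step E (x @ [a, b] @ y) (x @ [b, a] @ y)" using 1 by (intro swap_step.intros)
    from cancel_letter_swap_step[OF this, of t] Cons show ?case by auto
  qed
  with 1 assms show ?thesis by simp
qed

lemma reduced_swaps: "u \<simeq> v \<Longrightarrow> reduced E u \<Longrightarrow> reduced E v"
  by (induction rule: rtranclp_induct) (auto intro: reduced_swap_step)

lemma reduced_act_letter: "reduced E w \<Longrightarrow> reduced E (act_letter E s w)"
proof (cases "cancel_letter E s w")
  case (Some w')
  assume "reduced E w"
  with reduced_swaps[OF cancel_letter_swaps[OF Some]] Some show ?thesis by (simp add: act_letter_def)
qed (simp add: act_letter_def)

lemma reduced_normal_word: "reduced E (foldr (act_letter E) u [])"
  by (induction u) (auto intro: reduced_act_letter)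

text \<open>Reducedness matters here: on the word \<open>s s\<close>, which is not reduced, acting twice with
  \<open>s\<close> gives the empty word.\<close>

lemma act_letter_twice:
  assumes "reduced E w"
  shows "act_letter E s (act_letter E s w) \<simeq> w"
proof (cases "cancel_letter E s w")
  case (Some w')
  then have w: "w \<simeq> s # w'" by (rule cancel_letter_swaps)
  with assms have "reduced E (s # w')" by (rule reduced_swaps[rotated])
  with Some swap_steps_sym[OF sym_E w] show ?thesis by (simp add: act_letter_def)
qed (simp add: act_letter_def)

lemma act_letter_commute:
  assumes st: "(s, t) \<in> E"
  shows "act_letter E s (act_letter E t w) \<simeq> act_letter E t (act_letter E s w)"
proof -
  have ts: "(t, s) \<in> E" "s \<noteq> t" using E_sym[OF st] E_neq[OF st] by auto
  have None: "cancel_letter E b v = None"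
    if "cancel_letter E a w = Some v" "cancel_letter E b w = None" "(b, a) \<in> E" "a \<noteq> b" for a b v
    using cancel_letter_swaps_cong[OF cancel_letter_swaps[OF that(1)], of b] that(2-) by simp
  show ?thesis
  proof (cases "cancel_letter E s w"; cases "cancel_letter E t w")
    assume "cancel_letter E s w = None" "cancel_letter E t w = None"
    then show ?thesis using st ts swap_step.intros[OF st, of "[]" w]
      by (auto simp: act_letter_def)
  next
    fix v assume "cancel_letter E s w = None" "cancel_letter E t w = Some v"
    then show ?thesis using None[of t v s] st ts by (auto simp: act_letter_def)
  next
    fix v assume "cancel_letter E s w = Some v" "cancel_letter E t w = None"
    then show ?thesis using None[of s v t] st ts by (auto simp: act_letter_def)
  next
    fix v v' assume v: "cancel_letter E s w = Some v" "cancel_letter E t w = Some v'"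
    from cancel_letter_swaps_cong[OF cancel_letter_swaps[OF v(1)], of t] v(2) ts
    obtain x where x: "cancel_letter E t v = Some x" "v' \<simeq> s # x"
      by (auto simp: rel_option_iff split: option.splits)
    from act_letter_cong[OF x(2), of s] have "act_letter E s v' \<simeq> x"
      by (simp add: act_letter_def)
    then show ?thesis using v x by (simp add: act_letter_def)
  qed
qed

lemma normal_word_steps: "(tits_step E)\<^sup>*\<^sup>* u (normal_word E u)"
proof (induction u)
  case (Cons s u)
  let ?n = "normal_word E u"
  have "(tits_step E)\<^sup>*\<^sup>* (s # u) (s # ?n)" using Cons.IH by (rule tits_steps_Cons)
  moreover have "(tits_step E)\<^sup>*\<^sup>* (s # ?n) (act_letter E s ?n)"
  proof (cases "cancel_letter E s ?n")
    case (Some w)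
    then have "(tits_step E)\<^sup>*\<^sup>* (s # ?n) (s # s # w)"
      by (intro tits_steps_Cons swap_steps_imp_tits_steps cancel_letter_swaps)
    moreover have "tits_step E ([] @ [s, s] @ w) ([] @ w)" by (rule tits_step.delete)
    ultimately show ?thesis using Some
      by (simp add: act_letter_def rtranclp.rtrancl_into_rtrancl)
  qed (simp add: act_letter_def)
  ultimately show ?case by (simp add: normal_word_def)
qed (simp add: normal_word_def)

lemma normal_word_reduced: "reduced E w \<Longrightarrow> normal_word E w = w"
  by (induction w) (auto simp: normal_word_def act_letter_def)

lemma tits_steps_short:
  assumes "(tits_step E)\<^sup>*\<^sup>* w v"
  shows "w \<simeq> v \<or> length v < length w"
  using assms
proof (induction rule: rtranclp_induct)
  case (step v u)
  from step(2) show ?case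
  proof cases
    case (swap s t x y)
    then have "swap_step E v u" by (simp only: swap_step.intros)
    with step.IH swap show ?thesis by (auto intro: rtranclp.rtrancl_into_rtrancl)
  next
    case (delete x s y)
    with step.IH show ?thesis by (auto dest: swap_steps_length)
  qed
qed simp

end

lemma commutation_pair_graph:
  assumes "pair_graph \<Gamma>"
  shows "commutation (parcs \<Gamma>)"
proof -
  interpret pair_graph \<Gamma> by fact
  show ?thesis
  proof
    show "sym (parcs \<Gamma>)" using pair_sym_arcs by (simp add: symmetric_def)
    show "irrefl (parcs \<Gamma>)" using pair_no_loops by (fastforce simp: irrefl_def)
  qed
qed

lemma tits_steps_lists:
  "(tits_step E)\<^sup>*\<^sup>* u v \<Longrightarrow> u \<in> lists V \<Longrightarrow> v \<in> lists V"
  by (induction rule: rtranclp_induct) (auto elim!: tits_step.cases)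

lemma tits_steps_racg_word:
  assumes "(tits_step (parcs \<Gamma>))\<^sup>*\<^sup>* u v" "u \<in> lists (pverts \<Gamma>)"
  shows "racg_word \<Gamma> u = racg_word \<Gamma> v"
  using assms
proof (induction rule: rtranclp_induct)
  case (step v w)
  then have v: "v \<in> lists (pverts \<Gamma>)" using tits_steps_lists by blast
  from step(2) have "racg_word \<Gamma> v = racg_word \<Gamma> w"
  proof cases
    case (swap s t x y)
    then show ?thesis using racg_word_swap[of s t \<Gamma> x y] v by simp
  next
    case (delete x s y)
    then show ?thesis using racg_word_square[of s \<Gamma> x y] v by simp
  qed
  with step show ?case by simp
qed simp

lemma racg_word_normal_word:
  assumes "pair_graph \<Gamma>" "racg_word \<Gamma> u = racg_word \<Gamma> v"
    and "u \<in> lists (pverts \<Gamma>)" "v \<in> lists (pverts \<Gamma>)"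
  shows "(swap_step (parcs \<Gamma>))\<^sup>*\<^sup>* (normal_word (parcs \<Gamma>) u) (normal_word (parcs \<Gamma>) v)"
proof -
  interpret commutation "parcs \<Gamma>" using assms(1) by (rule commutation_pair_graph)
  let ?eq = "\<lambda>u v. (swap_step (parcs \<Gamma>))\<^sup>*\<^sup>* (normal_word (parcs \<Gamma>) u) (normal_word (parcs \<Gamma>) v)"
  show ?thesis using assms(2-4)
  proof (rule racg_word_eq_induct[where Q = ?eq])
    fix u v s show "?eq (u @ [s, s] @ v) (u @ v)"
      by (auto simp: normal_word_def intro!: foldr_act_letter_cong act_letter_twice reduced_normal_word)
  next
    fix u v s t assume "(s, t) \<in> parcs \<Gamma>"
    then show "?eq (u @ [s, t] @ v) (u @ [t, s] @ v)"
      by (auto simp: normal_word_def intro!: foldr_act_letter_cong act_letter_commute)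
  next
    fix u v assume "?eq u v"
    then show "?eq v u" by (rule swap_steps_sym[OF sym_E])
  next
    fix u v w assume "?eq u v"
      "?eq v w"
    then show "?eq u w" by (rule rtranclp_trans)
  qed simp
qed

definition shortest_word :: "'a pair_pre_digraph \<Rightarrow> 'a list \<Rightarrow> bool" where
  "shortest_word \<Gamma> w \<longleftrightarrow> w \<in> lists (pverts \<Gamma>) \<and>
     (\<forall>v\<in>lists (pverts \<Gamma>). racg_word \<Gamma> v = racg_word \<Gamma> w \<longrightarrow> length w \<le> length v)"

text \<open>The way from \<open>w\<close> to its normal form cannot involve deletions because \<open>w\<close> is shortest.
  It consists of swaps and can be reversed. So one can go from \<open>u\<close> to its normal form, on to
  the normal form of \<open>w\<close> by swaps, and back to \<open>w\<close>.\<close>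

theorem tits_word_problem:
  assumes "pair_graph \<Gamma>" "racg_word \<Gamma> u = racg_word \<Gamma> w"
    and "u \<in> lists (pverts \<Gamma>)" "shortest_word \<Gamma> w"
  shows "(tits_step (parcs \<Gamma>))\<^sup>*\<^sup>* u w"
proof -
  interpret commutation "parcs \<Gamma>" using assms(1) by (rule commutation_pair_graph)
  let ?n = "normal_word (parcs \<Gamma>)"
  have w: "w \<in> lists (pverts \<Gamma>)" using assms(4) by (simp add: shortest_word_def)
  have "racg_word \<Gamma> (?n w) = racg_word \<Gamma> w" "?n w \<in> lists (pverts \<Gamma>)"
    using tits_steps_racg_word[OF normal_word_steps w] tits_steps_lists[OF normal_word_steps w] by auto
  then have "(swap_step (parcs \<Gamma>))\<^sup>*\<^sup>* w (?n w)" using tits_steps_short[OF normal_word_steps, of w] assms(4)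
    by (auto simp: shortest_word_def)
  then have "(swap_step (parcs \<Gamma>))\<^sup>*\<^sup>* (?n w) w" by (rule swap_steps_sym[OF sym_E])
  with racg_word_normal_word[OF assms(1-3) w] have "(swap_step (parcs \<Gamma>))\<^sup>*\<^sup>* (?n u) w" by (rule rtranclp_trans)
  with normal_word_steps[of u] show ?thesis
    by (meson rtranclp_trans swap_steps_imp_tits_steps)
qed


section \<open>Quasiconvexity in terms of words\<close>

abbreviation racg_cayley where
  "racg_cayley \<Gamma> \<equiv> with_proj (cayley_graph (racg \<Gamma>) (racg_gens \<Gamma>))"

lemma awalk_cayley_iff:
  "pre_digraph.awalk (racg_cayley \<Gamma>) g p h \<longleftrightarrow>
    g \<in> carrier (racg \<Gamma>) \<and> set p \<subseteq> parcs (cayley_graph (racg \<Gamma>) (racg_gens \<Gamma>)) \<and> pcas g p h"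
  by (simp add: pre_digraph.awalk_def cas_with_proj_eq) (simp add: cayley_graph_def)

lemma cayley_arc_iff:
  "(g, h) \<in> parcs (cayley_graph (racg \<Gamma>) (racg_gens \<Gamma>)) \<longleftrightarrow>
    g \<in> carrier (racg \<Gamma>) \<and> (\<exists>s\<in>pverts \<Gamma>. h = g \<otimes>\<^bsub>racg \<Gamma>\<^esub> racg_word \<Gamma> [s])"
proof -
  interpret Group.group "racg \<Gamma>" by (rule group_racg)
  have sq: "racg_word \<Gamma> [s] \<otimes>\<^bsub>racg \<Gamma>\<^esub> racg_word \<Gamma> [s] = \<one>\<^bsub>racg \<Gamma>\<^esub>" if "s \<in> pverts \<Gamma>" for s
    using racg_word_append[of "[s]" \<Gamma> "[s]"] racg_word_square[of s \<Gamma> "[]" "[]"] that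
    by (simp add: racg_word_Nil)
  have rev_arc: "h = g \<otimes>\<^bsub>racg \<Gamma>\<^esub> racg_word \<Gamma> [s]"
    if "g = h \<otimes>\<^bsub>racg \<Gamma>\<^esub> racg_word \<Gamma> [s]" "s \<in> pverts \<Gamma>" "h \<in> carrier (racg \<Gamma>)" for g h s
    using that by (simp add: m_assoc racg_word_carrier sq)
  show ?thesis
  proof
    assume "(g, h) \<in> parcs (cayley_graph (racg \<Gamma>) (racg_gens \<Gamma>))"
    then obtain s where s: "g \<in> carrier (racg \<Gamma>)" "h \<in> carrier (racg \<Gamma>)" "s \<in> pverts \<Gamma>"
      "h = g \<otimes>\<^bsub>racg \<Gamma>\<^esub> racg_word \<Gamma> [s] \<or> g = h \<otimes>\<^bsub>racg \<Gamma>\<^esub> racg_word \<Gamma> [s]"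
      unfolding cayley_graph_def racg_gens_def by auto
    from s(4) have "h = g \<otimes>\<^bsub>racg \<Gamma>\<^esub> racg_word \<Gamma> [s]"
      using rev_arc[OF _ s(3,2)] by blast
    with s show "g \<in> carrier (racg \<Gamma>) \<and> (\<exists>s\<in>pverts \<Gamma>. h = g \<otimes>\<^bsub>racg \<Gamma>\<^esub> racg_word \<Gamma> [s])"
      by blast
  qed (auto simp: cayley_graph_def racg_gens_def racg_word_carrier)
qed

definition prefix_points :: "'a pair_pre_digraph \<Rightarrow> 'a sword set \<Rightarrow> 'a list \<Rightarrow> 'a sword set set" where
  "prefix_points \<Gamma> g w = (\<lambda>k. g \<otimes>\<^bsub>racg \<Gamma>\<^esub> racg_word \<Gamma> (take k w)) ` {..length w}"

lemma prefix_points_Cons: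
  assumes "s \<in> pverts \<Gamma>" "w \<in> lists (pverts \<Gamma>)" "g \<in> carrier (racg \<Gamma>)"
  shows "prefix_points \<Gamma> g (s # w) = insert g (prefix_points \<Gamma> (g \<otimes>\<^bsub>racg \<Gamma>\<^esub> racg_word \<Gamma> [s]) w)"
proof -
  interpret Group.group "racg \<Gamma>" by (rule group_racg)
  have take: "take k w \<in> lists (pverts \<Gamma>)" for k using assms(2) by (auto dest: in_set_takeD)
  have "g \<otimes>\<^bsub>racg \<Gamma>\<^esub> racg_word \<Gamma> [s] \<otimes>\<^bsub>racg \<Gamma>\<^esub> racg_word \<Gamma> (take k w) =
      g \<otimes>\<^bsub>racg \<Gamma>\<^esub> racg_word \<Gamma> (s # take k w)" for k
    using assms racg_word_append[of "[s]" \<Gamma> "take k w"] take[of k]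
    by (simp add: m_assoc racg_word_carrier)
  moreover have "{..length (s # w)} = insert 0 (Suc ` {..length w})"
    by (simp add: atMost_Suc_eq_insert_0)
  ultimately show ?thesis
    by (simp only: prefix_points_def image_insert image_image take_0 take_Suc_Cons racg_word_Nil
        r_one[OF assms(3)])
qed

lemma cayley_walk_of_word:
  assumes "w \<in> lists (pverts \<Gamma>)" "g \<in> carrier (racg \<Gamma>)"
  shows "\<exists>p. pre_digraph.awalk (racg_cayley \<Gamma>) g p (g \<otimes>\<^bsub>racg \<Gamma>\<^esub> racg_word \<Gamma> w) \<and>
    length p = length w \<and> set (pre_digraph.awalk_verts (racg_cayley \<Gamma>) g p) = prefix_points \<Gamma> g w"
  using assms
proof (induction w arbitrary: g rule: list.induct)
  case Nil
  interpret Group.group "racg \<Gamma>" by (rule group_racg)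
  from Nil show ?case
    by (intro exI[of _ "[]"])
      (simp add: awalk_cayley_iff awalk_verts_with_proj_eq prefix_points_def racg_word_Nil)
next
  case (Cons s w)
  interpret Group.group "racg \<Gamma>" by (rule group_racg)
  let ?g = "g \<otimes>\<^bsub>racg \<Gamma>\<^esub> racg_word \<Gamma> [s]"
  have s: "s \<in> pverts \<Gamma>" "w \<in> lists (pverts \<Gamma>)" using Cons.prems by auto
  have g: "?g \<in> carrier (racg \<Gamma>)" using Cons.prems s by (simp add: racg_word_carrier)
  have eq: "?g \<otimes>\<^bsub>racg \<Gamma>\<^esub> racg_word \<Gamma> w = g \<otimes>\<^bsub>racg \<Gamma>\<^esub> racg_word \<Gamma> (s # w)"
    using Cons.prems s racg_word_append[of "[s]" \<Gamma> w] by (simp add: m_assoc racg_word_carrier)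
  from Cons.IH[OF s(2) g] obtain p where p:
    "pre_digraph.awalk (racg_cayley \<Gamma>) ?g p (?g \<otimes>\<^bsub>racg \<Gamma>\<^esub> racg_word \<Gamma> w)"
    "length p = length w" "set (pre_digraph.awalk_verts (racg_cayley \<Gamma>) ?g p) = prefix_points \<Gamma> ?g w"
    by blast
  have "(g, ?g) \<in> parcs (cayley_graph (racg \<Gamma>) (racg_gens \<Gamma>))"
    using Cons.prems s by (auto simp: cayley_arc_iff)
  with p Cons.prems s show ?case unfolding eq
    by (intro exI[of _ "(g, ?g) # p"])
      (simp add: awalk_cayley_iff awalk_verts_with_proj_eq prefix_points_Cons)
qed

lemma word_of_cayley_walk:
  assumes "pre_digraph.awalk (racg_cayley \<Gamma>) g p h"
  shows "\<exists>w\<in>lists (pverts \<Gamma>). h = g \<otimes>\<^bsub>racg \<Gamma>\<^esub> racg_word \<Gamma> w \<and> length w = length p \<and>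
    set (pre_digraph.awalk_verts (racg_cayley \<Gamma>) g p) = prefix_points \<Gamma> g w"
  using assms
proof (induction p arbitrary: g)
  case Nil
  interpret Group.group "racg \<Gamma>" by (rule group_racg)
  from Nil show ?case
    by (intro bexI[of _ "[]"])
      (auto simp: awalk_cayley_iff awalk_verts_with_proj_eq prefix_points_def racg_word_Nil)
next
  case (Cons e p)
  interpret Group.group "racg \<Gamma>" by (rule group_racg)
  obtain g' where e: "e = (g, g')" "(g, g') \<in> parcs (cayley_graph (racg \<Gamma>) (racg_gens \<Gamma>))"
    using Cons.prems by (cases e) (auto simp: awalk_cayley_iff)
  then obtain s where s: "s \<in> pverts \<Gamma>" "g \<in> carrier (racg \<Gamma>)"
    "g' = g \<otimes>\<^bsub>racg \<Gamma>\<^esub> racg_word \<Gamma> [s]" by (auto simp: cayley_arc_iff)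
  have "pre_digraph.awalk (racg_cayley \<Gamma>) g' p h"
    using Cons.prems e s by (auto simp: awalk_cayley_iff racg_word_carrier)
  from Cons.IH[OF this] obtain w where w: "w \<in> lists (pverts \<Gamma>)"
    "h = g' \<otimes>\<^bsub>racg \<Gamma>\<^esub> racg_word \<Gamma> w" "length w = length p"
    "set (pre_digraph.awalk_verts (racg_cayley \<Gamma>) g' p) = prefix_points \<Gamma> g' w" by blast
  have "h = g \<otimes>\<^bsub>racg \<Gamma>\<^esub> racg_word \<Gamma> (s # w)"
    using w s racg_word_append[of "[s]" \<Gamma> w] by (simp add: m_assoc racg_word_carrier)
  with w s e show ?case
    by (intro bexI[of _ "s # w"]) (auto simp: awalk_verts_with_proj_eq prefix_points_Cons)
qed

text \<open>Since the Cayley graph and \<open>H\<close> are invariant under left translation by elements of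
  \<open>H\<close>, geodesics between elements of \<open>H\<close> may be assumed to start at the identity. Their
  labels are then the shortest words for the elements of \<open>H\<close>, and a vertex lies within
  distance \<open>r\<close> of \<open>H\<close> if the corresponding prefix can be completed to an element of \<open>H\<close> by a
  word of length at most \<open>r\<close>.\<close>

definition word_quasiconvex :: "'a pair_pre_digraph \<Rightarrow> 'a sword set set \<Rightarrow> bool" where
  "word_quasiconvex \<Gamma> H \<longleftrightarrow>
     (\<exists>r. \<forall>w. shortest_word \<Gamma> w \<and> racg_word \<Gamma> w \<in> H \<longrightarrow>
        (\<forall>k\<le>length w. \<exists>v\<in>lists (pverts \<Gamma>). length v \<le> r \<and> racg_word \<Gamma> (take k w @ v) \<in> H))"

lemma quasiconvex_imp_word_quasiconvex:
  assumes H: "subgroup H (racg \<Gamma>)" and qc: "quasiconvex (racg \<Gamma>) (racg_gens \<Gamma>) H"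
  shows "word_quasiconvex \<Gamma> H"
proof -
  interpret Group.group "racg \<Gamma>" by (rule group_racg)
  from qc obtain r where r: "\<And>g h p. g \<in> H \<Longrightarrow> h \<in> H \<Longrightarrow> geodesic (racg_cayley \<Gamma>) g p h \<Longrightarrow>
      set (pre_digraph.awalk_verts (racg_cayley \<Gamma>) g p) \<subseteq> graph_nbhd (racg_cayley \<Gamma>) H r"
    unfolding quasiconvex_def by blast
  have "\<exists>v\<in>lists (pverts \<Gamma>). length v \<le> r \<and> racg_word \<Gamma> (take k w @ v) \<in> H"
    if w: "shortest_word \<Gamma> w" "racg_word \<Gamma> w \<in> H" and k: "k \<le> length w" for w k
  proof -
    have wl: "w \<in> lists (pverts \<Gamma>)" using w(1) by (simp add: shortest_word_def)
    then have tl: "take k w \<in> lists (pverts \<Gamma>)" by (auto dest: in_set_takeD)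
    obtain p where p: "pre_digraph.awalk (racg_cayley \<Gamma>) \<one>\<^bsub>racg \<Gamma>\<^esub> p (racg_word \<Gamma> w)"
      "length p = length w"
      "set (pre_digraph.awalk_verts (racg_cayley \<Gamma>) \<one>\<^bsub>racg \<Gamma>\<^esub> p) = prefix_points \<Gamma> \<one>\<^bsub>racg \<Gamma>\<^esub> w"
      using cayley_walk_of_word[OF wl one_closed] by (auto simp: racg_word_carrier wl)
    have "length p \<le> length q" if "pre_digraph.awalk (racg_cayley \<Gamma>) \<one>\<^bsub>racg \<Gamma>\<^esub> q (racg_word \<Gamma> w)" for q
      using word_of_cayley_walk[OF that] w(1) p(2)
      by (auto simp: shortest_word_def racg_word_carrier)
    then have "geodesic (racg_cayley \<Gamma>) \<one>\<^bsub>racg \<Gamma>\<^esub> p (racg_word \<Gamma> w)"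
      using p(1) by (auto simp: geodesic_def)
    from r[OF subgroup.one_closed[OF H] w(2) this]
    have "prefix_points \<Gamma> \<one>\<^bsub>racg \<Gamma>\<^esub> w \<subseteq> graph_nbhd (racg_cayley \<Gamma>) H r" by (simp add: p(3))
    moreover have "racg_word \<Gamma> (take k w) \<in> prefix_points \<Gamma> \<one>\<^bsub>racg \<Gamma>\<^esub> w"
      unfolding prefix_points_def using k l_one[OF racg_word_carrier[OF tl]]
      by (intro image_eqI[of _ _ k]) simp_all
    ultimately obtain u q where u: "u \<in> H" "pre_digraph.awalk (racg_cayley \<Gamma>) u q (racg_word \<Gamma> (take k w))"
      "length q \<le> r" by (auto simp: graph_nbhd_def)
    obtain v where v: "v \<in> lists (pverts \<Gamma>)" "length v = length q"
      "racg_word \<Gamma> (take k w) = u \<otimes>\<^bsub>racg \<Gamma>\<^esub> racg_word \<Gamma> v"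
      using word_of_cayley_walk[OF u(2)] by blast
    have uc: "u \<in> carrier (racg \<Gamma>)" by (rule subgroup.mem_carrier[OF H u(1)])
    have rv: "rev v \<in> lists (pverts \<Gamma>)" using v(1) by auto
    have "racg_word \<Gamma> (take k w @ rev v) = u"
      unfolding racg_word_append[OF tl rv] racg_word_rev[OF v(1)] v(3)
      using uc racg_word_carrier[OF v(1)] by (simp add: m_assoc)
    then show ?thesis using u v rv by (intro bexI[of _ "rev v"]) auto
  qed
  then show ?thesis unfolding word_quasiconvex_def by blast
qed

lemma word_quasiconvex_imp_quasiconvex:
  assumes H: "subgroup H (racg \<Gamma>)" and qc: "word_quasiconvex \<Gamma> H"
  shows "quasiconvex (racg \<Gamma>) (racg_gens \<Gamma>) H"
proof -
  interpret Group.group "racg \<Gamma>" by (rule group_racg)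
  from qc obtain r where r: "\<And>w k. shortest_word \<Gamma> w \<Longrightarrow> racg_word \<Gamma> w \<in> H \<Longrightarrow> k \<le> length w \<Longrightarrow>
      \<exists>v\<in>lists (pverts \<Gamma>). length v \<le> r \<and> racg_word \<Gamma> (take k w @ v) \<in> H"
    unfolding word_quasiconvex_def by blast
  have "set (pre_digraph.awalk_verts (racg_cayley \<Gamma>) g p) \<subseteq> graph_nbhd (racg_cayley \<Gamma>) H r"
    if gh: "g \<in> H" "h \<in> H" and p: "geodesic (racg_cayley \<Gamma>) g p h" for g h p
  proof -
    have gc: "g \<in> carrier (racg \<Gamma>)" "h \<in> carrier (racg \<Gamma>)" using gh by (auto intro: subgroup.mem_carrier[OF H])
    obtain w where w: "w \<in> lists (pverts \<Gamma>)" "h = g \<otimes>\<^bsub>racg \<Gamma>\<^esub> racg_word \<Gamma> w" "length w = length p"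
      "set (pre_digraph.awalk_verts (racg_cayley \<Gamma>) g p) = prefix_points \<Gamma> g w"
      using word_of_cayley_walk[of \<Gamma> g p h] p unfolding geodesic_def by blast
    have wc: "racg_word \<Gamma> w \<in> carrier (racg \<Gamma>)" using w(1) by (rule racg_word_carrier)
    have "inv\<^bsub>racg \<Gamma>\<^esub> g \<otimes>\<^bsub>racg \<Gamma>\<^esub> h = racg_word \<Gamma> w"
      unfolding w(2) using gc(1) wc by (simp add: m_assoc[symmetric])
    then have wH: "racg_word \<Gamma> w \<in> H" using gh H by (metis subgroup.m_closed subgroup.m_inv_closed)
    have short: "shortest_word \<Gamma> w"
      unfolding shortest_word_def
    proof (intro conjI ballI impI w(1))
      fix v assume v: "v \<in> lists (pverts \<Gamma>)" "racg_word \<Gamma> v = racg_word \<Gamma> w"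
      from cayley_walk_of_word[OF v(1) gc(1)] v(2) w(2) obtain q
        where "pre_digraph.awalk (racg_cayley \<Gamma>) g q h" "length q = length v" by auto
      then show "length w \<le> length v" using p w(3) by (auto simp: geodesic_def)
    qed
    show ?thesis unfolding w(4)
    proof
      fix x assume "x \<in> prefix_points \<Gamma> g w"
      then obtain k where k: "k \<le> length w" "x = g \<otimes>\<^bsub>racg \<Gamma>\<^esub> racg_word \<Gamma> (take k w)"
        by (auto simp: prefix_points_def)
      have tl: "take k w \<in> lists (pverts \<Gamma>)" using w(1) by (auto dest: in_set_takeD)
      obtain v where v: "v \<in> lists (pverts \<Gamma>)" "length v \<le> r" "racg_word \<Gamma> (take k w @ v) \<in> H"
        using r[OF short wH k(1)] by blast
      have rv: "rev v \<in> lists (pverts \<Gamma>)" using v(1) by auto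
      let ?u = "g \<otimes>\<^bsub>racg \<Gamma>\<^esub> racg_word \<Gamma> (take k w @ v)"
      have u: "?u \<in> H" "?u \<in> carrier (racg \<Gamma>)" using subgroup.m_closed[OF H gh(1) v(3)] subgroup.mem_carrier[OF H] by auto
      have "?u \<otimes>\<^bsub>racg \<Gamma>\<^esub> racg_word \<Gamma> (rev v) = x"
        unfolding racg_word_append[OF tl v(1)] racg_word_rev[OF v(1)] k(2)
        using gc(1) racg_word_carrier[OF v(1)] racg_word_carrier[OF tl] by (simp add: m_assoc)
      with cayley_walk_of_word[OF rv u(2)] obtain q where
        q: "pre_digraph.awalk (racg_cayley \<Gamma>) ?u q x" "length q = length v" by auto
      from q(2) v(2) have "length q \<le> r" by simp
      with q(1) u(1) show "x \<in> graph_nbhd (racg_cayley \<Gamma>) H r" unfolding graph_nbhd_def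
        by blast
    qed
  qed
  then show ?thesis unfolding quasiconvex_def by blast
qed


section \<open>Edge loops and their labels\<close>

lemma cas_append:
  "pre_digraph.cas G u (p @ q) v \<longleftrightarrow> (\<exists>w. pre_digraph.cas G u p w \<and> pre_digraph.cas G w q v)"
  by (induction p arbitrary: u) (auto simp: pre_digraph.cas.simps)

lemma bidirect_simps [simp]:
  "verts (bidirect G) = verts G" "arcs (bidirect G) = arcs G \<times> UNIV"
  "tail (bidirect G) (e, b) = (if b then tail G e else head G e)"
  "head (bidirect G) (e, b) = (if b then head G e else tail G e)"
  by (auto simp: bidirect_def)

lemma edge_loops_iff:
  "p \<in> edge_loops G x \<longleftrightarrow>
    x \<in> verts G \<and> set p \<subseteq> arcs G \<times> UNIV \<and> pre_digraph.cas (bidirect G) x p x"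
  by (simp add: edge_loops_def pre_digraph.awalk_def)

lemma edge_loops_append:
  "p \<in> edge_loops G x \<Longrightarrow> q \<in> edge_loops G x \<Longrightarrow> p @ q \<in> edge_loops G x"
  by (auto simp: edge_loops_iff cas_append)

lemma edge_loops_backtrack:
  "p @ [(e, b), (e, \<not> b)] @ q \<in> edge_loops G x \<Longrightarrow> p @ q \<in> edge_loops G x"
  by (cases b) (auto simp: edge_loops_iff cas_append pre_digraph.cas.simps)

lemma edge_homotopy_mem: "(p, q) \<in> edge_homotopy G x \<Longrightarrow> p \<in> edge_loops G x \<and> q \<in> edge_loops G x"
proof (induction rule: edge_homotopy.induct)
  case (backtrack p e b q)
  then show ?case using edge_loops_backtrack[OF backtrack] by simp
qed auto

lemma edge_homotopy_context:
  assumes "(p, q) \<in> edge_homotopy G x" "u \<in> edge_loops G x" "v \<in> edge_loops G x"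
  shows "(u @ p @ v, u @ q @ v) \<in> edge_homotopy G x"
  using assms(1)
proof (induction rule: edge_homotopy.induct)
  case (refl p)
  then show ?case using assms by (intro edge_homotopy.refl edge_loops_append)
next
  case (sym p q)
  show ?case by (rule edge_homotopy.sym) (rule sym.IH)
next
  case (trans p q r)
  show ?case by (rule edge_homotopy.trans) (rule trans.IH)+
next
  case (backtrack p e b q)
  then have "u @ (p @ [(e, b), (e, \<not> b)] @ q) @ v \<in> edge_loops G x"
    using edge_loops_append[OF assms(2) edge_loops_append[OF _ assms(3)]] by blast
  then show ?case using edge_homotopy.backtrack[of "u @ p" e b "q @ v" G x] by simp
qed

definition inverse_walk :: "('e \<times> bool) list \<Rightarrow> ('e \<times> bool) list" where
  "inverse_walk p = rev (map (\<lambda>(e, b). (e, \<not> b)) p)"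

lemma cas_inverse_walk:
  "pre_digraph.cas (bidirect G) u p v \<Longrightarrow> pre_digraph.cas (bidirect G) v (inverse_walk p) u"
  by (induction p arbitrary: u)
    (auto simp: inverse_walk_def pre_digraph.cas.simps cas_append split: if_splits)

lemma inverse_walk_edge_loops: "p \<in> edge_loops G x \<Longrightarrow> inverse_walk p \<in> edge_loops G x"
  using cas_inverse_walk[of G x p x] by (auto simp: edge_loops_iff inverse_walk_def)

text \<open>The walk may start anywhere, so that induction can cancel its first edge, which is the
  one that meets its inverse.\<close>

lemma inverse_walk_homotopy:
  assumes "set p \<subseteq> arcs G \<times> UNIV" "pre_digraph.cas (bidirect G) u p x" "x \<in> verts G"
  shows "(inverse_walk p @ p, []) \<in> edge_homotopy G x"
  using assms
proof (induction p arbitrary: u)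
  case Nil
  then show ?case
    using edge_homotopy.refl[of "[]" G x] by (simp add: edge_loops_iff inverse_walk_def pre_digraph.cas.simps)
next
  case (Cons f p)
  obtain e b where f: "f = (e, b)" by (cases f)
  have "inverse_walk (f # p) @ f # p = inverse_walk p @ [(e, \<not> b), (e, \<not> \<not> b)] @ p"
    by (simp add: f inverse_walk_def)
  moreover have "inverse_walk (f # p) @ f # p \<in> edge_loops G x"
    unfolding edge_loops_iff cas_append
  proof (intro conjI exI)
    show "x \<in> verts G" by fact
    show "set (inverse_walk (f # p) @ f # p) \<subseteq> arcs G \<times> UNIV"
      using Cons.prems(1) by (auto simp: inverse_walk_def)
    show "pre_digraph.cas (bidirect G) x (inverse_walk (f # p)) u"
      by (rule cas_inverse_walk) fact
    show "pre_digraph.cas (bidirect G) u (f # p) x" by fact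
  qed
  ultimately have "(inverse_walk (f # p) @ f # p, inverse_walk p @ p) \<in> edge_homotopy G x"
    using edge_homotopy.backtrack[of "inverse_walk p" e "\<not> b" p G x] by argo
  then show ?case using Cons.IH[of "head (bidirect G) f"] Cons.prems
    by (auto simp: pre_digraph.cas.simps intro: edge_homotopy.trans)
qed

lemma list_congruence_edge_homotopy:
  assumes "x \<in> verts G"
  shows "list_congruence (edge_loops G x) (edge_homotopy G x)"
proof
  show "equiv (edge_loops G x) (edge_homotopy G x)"
  proof (rule equivI)
    show "edge_homotopy G x \<subseteq> edge_loops G x \<times> edge_loops G x" by (auto dest: edge_homotopy_mem)
    show "refl_on (edge_loops G x) (edge_homotopy G x)" by (rule refl_onI) (rule edge_homotopy.refl)
    show "sym (edge_homotopy G x)" by (rule symI) (rule edge_homotopy.sym)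
    show "trans (edge_homotopy G x)" by (rule transI) (rule edge_homotopy.trans)
  qed
  show nil: "[] \<in> edge_loops G x" using assms by (simp add: edge_loops_iff pre_digraph.cas.simps)
  show "(p @ q, p' @ q') \<in> edge_homotopy G x"
    if "(p, p') \<in> edge_homotopy G x" "(q, q') \<in> edge_homotopy G x" for p p' q q'
  proof (rule edge_homotopy.trans)
    show "(p @ q, p' @ q) \<in> edge_homotopy G x"
      using edge_homotopy_context[OF that(1) nil, of q] that by (auto dest: edge_homotopy_mem)
    show "(p' @ q, p' @ q') \<in> edge_homotopy G x"
      using edge_homotopy_context[OF that(2) _ nil, of p'] that by (auto dest: edge_homotopy_mem)
  qed
  show "\<exists>v\<in>edge_loops G x. (v @ u, []) \<in> edge_homotopy G x" if "u \<in> edge_loops G x" for u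
    using that inverse_walk_edge_loops[OF that] inverse_walk_homotopy[of u G x x]
    by (intro bexI[of _ "inverse_walk u"]) (auto simp: edge_loops_iff)
qed (rule edge_loops_append)

section \<open>Generalizations\<close>

locale generalization =
  fixes \<Gamma> :: "'a pair_pre_digraph" and \<Delta> :: "'b pair_pre_digraph" and A :: "'a \<Rightarrow> 'b set"
    and T :: "'a list set" and K :: "'b sword set set"
  assumes graph_\<Gamma>: "pair_graph \<Gamma>" and graph_\<Delta>: "pair_graph \<Delta>"
    and partite: "gamma_partite \<Gamma> \<Delta> A"
    and finite_T: "finite T" and T_lists: "T \<subseteq> lists (pverts \<Gamma>)"
    and gen: "is_generalization \<Delta> A T K"
begin

abbreviation "H \<equiv> generate (racg \<Gamma>) (racg_word \<Gamma> ` T)"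

sublocale WG: Group.group "racg \<Gamma>" by (rule group_racg)
sublocale WD: Group.group "racg \<Delta>" by (rule group_racg)

lemma part_subset: "s \<in> pverts \<Gamma> \<Longrightarrow> A s \<subseteq> pverts \<Delta>"
  using partite by (auto simp: gamma_partite_def)

lemma part_nonempty: "s \<in> pverts \<Gamma> \<Longrightarrow> A s \<noteq> {}"
  using partite by (auto simp: gamma_partite_def)

lemma part_unique: "s \<in> pverts \<Gamma> \<Longrightarrow> t \<in> pverts \<Gamma> \<Longrightarrow> a \<in> A s \<Longrightarrow> a \<in> A t \<Longrightarrow> s = t"
  using partite by (auto simp: gamma_partite_def disjoint_family_on_def)

lemma part_exists: "a \<in> pverts \<Delta> \<Longrightarrow> \<exists>s\<in>pverts \<Gamma>. a \<in> A s"
  using partite by (auto simp: gamma_partite_def)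

definition part_of :: "'b \<Rightarrow> 'a" where
  "part_of a = (THE s. s \<in> pverts \<Gamma> \<and> a \<in> A s)"

lemma part_of_eq: "s \<in> pverts \<Gamma> \<Longrightarrow> a \<in> A s \<Longrightarrow> part_of a = s"
  unfolding part_of_def by (rule the_equality) (auto dest: part_unique)

lemma part_of_mem: "a \<in> pverts \<Delta> \<Longrightarrow> part_of a \<in> pverts \<Gamma> \<and> a \<in> A (part_of a)"
  using part_exists part_of_eq by metis

lemma part_of_lists: "u \<in> lists (pverts \<Delta>) \<Longrightarrow> map part_of u \<in> lists (pverts \<Gamma>)"
  by (auto simp: part_of_mem)

lemma part_of_arc:
  assumes "(a, b) \<in> parcs \<Delta>"
  shows "(part_of a, part_of b) \<in> parcs \<Gamma>"
proof -
  interpret D: pair_graph \<Delta> by (rule graph_\<Delta>)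
  have ab: "a \<in> pverts \<Delta>" "b \<in> pverts \<Delta>" using assms by (auto dest: D.in_arcsD1 D.in_arcsD2)
  let ?s = "part_of a" and ?t = "part_of b"
  have st: "?s \<in> pverts \<Gamma>" "?t \<in> pverts \<Gamma>" "a \<in> A ?s" "b \<in> A ?t" using ab part_of_mem by auto
  then have "?s \<noteq> ?t" using partite assms unfolding gamma_partite_def by metis
  moreover have "(a, b) \<in> arcs (part_subgraph \<Delta> A ?s ?t)" using assms st by (simp add: part_subgraph_def)
  ultimately show ?thesis using partite st unfolding gamma_partite_def by (metis empty_iff)
qed

text \<open>Adjacent vertices lie in parts of adjacent vertices, so sending each vertex to its
  part respects the defining relations. This gives the homomorphism from \<open>W\<^sub>\<Delta>\<close> to \<open>W\<^sub>\<Gamma>\<close>.\<close>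

lemma racg_word_part_of:
  assumes "racg_word \<Delta> u = racg_word \<Delta> v" "u \<in> lists (pverts \<Delta>)" "v \<in> lists (pverts \<Delta>)"
  shows "racg_word \<Gamma> (map part_of u) = racg_word \<Gamma> (map part_of v)"
proof (rule racg_word_eq_induct[OF assms, where Q = "\<lambda>u v. racg_word \<Gamma> (map part_of u) = racg_word \<Gamma> (map part_of v)"])
  fix u v s assume "u \<in> lists (pverts \<Delta>)" "v \<in> lists (pverts \<Delta>)" "s \<in> pverts \<Delta>"
  then show "racg_word \<Gamma> (map part_of (u @ [s, s] @ v)) = racg_word \<Gamma> (map part_of (u @ v))"
    using racg_word_square[of "part_of s" \<Gamma> "map part_of u" "map part_of v"] part_of_lists part_of_mem
    by simp
next
  fix u v s t assume "u \<in> lists (pverts \<Delta>)" "v \<in> lists (pverts \<Delta>)" "(s, t) \<in> parcs \<Delta>"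
    "s \<in> pverts \<Delta>" "t \<in> pverts \<Delta>"
  then show "racg_word \<Gamma> (map part_of (u @ [s, t] @ v)) = racg_word \<Gamma> (map part_of (u @ [t, s] @ v))"
    using racg_word_swap[of "part_of s" "part_of t" \<Gamma> "map part_of u" "map part_of v"]
      part_of_lists part_of_mem part_of_arc by simp
qed simp_all

definition lift :: "'a list \<Rightarrow> 'b list \<Rightarrow> bool" where
  "lift w u \<longleftrightarrow> list_all2 (\<lambda>s a. a \<in> A s) w u"

lemma lift_map_part_of: "lift w u \<Longrightarrow> w \<in> lists (pverts \<Gamma>) \<Longrightarrow> map part_of u = w"
  unfolding lift_def by (induction rule: list_all2_induct) (auto simp: part_of_eq)

lemma lift_lists: "lift w u \<Longrightarrow> w \<in> lists (pverts \<Gamma>) \<Longrightarrow> u \<in> lists (pverts \<Delta>)"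
  unfolding lift_def by (induction rule: list_all2_induct) (auto dest: part_subset)

lemma lift_exists: "w \<in> lists (pverts \<Gamma>) \<Longrightarrow> \<exists>u. lift w u"
proof (induction w)
  case (Cons s w)
  then obtain u a where "lift w u" "a \<in> A s" using part_nonempty[of s] by auto
  then have "lift (s # w) (a # u)" by (simp add: lift_def)
  then show ?case by blast
qed (auto simp: lift_def)

lemma subgroup_H: "subgroup H (racg \<Gamma>)"
  using T_lists by (intro WG.generate_is_subgroup) (auto intro: racg_word_carrier)

lemma rose_bar_wf:
  "(e, a) \<in> arcs (rose_bar A T) \<longleftrightarrow> fst e \<in> T \<and> snd e < length (fst e) \<and> a \<in> A (fst e ! snd e)"
  by (cases e) (auto simp: rose_bar_def rose_def rose_label_def)

lemma rose_bar_label_lists: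
  assumes "set p \<subseteq> arcs (rose_bar A T) \<times> UNIV"
  shows "rose_bar_label p \<in> lists (pverts \<Delta>)"
proof -
  have "a \<in> pverts \<Delta>" if "(e, a) \<in> arcs (rose_bar A T)" for e a
    using that T_lists part_subset[of "fst e ! snd e"] by (force simp: rose_bar_wf)
  with assms show ?thesis by (fastforce simp: rose_bar_label_def)
qed

lemma label_of_homotopy:
  assumes "(p, q) \<in> edge_homotopy (rose_bar A T) Base"
  shows "racg_word \<Delta> (rose_bar_label p) = racg_word \<Delta> (rose_bar_label q)"
  using assms
proof (induction rule: edge_homotopy.induct)
  case (backtrack p e b q)
  then have "rose_bar_label (p @ [(e, b), (e, \<not> b)] @ q) \<in> lists (pverts \<Delta>)"
    by (intro rose_bar_label_lists) (auto simp: edge_loops_iff)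
  moreover have "rose_bar_label (p @ [(e, b), (e, \<not> b)] @ q) =
      rose_bar_label p @ [snd e, snd e] @ rose_bar_label q"
    by (cases e) (simp add: rose_bar_label_def)
  moreover have "rose_bar_label (p @ q) = rose_bar_label p @ rose_bar_label q"
    by (simp add: rose_bar_label_def)
  ultimately show ?case using racg_word_square[of "snd e" \<Delta> "rose_bar_label p" "rose_bar_label q"]
    by simp
qed simp_all

lemma Base_vert: "Base \<in> verts (rose_bar A T)"
  by (simp add: rose_bar_def rose_def)

lemma subgroup_K: "subgroup K (racg \<Delta>)"
proof -
  from gen obtain L where L: "L \<subseteq> edge_loops (rose_bar A T) Base"
    "K = generate (racg \<Delta>) ((\<lambda>p. racg_word \<Delta> (rose_bar_label p)) ` L)"
    unfolding is_generalization_def by blast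
  have "racg_word \<Delta> (rose_bar_label p) \<in> carrier (racg \<Delta>)" if "p \<in> L" for p
    using subsetD[OF L(1) that] by (intro racg_word_carrier rose_bar_label_lists) (simp add: edge_loops_iff)
  then show ?thesis unfolding L(2) by (intro WD.generate_is_subgroup) auto
qed

text \<open>Labels are compatible with backtracking, concatenation and inversion of loops. Hence
  the group generated by the labels of a generating set of loops contains the labels of all
  loops, and it does not matter which loops were chosen.\<close>

lemma loop_label_mem_K:
  assumes p: "p \<in> edge_loops (rose_bar A T) Base"
  shows "racg_word \<Delta> (rose_bar_label p) \<in> K"
proof -
  let ?R = "rose_bar A T"
  let ?h = "\<lambda>p. edge_homotopy ?R Base `` {p}"
  let ?P = "graph_pi1 ?R Base"
  interpret lc: list_congruence "edge_loops ?R Base" "edge_homotopy ?R Base"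
    by (rule list_congruence_edge_homotopy[OF Base_vert])
  interpret P: Group.group ?P unfolding graph_pi1_def by (rule lc.group_list_quotient)
  from gen obtain L where L: "L \<subseteq> edge_loops ?R Base" "generate ?P (?h ` L) = carrier ?P"
    "K = generate (racg \<Delta>) ((\<lambda>p. racg_word \<Delta> (rose_bar_label p)) ` L)"
    unfolding is_generalization_def by blast
  have lists: "rose_bar_label q \<in> lists (pverts \<Delta>)" if "q \<in> edge_loops ?R Base" for q
    using that by (intro rose_bar_label_lists) (auto simp: edge_loops_iff)
  have "\<exists>q\<in>edge_loops ?R Base. X = ?h q \<and> racg_word \<Delta> (rose_bar_label q) \<in> K"
    if "X \<in> generate ?P (?h ` L)" for X
    using that
  proof (induction rule: generate.induct)
    case one
    show ?case
      using lc.Nil_mem subgroup.one_closed[OF subgroup_K]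
      by (intro bexI[of _ "[]"]) (auto simp: graph_pi1_def rose_bar_label_def racg_word_Nil)
  next
    case (incl X)
    then show ?case using L by (auto intro: generate.incl)
  next
    case (inv X)
    then obtain l where l: "l \<in> L" "X = ?h l" by blast
    then have ll: "l \<in> edge_loops ?R Base" using L by blast
    then have il: "inverse_walk l \<in> edge_loops ?R Base" by (rule inverse_walk_edge_loops)
    have "(inverse_walk l @ l, []) \<in> edge_homotopy ?R Base"
      using ll by (intro inverse_walk_homotopy[of _ _ Base]) (auto simp: edge_loops_iff)
    then have "?h (inverse_walk l) \<otimes>\<^bsub>?P\<^esub> ?h l = \<one>\<^bsub>?P\<^esub>"
      using ll il by (simp add: graph_pi1_def lc.mult_class lc.class_eqI)
    then have "inv\<^bsub>?P\<^esub> X = ?h (inverse_walk l)"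
      unfolding l(2) using ll il
      by (intro P.inv_equality) (auto simp: graph_pi1_def intro: quotientI)
    moreover have "rose_bar_label (inverse_walk l) = rev (rose_bar_label l)"
      by (auto simp: rose_bar_label_def inverse_walk_def rev_map split: prod.splits)
    moreover have "racg_word \<Delta> (rose_bar_label l) \<in> K" using l(1) L(3) by (auto intro: generate.incl)
    ultimately show ?case using il lists[OF ll] subgroup.m_inv_closed[OF subgroup_K]
      by (intro bexI[of _ "inverse_walk l"]) (auto simp: racg_word_rev)
  next
    case (eng X Y)
    then obtain p q where pq: "p \<in> edge_loops ?R Base" "q \<in> edge_loops ?R Base" "X = ?h p" "Y = ?h q"
      "racg_word \<Delta> (rose_bar_label p) \<in> K" "racg_word \<Delta> (rose_bar_label q) \<in> K" by blast
    have "rose_bar_label (p @ q) = rose_bar_label p @ rose_bar_label q" by (simp add: rose_bar_label_def)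
    with pq lists subgroup.m_closed[OF subgroup_K] show ?case
      by (intro bexI[of _ "p @ q"])
        (auto simp: graph_pi1_def lc.mult_class racg_word_append edge_loops_append)
  qed
  moreover have "?h p \<in> generate ?P (?h ` L)" using p L(2) by (auto simp: graph_pi1_def intro: quotientI)
  ultimately obtain q where q: "q \<in> edge_loops ?R Base" "?h p = ?h q" "racg_word \<Delta> (rose_bar_label q) \<in> K"
    by blast
  then have "(p, q) \<in> edge_homotopy ?R Base" using p lc.class_eq_iff by blast
  with q(3) label_of_homotopy show ?thesis by simp
qed

text \<open>A lift of \<open>w\<close> is the label of the loop that runs once around the petal of \<open>w\<close> and
  uses, in each place, the parallel edge with the required label.\<close>

lemma lift_petal_mem_K:
  assumes w: "w \<in> T" and u: "lift w u"
  shows "racg_word \<Delta> u \<in> K"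
proof -
  let ?R = "rose_bar A T"
  let ?e = "\<lambda>k. (((w, k), u ! k), True)"
  have len: "length u = length w" using u by (simp add: lift_def list_all2_lengthD)
  have "pre_digraph.cas (bidirect ?R) (rose_pos w (length w - n)) (map ?e [length w - n..<length w]) Base"
    if "n \<le> length w" for n
    using that
  proof (induction n)
    case 0
    then show ?case by (simp add: pre_digraph.cas.simps rose_pos_def)
  next
    case (Suc n)
    then have "[length w - Suc n..<length w] = (length w - Suc n) # [length w - n..<length w]"
      by (metis Suc_diff_Suc Suc_le_lessD diff_less upt_conv_Cons zero_less_Suc less_le_trans zero_less_diff)
    moreover have "Suc (length w - Suc n) = length w - n" using Suc.prems by simp
    ultimately show ?case using Suc
      by (simp add: pre_digraph.cas.simps rose_bar_def rose_def)
  qed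
  from this[of "length w"] have "pre_digraph.cas (bidirect ?R) Base (map ?e [0..<length w]) Base"
    by (simp add: rose_pos_def)
  moreover have "set (map ?e [0..<length w]) \<subseteq> arcs ?R \<times> UNIV"
    using w u by (auto simp: rose_bar_wf lift_def list_all2_conv_all_nth)
  ultimately have "map ?e [0..<length w] \<in> edge_loops ?R Base"
    using Base_vert by (simp add: edge_loops_iff)
  from loop_label_mem_K[OF this]
  have "racg_word \<Delta> (map ((!) u) [0..<length u]) \<in> K" by (simp add: rose_bar_label_def comp_def len)
  then show ?thesis by (simp only: map_nth)
qed

text \<open>To see that the homomorphism takes \<open>K\<close> into \<open>H\<close>, a right coset of \<open>H\<close> is attached to
  each vertex of the rose such that traversing an edge with label \<open>s\<close> multiplies the coset
  at its start by \<open>s\<close>. The direction does not matter, as \<open>s\<close> is an involution. The cosets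
  match up where a petal closes because the petal spells an element of \<open>H\<close>.\<close>

fun rose_coset :: "'a rose_vertex \<Rightarrow> 'a sword set set" where
  "rose_coset Base = H"
| "rose_coset (Inner w k) = H #>\<^bsub>racg \<Gamma>\<^esub> racg_word \<Gamma> (take k w)"

lemma rose_coset_pos:
  assumes "w \<in> T" "k \<le> length w"
  shows "rose_coset (rose_pos w k) = H #>\<^bsub>racg \<Gamma>\<^esub> racg_word \<Gamma> (take k w)"
proof (cases "k = 0 \<or> k = length w")
  case True
  have "racg_word \<Gamma> w \<in> H" using assms by (auto intro: generate.incl)
  then have "H #>\<^bsub>racg \<Gamma>\<^esub> racg_word \<Gamma> w = H"
    using subgroup_H subgroup.mem_carrier[OF subgroup_H] by (intro WG.coset_join2)
  moreover have "H #>\<^bsub>racg \<Gamma>\<^esub> \<one>\<^bsub>racg \<Gamma>\<^esub> = H"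
    by (rule WG.coset_mult_one[OF subgroup.subset[OF subgroup_H]])
  ultimately show ?thesis using True by (elim disjE) (simp_all only: rose_pos_def racg_word_Nil
      rose_coset.simps take_0 take_all order_refl simp_thms if_True)
qed (simp add: rose_pos_def)

lemma rose_coset_step:
  assumes "f \<in> arcs (rose_bar A T) \<times> UNIV" "g \<in> rose_coset (tail (bidirect (rose_bar A T)) f)"
  shows "g \<otimes>\<^bsub>racg \<Gamma>\<^esub> racg_word \<Gamma> [part_of (snd (fst f))] \<in> rose_coset (head (bidirect (rose_bar A T)) f)"
proof -
  obtain w k a b where f: "f = (((w, k), a), b)" by (metis prod.exhaust)
  have wk: "w \<in> T" "k < length w" "a \<in> A (w ! k)" using assms(1) by (auto simp: f rose_bar_wf)
  then have s: "w ! k \<in> pverts \<Gamma>" "w \<in> lists (pverts \<Gamma>)" using T_lists by (auto simp: subset_iff)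
  have part: "part_of a = w ! k" using wk s by (simp add: part_of_eq)
  have tl: "take k w \<in> lists (pverts \<Gamma>)" "take (Suc k) w \<in> lists (pverts \<Gamma>)"
    using s(2) by (auto dest: in_set_takeD)
  have suc: "racg_word \<Gamma> (take (Suc k) w) = racg_word \<Gamma> (take k w) \<otimes>\<^bsub>racg \<Gamma>\<^esub> racg_word \<Gamma> [w ! k]"
    using s tl wk(2) by (simp add: take_Suc_conv_app_nth racg_word_append)
  have sq: "racg_word \<Gamma> [w ! k] \<otimes>\<^bsub>racg \<Gamma>\<^esub> racg_word \<Gamma> [w ! k] = \<one>\<^bsub>racg \<Gamma>\<^esub>"
    using racg_word_append[of "[w ! k]" \<Gamma> "[w ! k]"] racg_word_square[of "w ! k" \<Gamma> "[]" "[]"] s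
    by (simp add: racg_word_Nil)
  note c = racg_word_carrier[OF tl(1)] racg_word_carrier[of "[w ! k]" \<Gamma>] subgroup.mem_carrier[OF subgroup_H]
  have ends: "rose_coset (rose_pos w k) = H #>\<^bsub>racg \<Gamma>\<^esub> racg_word \<Gamma> (take k w)"
    "rose_coset (rose_pos w (Suc k)) = H #>\<^bsub>racg \<Gamma>\<^esub> racg_word \<Gamma> (take (Suc k) w)"
    using rose_coset_pos[OF wk(1), of k] rose_coset_pos[OF wk(1), of "Suc k"] wk(2) by simp_all
  show ?thesis
  proof (cases b)
    case True
    with assms(2) obtain h where "h \<in> H" "g = h \<otimes>\<^bsub>racg \<Gamma>\<^esub> racg_word \<Gamma> (take k w)"
      by (auto simp: f ends rose_bar_def rose_def r_coset_def)
    then show ?thesis using True c s(1) part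
      by (auto simp: f ends rose_bar_def rose_def r_coset_def suc WG.m_assoc)
  next
    case False
    with assms(2) obtain h where "h \<in> H" "g = h \<otimes>\<^bsub>racg \<Gamma>\<^esub> racg_word \<Gamma> (take (Suc k) w)"
      by (auto simp: f ends rose_bar_def rose_def r_coset_def)
    then show ?thesis using False c s(1) part
      by (auto simp: f ends rose_bar_def rose_def r_coset_def suc WG.m_assoc sq)
  qed
qed

lemma rose_coset_walk:
  assumes "set p \<subseteq> arcs (rose_bar A T) \<times> UNIV" "pre_digraph.cas (bidirect (rose_bar A T)) u p v"
    "g \<in> rose_coset u" "g \<in> carrier (racg \<Gamma>)"
  shows "g \<otimes>\<^bsub>racg \<Gamma>\<^esub> racg_word \<Gamma> (map part_of (rose_bar_label p)) \<in> rose_coset v"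
  using assms
proof (induction p arbitrary: u g)
  case Nil
  then show ?case by (simp add: pre_digraph.cas.simps rose_bar_label_def racg_word_Nil)
next
  case (Cons f p)
  let ?s = "part_of (snd (fst f))"
  have lists: "rose_bar_label (f # p) \<in> lists (pverts \<Delta>)" using Cons.prems(1) by (rule rose_bar_label_lists)
  have eq: "rose_bar_label (f # p) = snd (fst f) # rose_bar_label p"
    by (auto simp: rose_bar_label_def split: prod.splits)
  have s: "?s \<in> pverts \<Gamma>" "map part_of (rose_bar_label p) \<in> lists (pverts \<Gamma>)"
    using lists part_of_mem part_of_lists[of "rose_bar_label p"] by (simp_all add: eq)
  have "g \<otimes>\<^bsub>racg \<Gamma>\<^esub> racg_word \<Gamma> [?s] \<in> rose_coset (head (bidirect (rose_bar A T)) f)"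
    using Cons.prems by (intro rose_coset_step) (auto simp: pre_digraph.cas.simps)
  then have "g \<otimes>\<^bsub>racg \<Gamma>\<^esub> racg_word \<Gamma> [?s] \<otimes>\<^bsub>racg \<Gamma>\<^esub> racg_word \<Gamma> (map part_of (rose_bar_label p)) \<in> rose_coset v"
    using Cons.prems s by (intro Cons.IH) (auto simp: pre_digraph.cas.simps racg_word_carrier)
  then show ?case
    using racg_word_append[of "[?s]" \<Gamma> "map part_of (rose_bar_label p)"] s Cons.prems(4)
    by (simp add: eq WG.m_assoc racg_word_carrier)
qed

text \<open>The words attached to elements of \<open>K\<close> are existentially quantified because the part
  map is defined on words; by \<open>racg_word_part_of\<close> any other word would do.\<close>

lemma part_of_K:
  assumes "g \<in> K"
  shows "\<exists>u\<in>lists (pverts \<Delta>). g = racg_word \<Delta> u \<and> racg_word \<Gamma> (map part_of u) \<in> H"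
proof -
  from gen obtain L where L: "L \<subseteq> edge_loops (rose_bar A T) Base"
    "K = generate (racg \<Delta>) ((\<lambda>p. racg_word \<Delta> (rose_bar_label p)) ` L)"
    unfolding is_generalization_def by blast
  have l: "rose_bar_label l \<in> lists (pverts \<Delta>) \<and> racg_word \<Gamma> (map part_of (rose_bar_label l)) \<in> H"
    if "l \<in> L" for l
  proof -
    have l: "set l \<subseteq> arcs (rose_bar A T) \<times> UNIV" "pre_digraph.cas (bidirect (rose_bar A T)) Base l Base"
      using subsetD[OF L(1) that] by (simp_all add: edge_loops_iff)
    have "rose_bar_label l \<in> lists (pverts \<Delta>)" using l(1) by (rule rose_bar_label_lists)
    moreover have "\<one>\<^bsub>racg \<Gamma>\<^esub> \<otimes>\<^bsub>racg \<Gamma>\<^esub> racg_word \<Gamma> (map part_of (rose_bar_label l)) \<in> rose_coset Base"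
      using l by (intro rose_coset_walk[of _ Base]) (auto intro: generate.one)
    ultimately show ?thesis using racg_word_carrier[OF part_of_lists] by simp
  qed
  from assms show ?thesis unfolding L(2)
  proof (induction rule: generate.induct)
    case one
    show ?case by (intro bexI[of _ "[]"]) (auto simp: racg_word_Nil intro: generate.one)
  next
    case (incl g)
    then show ?case using l by blast
  next
    case (inv g)
    then obtain p where p: "p \<in> L" "g = racg_word \<Delta> (rose_bar_label p)" by blast
    have "map part_of (rev (rose_bar_label p)) = rev (map part_of (rose_bar_label p))"
      by (simp add: rev_map)
    then have "racg_word \<Gamma> (map part_of (rev (rose_bar_label p))) \<in> H"
      using l[OF p(1)] subgroup.m_inv_closed[OF subgroup_H]
      by (simp add: racg_word_rev[OF part_of_lists])
    moreover have "inv\<^bsub>racg \<Delta>\<^esub> g = racg_word \<Delta> (rev (rose_bar_label p))"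
      using l[OF p(1)] p(2) by (simp add: racg_word_rev)
    moreover have "rev (rose_bar_label p) \<in> lists (pverts \<Delta>)" using l[OF p(1)] by auto
    ultimately show ?case by blast
  next
    case (eng g h)
    then obtain u v where "u \<in> lists (pverts \<Delta>)" "v \<in> lists (pverts \<Delta>)" "g = racg_word \<Delta> u"
      "h = racg_word \<Delta> v" "racg_word \<Gamma> (map part_of u) \<in> H" "racg_word \<Gamma> (map part_of v) \<in> H" by blast
    then show ?case using subgroup.m_closed[OF subgroup_H] part_of_lists
      by (intro bexI[of _ "u @ v"]) (auto simp: racg_word_append)
  qed
qed

end


section \<open>The kernel of the map to the Klein four-group\<close>

text \<open>The letters \<open>c a\<close> and \<open>c b\<close> with \<open>a \<in> A\<close>, \<open>b \<in> B\<close> are involutions, and \<open>(A \<union> B, E)\<close> is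
  a connected bipartite graph whose edges commute. A subgroup \<open>N\<close> that contains all products
  \<open>a b b' a'\<close> contains every product with an even number of letters from \<open>A\<close> and an even
  number from \<open>B\<close>.\<close>

locale commuting_squares = Group.group G for G (structure) +
  fixes N and c :: "'v \<Rightarrow> 'g" and A B :: "'v set" and E :: "('v \<times> 'v) set"
  assumes subgroup_N: "subgroup N G"
    and c_closed: "x \<in> A \<union> B \<Longrightarrow> c x \<in> carrier G"
    and c_square: "x \<in> A \<union> B \<Longrightarrow> c x \<otimes> c x = \<one>"
    and E_sub: "E \<subseteq> A \<times> B"
    and E_commute: "(a, b) \<in> E \<Longrightarrow> c a \<otimes> c b = c b \<otimes> c a"
    and E_connected: "x \<in> A \<union> B \<Longrightarrow> y \<in> A \<union> B \<Longrightarrow> (x, y) \<in> (E \<union> E\<inverse>)\<^sup>*"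
    and disjoint: "A \<inter> B = {}" and nonempty: "A \<noteq> {}" "B \<noteq> {}"
    and squares: "a \<in> A \<Longrightarrow> a' \<in> A \<Longrightarrow> b \<in> B \<Longrightarrow> b' \<in> B \<Longrightarrow> c a \<otimes> (c b \<otimes> (c b' \<otimes> c a')) \<in> N"
begin

lemma cA: "a \<in> A \<Longrightarrow> c a \<in> carrier G" and cB: "b \<in> B \<Longrightarrow> c b \<in> carrier G"
  using c_closed by auto

lemma c_cancel: "x \<in> A \<union> B \<Longrightarrow> g \<in> carrier G \<Longrightarrow> c x \<otimes> (c x \<otimes> g) = g"
  by (metis c_closed c_square l_one m_assoc)

lemma c_swap: "(a, b) \<in> E \<Longrightarrow> g \<in> carrier G \<Longrightarrow> c b \<otimes> (c a \<otimes> g) = c a \<otimes> (c b \<otimes> g)"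
proof -
  assume "(a, b) \<in> E" "g \<in> carrier G"
  then have "c a \<in> carrier G" "c b \<in> carrier G" "g \<in> carrier G" using E_sub cA cB by auto
  then show ?thesis using E_commute[OF \<open>(a, b) \<in> E\<close>] by (metis m_assoc)
qed

lemma c_inv: "x \<in> A \<union> B \<Longrightarrow> inv (c x) = c x"
  by (rule inv_equality) (auto intro: c_square c_closed)

lemmas letters = cA cB c_square c_cancel m_assoc

lemma N_mult: "g \<in> N \<Longrightarrow> h \<in> N \<Longrightarrow> g \<otimes> h \<in> N"
  by (rule subgroup.m_closed[OF subgroup_N])

lemma neighbour_A: assumes "a \<in> A" shows "\<exists>b\<in>B. (a, b) \<in> E"
proof -
  obtain y where y: "y \<in> B" using nonempty by auto
  then have "(a, y) \<in> (E \<union> E\<inverse>)\<^sup>*" "a \<noteq> y" using assms disjoint E_connected by auto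
  then obtain z where "(a, z) \<in> E \<union> E\<inverse>" by (meson converse_rtranclE)
  then show ?thesis using assms E_sub disjoint by auto
qed

lemma neighbour_B: assumes "b \<in> B" shows "\<exists>a\<in>A. (a, b) \<in> E"
proof -
  obtain y where y: "y \<in> A" using nonempty by auto
  then have "(b, y) \<in> (E \<union> E\<inverse>)\<^sup>*" "b \<noteq> y" using assms disjoint E_connected by auto
  then obtain z where "(b, z) \<in> E \<union> E\<inverse>" by (meson converse_rtranclE)
  then show ?thesis using assms E_sub disjoint by auto
qed

lemma pair_A: assumes "a \<in> A" "a' \<in> A" shows "c a \<otimes> c a' \<in> N"
proof -
  obtain b where "b \<in> B" using nonempty by auto
  then show ?thesis using squares[of a a' b b] assms by (simp add: letters)
qed

lemma common_neighbour_B: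
  assumes "(a, b) \<in> E" "(a, b') \<in> E" shows "c b \<otimes> c b' \<in> N"
proof -
  have ab: "a \<in> A" "b \<in> B" "b' \<in> B" using assms E_sub by auto
  have "c a \<otimes> (c b \<otimes> (c b' \<otimes> c a)) = c b \<otimes> c b'"
    using ab E_commute[OF assms(2), symmetric] c_swap[OF assms(1)] by (simp add: letters)
  with squares[of a a b b'] ab show ?thesis by simp
qed

text \<open>For neighbours \<open>b\<close>, \<open>b'\<close> of the same vertex \<open>a\<close> the product is \<open>a b b' a\<close>. In general
  such products are multiplied along a path in the graph.\<close>

lemma pair_B: assumes "b \<in> B" "b' \<in> B" shows "c b \<otimes> c b' \<in> N"
proof -
  have "(v \<in> B \<longrightarrow> c b \<otimes> c v \<in> N) \<and> (v \<in> A \<longrightarrow> (\<forall>b'. (v, b') \<in> E \<longrightarrow> c b \<otimes> c b' \<in> N))"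
    if "(b, v) \<in> (E \<union> E\<inverse>)\<^sup>*" for v
    using that
  proof (induction rule: rtrancl_induct)
    case base
    then show ?case using assms disjoint subgroup.one_closed[OF subgroup_N] by (auto simp: c_square)
  next
    case (step v v')
    from step(2) consider "(v, v') \<in> E" | "(v', v) \<in> E" by auto
    then show ?case
    proof cases
      case 1
      then show ?thesis using step.IH E_sub disjoint by auto
    next
      case 2
      have "c b \<otimes> c b'' \<in> N" if "(v', b'') \<in> E" for b''
      proof -
        have "v \<in> B" "b'' \<in> B" using that 2 E_sub by auto
        moreover have "c b \<otimes> c v \<otimes> (c v \<otimes> c b'') \<in> N"
          using step.IH \<open>v \<in> B\<close> common_neighbour_B[OF 2 that] by (auto intro!: N_mult[of "c b \<otimes> c v"])
        ultimately show ?thesis using assms by (simp add: letters)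
      qed
      then show ?thesis using 2 E_sub disjoint by auto
    qed
  qed
  then show ?thesis using E_connected[of b b'] assms by auto
qed

text \<open>If \<open>u\<close> and \<open>v\<close> have a common neighbour \<open>d\<close>, then \<open>b u v b = (b d) (u v) (d b)\<close>. In
  general such products are multiplied along a path in the graph.\<close>

lemma conjugate_A:
  assumes "a \<in> A" "a' \<in> A" "b \<in> B"
  shows "c b \<otimes> (c a \<otimes> (c a' \<otimes> c b)) \<in> N"
proof -
  have common: "c b \<otimes> (c u \<otimes> (c v \<otimes> c b)) \<in> N" if "(u, d) \<in> E" "(v, d) \<in> E" for u v d
  proof -
    have d: "u \<in> A" "v \<in> A" "d \<in> B" using that E_sub by auto
    have "c b \<otimes> c d \<otimes> (c u \<otimes> c v) \<otimes> (c d \<otimes> c b) \<in> N"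
      using d assms by (intro N_mult pair_A pair_B)
    moreover have "c b \<otimes> c d \<otimes> (c u \<otimes> c v) \<otimes> (c d \<otimes> c b) = c b \<otimes> (c u \<otimes> (c v \<otimes> c b))"
      using d assms c_swap[OF that(1)] c_swap[OF that(2)] by (simp add: letters)
    ultimately show ?thesis by simp
  qed
  have "(v \<in> A \<longrightarrow> c b \<otimes> (c a \<otimes> (c v \<otimes> c b)) \<in> N) \<and>
      (v \<in> B \<longrightarrow> (\<forall>a'. (a', v) \<in> E \<longrightarrow> c b \<otimes> (c a \<otimes> (c a' \<otimes> c b)) \<in> N))"
    if "(a, v) \<in> (E \<union> E\<inverse>)\<^sup>*" for v
    using that
  proof (induction rule: rtrancl_induct)
    case base
    then show ?case using assms disjoint subgroup.one_closed[OF subgroup_N]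
      by (auto simp: letters)
  next
    case (step v v')
    from step(2) consider "(v', v) \<in> E" | "(v, v') \<in> E" by auto
    then show ?case
    proof cases
      case 1
      then show ?thesis using step.IH E_sub disjoint by auto
    next
      case 2
      have "c b \<otimes> (c a \<otimes> (c u \<otimes> c b)) \<in> N" if "(u, v') \<in> E" for u
      proof -
        have v: "v \<in> A" "u \<in> A" using that 2 E_sub by auto
        have "c b \<otimes> (c a \<otimes> (c v \<otimes> c b)) \<otimes> (c b \<otimes> (c v \<otimes> (c u \<otimes> c b))) \<in> N"
          using step.IH v common[OF 2 that] by (intro N_mult[of "c b \<otimes> (c a \<otimes> (c v \<otimes> c b))"]) auto
        then show ?thesis using assms v by (simp add: letters)
      qed
      then show ?thesis using 2 E_sub disjoint by auto
    qed
  qed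
  then show ?thesis using E_connected[of a a'] assms by auto
qed

text \<open>A neighbour \<open>d\<close> of \<open>b\<close> gives \<open>b a b' a' = (b a d b) (d b b' a')\<close>, since \<open>b\<close> and \<open>d\<close>
  commute.\<close>

lemma squares_swapped:
  assumes "a \<in> A" "a' \<in> A" "b \<in> B" "b' \<in> B"
  shows "c b \<otimes> (c a \<otimes> (c b' \<otimes> c a')) \<in> N"
proof -
  obtain d where d: "d \<in> A" "(d, b) \<in> E" using neighbour_B assms by blast
  have "c b \<otimes> (c a \<otimes> (c d \<otimes> c b)) \<otimes> (c d \<otimes> (c b \<otimes> (c b' \<otimes> c a'))) \<in> N"
    using d assms by (intro N_mult[of "c b \<otimes> (c a \<otimes> (c d \<otimes> c b))"] conjugate_A squares)
  then show ?thesis using d assms c_swap[OF d(2)] by (simp add: letters)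
qed

text \<open>Modulo \<open>N\<close> every word equals \<open>r\<close>, a product of at most one fixed letter \<open>a0\<close> and at
  most one fixed letter \<open>b0\<close>, according to the parities. The eight cases of adding a letter
  to the word compare two such products.\<close>

lemma even_word_mem:
  assumes ev_Nil: "ev [] = \<one>"
    and ev_snoc: "\<And>xs x. xs \<in> lists (A \<union> B) \<Longrightarrow> x \<in> A \<union> B \<Longrightarrow> ev (xs @ [x]) = ev xs \<otimes> c x"
    and xs: "xs \<in> lists (A \<union> B)"
    and even: "even (length (filter (\<lambda>x. x \<in> A) xs))" "even (length (filter (\<lambda>x. x \<in> B) xs))"
  shows "ev xs \<in> N"
proof -
  obtain a0 b0 where ab: "a0 \<in> A" "b0 \<in> B" using nonempty by auto
  define r where "r xs = (if odd (length (filter (\<lambda>x. x \<in> A) xs)) then c a0 else \<one>) \<otimes>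
      (if odd (length (filter (\<lambda>x. x \<in> B) xs)) then c b0 else \<one>)" for xs
  have r_closed: "r xs \<in> carrier G" for xs using ab by (simp add: r_def letters)
  have "\<exists>n\<in>N. ev xs = n \<otimes> r xs" using xs
  proof (induction xs rule: rev_induct)
    case Nil
    show ?case using subgroup.one_closed[OF subgroup_N] by (intro bexI[of _ \<one>]) (simp_all add: ev_Nil r_def)
  next
    case (snoc x xs)
    then obtain n where n: "n \<in> N" "ev xs = n \<otimes> r xs" by auto
    have nc: "n \<in> carrier G" using n(1) by (rule subgroup.mem_carrier[OF subgroup_N])
    have x: "x \<in> A \<union> B" "xs \<in> lists (A \<union> B)" using snoc.prems by auto
    have "\<exists>m\<in>N. r xs \<otimes> c x = m \<otimes> r (xs @ [x])"
    proof (cases "x \<in> A")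
      case True
      then have xB: "x \<notin> B" using disjoint by auto
      have swap: "c a0 \<otimes> (c b0 \<otimes> (c x \<otimes> c b0)) \<in> N"
        using subgroup.m_inv_closed[OF subgroup_N squares_swapped[of x a0 b0 b0]] True ab
        by (simp add: inv_mult_group letters c_inv)
      show ?thesis
      proof (cases "odd (length (filter (\<lambda>x. x \<in> B) xs))"; cases "odd (length (filter (\<lambda>x. x \<in> A) xs))")
        assume "odd (length (filter (\<lambda>x. x \<in> B) xs))" "odd (length (filter (\<lambda>x. x \<in> A) xs))"
        then show ?thesis using True xB ab swap
          by (intro bexI[of _ "c a0 \<otimes> (c b0 \<otimes> (c x \<otimes> c b0))"]) (simp_all add: r_def letters)
      next
        assume "odd (length (filter (\<lambda>x. x \<in> B) xs))" "\<not> odd (length (filter (\<lambda>x. x \<in> A) xs))"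
        then show ?thesis using True xB ab squares_swapped[of x a0 b0 b0]
          by (intro bexI[of _ "c b0 \<otimes> (c x \<otimes> (c b0 \<otimes> c a0))"]) (simp_all add: r_def letters)
      next
        assume "\<not> odd (length (filter (\<lambda>x. x \<in> B) xs))" "odd (length (filter (\<lambda>x. x \<in> A) xs))"
        then show ?thesis using True xB ab pair_A[of a0 x]
          by (intro bexI[of _ "c a0 \<otimes> c x"]) (simp_all add: r_def letters)
      next
        assume "\<not> odd (length (filter (\<lambda>x. x \<in> B) xs))" "\<not> odd (length (filter (\<lambda>x. x \<in> A) xs))"
        then show ?thesis using True xB ab pair_A[of x a0]
          by (intro bexI[of _ "c x \<otimes> c a0"]) (simp_all add: r_def letters)
      qed
    next
      case False
      then have xB: "x \<in> B" using x by auto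
      show ?thesis
      proof (cases "odd (length (filter (\<lambda>x. x \<in> B) xs))"; cases "odd (length (filter (\<lambda>x. x \<in> A) xs))")
        assume "odd (length (filter (\<lambda>x. x \<in> B) xs))" "odd (length (filter (\<lambda>x. x \<in> A) xs))"
        then show ?thesis using False xB ab squares[of a0 a0 b0 x]
          by (intro bexI[of _ "c a0 \<otimes> (c b0 \<otimes> (c x \<otimes> c a0))"]) (simp_all add: r_def letters)
      next
        assume "odd (length (filter (\<lambda>x. x \<in> B) xs))" "\<not> odd (length (filter (\<lambda>x. x \<in> A) xs))"
        then show ?thesis using False xB ab pair_B[of b0 x]
          by (intro bexI[of _ "c b0 \<otimes> c x"]) (simp_all add: r_def letters)
      next
        assume "\<not> odd (length (filter (\<lambda>x. x \<in> B) xs))" "odd (length (filter (\<lambda>x. x \<in> A) xs))"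
        then show ?thesis using False xB ab squares[of a0 a0 x b0]
          by (intro bexI[of _ "c a0 \<otimes> (c x \<otimes> (c b0 \<otimes> c a0))"]) (simp_all add: r_def letters)
      next
        assume "\<not> odd (length (filter (\<lambda>x. x \<in> B) xs))" "\<not> odd (length (filter (\<lambda>x. x \<in> A) xs))"
        then show ?thesis using False xB ab pair_B[of x b0]
          by (intro bexI[of _ "c x \<otimes> c b0"]) (simp_all add: r_def letters)
      qed
    qed
    then obtain m where m: "m \<in> N" "r xs \<otimes> c x = m \<otimes> r (xs @ [x])" by blast
    have mc: "m \<in> carrier G" using m(1) by (rule subgroup.mem_carrier[OF subgroup_N])
    have "ev (xs @ [x]) = n \<otimes> (r xs \<otimes> c x)"
      using x n nc r_closed c_closed by (simp add: ev_snoc m_assoc)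
    also have "\<dots> = n \<otimes> m \<otimes> r (xs @ [x])" using nc mc r_closed by (simp add: m(2) m_assoc)
    finally show ?case using N_mult[OF n(1) m(1)] by blast
  qed
  then obtain n where n: "n \<in> N" "ev xs = n \<otimes> r xs" by blast
  have "n \<in> carrier G" using n(1) by (rule subgroup.mem_carrier[OF subgroup_N])
  with n even show ?thesis by (simp add: r_def)
qed

end

section \<open>Words all of whose lifts lie in the generalization\<close>

lemma (in Group.group) inv_cancel:
  assumes "g \<in> carrier G" "x \<in> carrier G"
  shows "inv g \<otimes> (g \<otimes> x) = x" "g \<otimes> (inv g \<otimes> x) = x"
  using assms by (simp_all add: m_assoc[symmetric])

context generalization
begin

definition all_lifts :: "'a list \<Rightarrow> bool" where
  "all_lifts w \<longleftrightarrow> w \<in> lists (pverts \<Gamma>) \<and> (\<forall>u. lift w u \<longrightarrow> racg_word \<Delta> u \<in> K)"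

lemma lift_append_iff: "lift (w @ w') u \<longleftrightarrow> (\<exists>v v'. u = v @ v' \<and> lift w v \<and> lift w' v')"
  unfolding lift_def list_all2_append1
  by (metis list_all2_lengthD)

lemma lift_appendI: "lift w v \<Longrightarrow> lift w' v' \<Longrightarrow> lift (w @ w') (v @ v')"
  by (auto simp: lift_append_iff)

lemma lift_two: "a \<in> A s \<Longrightarrow> b \<in> A t \<Longrightarrow> lift [s, t] [a, b]"
  by (simp add: lift_def)

lemma all_lifts_append:
  assumes "all_lifts w" "all_lifts w'" shows "all_lifts (w @ w')"
  unfolding all_lifts_def
proof (intro conjI allI impI)
  show "w @ w' \<in> lists (pverts \<Gamma>)" using assms by (auto simp: all_lifts_def)
  fix u assume "lift (w @ w') u"
  then obtain v v' where v: "u = v @ v'" "lift w v" "lift w' v'" by (auto simp: lift_append_iff)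
  then have "v \<in> lists (pverts \<Delta>)" "v' \<in> lists (pverts \<Delta>)"
    using assms lift_lists unfolding all_lifts_def by blast+
  then show "racg_word \<Delta> u \<in> K"
    using v assms subgroup.m_closed[OF subgroup_K] by (simp add: all_lifts_def racg_word_append)
qed

lemma all_lifts_petal: "w \<in> T \<Longrightarrow> all_lifts w"
  using T_lists lift_petal_mem_K by (auto simp: all_lifts_def)

lemma all_lifts_rev:
  assumes "all_lifts w" shows "all_lifts (rev w)"
  unfolding all_lifts_def
proof (intro conjI allI impI)
  show "rev w \<in> lists (pverts \<Gamma>)" using assms by (auto simp: all_lifts_def)
  fix u assume "lift (rev w) u"
  then have "lift w (rev u)" by (simp add: lift_def list_all2_rev1)
  moreover from this have "rev u \<in> lists (pverts \<Delta>)" using assms lift_lists by (auto simp: all_lifts_def)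
  ultimately have "inv\<^bsub>racg \<Delta>\<^esub> (racg_word \<Delta> (rev u)) \<in> K" "u \<in> lists (pverts \<Delta>)"
    using assms subgroup.m_inv_closed[OF subgroup_K] by (auto simp: all_lifts_def)
  then show "racg_word \<Delta> u \<in> K" using racg_word_rev[of "rev u" \<Delta>] by (simp add: in_lists_conv_set)
qed

text \<open>The lifts \<open>x' a b y'\<close> and \<open>x' a' b' y'\<close> lie in \<open>K\<close>, and their quotient is the
  conjugate of \<open>a b b' a'\<close> by \<open>x'\<close>.\<close>

lemma commuting_squares_conj:
  assumes st: "(s, t) \<in> parcs \<Gamma>" and xy: "all_lifts (x @ [s, t] @ y)" and x: "lift x x'"
  defines "g \<equiv> racg_word \<Delta> x'"
  shows "commuting_squares (racg \<Delta>)
    {n \<in> carrier (racg \<Delta>). g \<otimes>\<^bsub>racg \<Delta>\<^esub> n \<otimes>\<^bsub>racg \<Delta>\<^esub> inv\<^bsub>racg \<Delta>\<^esub> g \<in> K}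
    (\<lambda>a. racg_word \<Delta> [a]) (A s) (A t) {(a, b). a \<in> A s \<and> b \<in> A t \<and> (a, b) \<in> parcs \<Delta>}"
proof -
  interpret D: pair_graph \<Delta> by (rule graph_\<Delta>)
  interpret G: pair_graph \<Gamma> by (rule graph_\<Gamma>)
  have stv: "s \<in> pverts \<Gamma>" "t \<in> pverts \<Gamma>" "s \<noteq> t"
    using st G.in_arcsD1 G.in_arcsD2 G.pair_no_loops by fastforce+
  have xl: "x \<in> lists (pverts \<Gamma>)" "y \<in> lists (pverts \<Gamma>)" using xy by (auto simp: all_lifts_def)
  have x'l: "x' \<in> lists (pverts \<Delta>)" using lift_lists[OF x xl(1)] .
  have gc: "g \<in> carrier (racg \<Delta>)" unfolding g_def by (rule racg_word_carrier[OF x'l])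
  have As: "a \<in> pverts \<Delta>" if "a \<in> A s \<union> A t" for a using that part_subset stv by auto
  have c: "racg_word \<Delta> [a] \<in> carrier (racg \<Delta>)" if "a \<in> A s \<union> A t" for a
    using As[OF that] by (intro racg_word_carrier) simp
  note Kc = subgroup.mem_carrier[OF subgroup_K] and Km = subgroup.m_closed[OF subgroup_K]
    and Ki = subgroup.m_inv_closed[OF subgroup_K]
  let ?N = "{n \<in> carrier (racg \<Delta>). g \<otimes>\<^bsub>racg \<Delta>\<^esub> n \<otimes>\<^bsub>racg \<Delta>\<^esub> inv\<^bsub>racg \<Delta>\<^esub> g \<in> K}"
  show ?thesis
  proof (intro commuting_squares.intro WD.is_group commuting_squares_axioms.intro)
    show "subgroup ?N (racg \<Delta>)"
    proof (rule WD.subgroupI)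
      have "\<one>\<^bsub>racg \<Delta>\<^esub> \<in> ?N" using gc subgroup.one_closed[OF subgroup_K] by simp
      then show "?N \<noteq> {}" by blast
    next
      fix n assume n: "n \<in> ?N"
      then have "inv\<^bsub>racg \<Delta>\<^esub> (g \<otimes>\<^bsub>racg \<Delta>\<^esub> n \<otimes>\<^bsub>racg \<Delta>\<^esub> inv\<^bsub>racg \<Delta>\<^esub> g) \<in> K" by (intro Ki) simp
      with n gc show "inv\<^bsub>racg \<Delta>\<^esub> n \<in> ?N" by (simp add: WD.inv_mult_group WD.m_assoc)
    next
      fix n m assume n: "n \<in> ?N" "m \<in> ?N"
      then have "(g \<otimes>\<^bsub>racg \<Delta>\<^esub> n \<otimes>\<^bsub>racg \<Delta>\<^esub> inv\<^bsub>racg \<Delta>\<^esub> g) \<otimes>\<^bsub>racg \<Delta>\<^esub>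
          (g \<otimes>\<^bsub>racg \<Delta>\<^esub> m \<otimes>\<^bsub>racg \<Delta>\<^esub> inv\<^bsub>racg \<Delta>\<^esub> g) \<in> K" by (intro Km[of "_ \<otimes>\<^bsub>racg \<Delta>\<^esub> inv\<^bsub>racg \<Delta>\<^esub> g"]) simp_all
      with n gc show "n \<otimes>\<^bsub>racg \<Delta>\<^esub> m \<in> ?N" by (simp add: WD.m_assoc WD.inv_cancel)
    qed blast
    show "racg_word \<Delta> [a] \<otimes>\<^bsub>racg \<Delta>\<^esub> racg_word \<Delta> [a] = \<one>\<^bsub>racg \<Delta>\<^esub>" if "a \<in> A s \<union> A t" for a
      using racg_word_append[of "[a]" \<Delta> "[a]"] racg_word_square[of a \<Delta> "[]" "[]"] As[OF that]
      by (simp add: racg_word_Nil)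
    show "racg_word \<Delta> [a] \<otimes>\<^bsub>racg \<Delta>\<^esub> racg_word \<Delta> [b] = racg_word \<Delta> [b] \<otimes>\<^bsub>racg \<Delta>\<^esub> racg_word \<Delta> [a]"
      if "(a, b) \<in> {(a, b). a \<in> A s \<and> b \<in> A t \<and> (a, b) \<in> parcs \<Delta>}" for a b
      using that As[of a] As[of b] racg_word_swap[of a b \<Delta> "[]" "[]"]
        racg_word_append[of "[a]" \<Delta> "[b]"] racg_word_append[of "[b]" \<Delta> "[a]"] by simp
    show "A s \<inter> A t = {}" using part_unique stv by blast
    show "A s \<noteq> {}" "A t \<noteq> {}" using part_nonempty stv by auto
    show "(a, b) \<in> ({(a, b). a \<in> A s \<and> b \<in> A t \<and> (a, b) \<in> parcs \<Delta>} \<union>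
        {(a, b). a \<in> A s \<and> b \<in> A t \<and> (a, b) \<in> parcs \<Delta>}\<inverse>)\<^sup>*" (is "_ \<in> ?E\<^sup>*")
      if ab: "a \<in> A s \<union> A t" "b \<in> A s \<union> A t" for a b
    proof -
      let ?G = "part_subgraph \<Delta> A s t"
      have "Digraph_Component.connected ?G" using partite st stv unfolding gamma_partite_def by metis
      then have "(a, b) \<in> rtrancl_on (verts (mk_symmetric ?G)) (arcs_ends (mk_symmetric ?G))"
        using ab unfolding Digraph_Component.connected_def strongly_connected_def
        by (auto simp: reachable_def mk_symmetric_def part_subgraph_def)
      then have "(a, b) \<in> (arcs_ends (mk_symmetric ?G))\<^sup>*"
        by (induction rule: rtrancl_on_induct) (auto intro: rtrancl_into_rtrancl)
      moreover have "arcs_ends (mk_symmetric ?G) \<subseteq> ?E"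
      proof -
        have "(u, v) \<in> ?E" if "(u, v) \<in> parcs \<Delta>" "u \<in> A s \<union> A t" "v \<in> A s \<union> A t" for u v
        proof -
          have "(v, u) \<in> parcs \<Delta>" using that(1) D.pair_sym_arcs by (auto simp: symmetric_def dest: symD)
          moreover have "\<not> (u \<in> A s \<and> v \<in> A s)" "\<not> (u \<in> A t \<and> v \<in> A t)"
            using partite that(1) stv unfolding gamma_partite_def by blast+
          ultimately show ?thesis using that by blast
        qed
        moreover have "(v, u) \<in> ?E" if "(u, v) \<in> ?E" for u v using that by blast
        ultimately show ?thesis unfolding mk_symmetric_def part_subgraph_def
          by (simp add: subset_iff) blast
      qed
      ultimately show ?thesis using rtrancl_mono by blast
    qed
    show "racg_word \<Delta> [a] \<otimes>\<^bsub>racg \<Delta>\<^esub> (racg_word \<Delta> [b] \<otimes>\<^bsub>racg \<Delta>\<^esub>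
        (racg_word \<Delta> [b'] \<otimes>\<^bsub>racg \<Delta>\<^esub> racg_word \<Delta> [a'])) \<in> ?N"
      if ab: "a \<in> A s" "a' \<in> A s" "b \<in> A t" "b' \<in> A t" for a a' b b'
    proof -
      obtain y' where y': "lift y y'" using lift_exists[OF xl(2)] by blast
      have y'l: "y' \<in> lists (pverts \<Delta>)" using lift_lists[OF y' xl(2)] .
      let ?c = "\<lambda>a. racg_word \<Delta> [a]" and ?y = "racg_word \<Delta> y'"
      have yc: "?y \<in> carrier (racg \<Delta>)" by (rule racg_word_carrier[OF y'l])
      have word: "racg_word \<Delta> (x' @ [a, b] @ y') = g \<otimes>\<^bsub>racg \<Delta>\<^esub> (?c a \<otimes>\<^bsub>racg \<Delta>\<^esub> (?c b \<otimes>\<^bsub>racg \<Delta>\<^esub> ?y))"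
        if "a \<in> A s" "b \<in> A t" for a b
        using that As[of a] As[of b] x'l y'l racg_word_append[of x' \<Delta> "[a, b] @ y'"]
          racg_word_append[of "[a]" \<Delta> "b # y'"] racg_word_append[of "[b]" \<Delta> y'] by (simp add: g_def)
      have mem: "g \<otimes>\<^bsub>racg \<Delta>\<^esub> (?c a \<otimes>\<^bsub>racg \<Delta>\<^esub> (?c b \<otimes>\<^bsub>racg \<Delta>\<^esub> ?y)) \<in> K"
        if "a \<in> A s" "b \<in> A t" for a b
        using xy x y' lift_two[OF that] unfolding word[OF that, symmetric] all_lifts_def
        by (blast intro: lift_appendI)
      have inv_c: "inv\<^bsub>racg \<Delta>\<^esub> (?c a) = ?c a" if "a \<in> A s \<union> A t" for a
        using racg_word_rev[of "[a]" \<Delta>] As[OF that] by simp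
      have "(g \<otimes>\<^bsub>racg \<Delta>\<^esub> (?c a \<otimes>\<^bsub>racg \<Delta>\<^esub> (?c b \<otimes>\<^bsub>racg \<Delta>\<^esub> ?y))) \<otimes>\<^bsub>racg \<Delta>\<^esub>
          inv\<^bsub>racg \<Delta>\<^esub> (g \<otimes>\<^bsub>racg \<Delta>\<^esub> (?c a' \<otimes>\<^bsub>racg \<Delta>\<^esub> (?c b' \<otimes>\<^bsub>racg \<Delta>\<^esub> ?y))) \<in> K"
        using mem[OF ab(1,3)] Ki[OF mem[OF ab(2,4)]] by (rule Km)
      then show ?thesis using ab gc yc c
        by (simp add: WD.inv_mult_group WD.m_assoc inv_c WD.inv_cancel)
    qed
  qed (use c in auto)
qed

text \<open>The letters \<open>a\<close> and \<open>b\<close> of a lift need not commute, but \<open>b a y' = (b a b a) (a b y')\<close>,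
  and the conjugate of \<open>b a b a\<close> by \<open>x'\<close> belongs to \<open>K\<close>.\<close>

lemma all_lifts_swap:
  assumes st: "(s, t) \<in> parcs \<Gamma>" and xy: "all_lifts (x @ [s, t] @ y)"
  shows "all_lifts (x @ [t, s] @ y)"
  unfolding all_lifts_def
proof (intro conjI allI impI)
  show l: "x @ [t, s] @ y \<in> lists (pverts \<Gamma>)" using xy by (auto simp: all_lifts_def)
  fix u assume "lift (x @ [t, s] @ y) u"
  then obtain x' b a y' where u: "u = x' @ [b, a] @ y'" "lift x x'" "lift y y'" "a \<in> A s" "b \<in> A t"
    unfolding lift_append_iff by (auto simp: lift_def list_all2_Cons1)
  let ?g = "racg_word \<Delta> x'" and ?c = "\<lambda>a. racg_word \<Delta> [a]" and ?y = "racg_word \<Delta> y'"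
  interpret commuting_squares "racg \<Delta>"
    "{n \<in> carrier (racg \<Delta>). ?g \<otimes>\<^bsub>racg \<Delta>\<^esub> n \<otimes>\<^bsub>racg \<Delta>\<^esub> inv\<^bsub>racg \<Delta>\<^esub> ?g \<in> K}"
    ?c "A s" "A t" "{(a, b). a \<in> A s \<and> b \<in> A t \<and> (a, b) \<in> parcs \<Delta>}"
    using st xy u(2) by (rule commuting_squares_conj)
  have lists: "x' \<in> lists (pverts \<Delta>)" "y' \<in> lists (pverts \<Delta>)" "a \<in> pverts \<Delta>" "b \<in> pverts \<Delta>"
    using u l lift_lists subsetD[OF part_subset, of s a] subsetD[OF part_subset, of t b] by auto
  then have car: "?g \<in> carrier (racg \<Delta>)" "?y \<in> carrier (racg \<Delta>)" "?c a \<in> carrier (racg \<Delta>)"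
    "?c b \<in> carrier (racg \<Delta>)" by (auto intro!: racg_word_carrier)
  have "?g \<otimes>\<^bsub>racg \<Delta>\<^esub> (?c b \<otimes>\<^bsub>racg \<Delta>\<^esub> (?c a \<otimes>\<^bsub>racg \<Delta>\<^esub> (?c b \<otimes>\<^bsub>racg \<Delta>\<^esub> ?c a))) \<otimes>\<^bsub>racg \<Delta>\<^esub> inv\<^bsub>racg \<Delta>\<^esub> ?g \<in> K"
    using squares_swapped[of a a b b] u by simp
  moreover have "racg_word \<Delta> (x' @ [a, b] @ y') \<in> K"
    using xy u lift_appendI[OF u(2) lift_appendI[OF lift_two[OF u(4,5)] u(3)]] by (auto simp: all_lifts_def)
  moreover have "racg_word \<Delta> (x' @ [a, b] @ y') = ?g \<otimes>\<^bsub>racg \<Delta>\<^esub> (?c a \<otimes>\<^bsub>racg \<Delta>\<^esub> (?c b \<otimes>\<^bsub>racg \<Delta>\<^esub> ?y))"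
    "racg_word \<Delta> (x' @ [b, a] @ y') = ?g \<otimes>\<^bsub>racg \<Delta>\<^esub> (?c b \<otimes>\<^bsub>racg \<Delta>\<^esub> (?c a \<otimes>\<^bsub>racg \<Delta>\<^esub> ?y))"
    using lists racg_word_append[of x' \<Delta> "[a, b] @ y'"] racg_word_append[of x' \<Delta> "[b, a] @ y'"]
      racg_word_append[of "[a]" \<Delta> "b # y'"] racg_word_append[of "[b]" \<Delta> y']
      racg_word_append[of "[b]" \<Delta> "a # y'"] racg_word_append[of "[a]" \<Delta> y'] by simp_all
  ultimately have "(?g \<otimes>\<^bsub>racg \<Delta>\<^esub> (?c b \<otimes>\<^bsub>racg \<Delta>\<^esub> (?c a \<otimes>\<^bsub>racg \<Delta>\<^esub> (?c b \<otimes>\<^bsub>racg \<Delta>\<^esub> ?c a))) \<otimes>\<^bsub>racg \<Delta>\<^esub> inv\<^bsub>racg \<Delta>\<^esub> ?g)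
      \<otimes>\<^bsub>racg \<Delta>\<^esub> (?g \<otimes>\<^bsub>racg \<Delta>\<^esub> (?c a \<otimes>\<^bsub>racg \<Delta>\<^esub> (?c b \<otimes>\<^bsub>racg \<Delta>\<^esub> ?y))) \<in> K"
    by (metis subgroup.m_closed[OF subgroup_K])
  moreover have "(?g \<otimes>\<^bsub>racg \<Delta>\<^esub> (?c b \<otimes>\<^bsub>racg \<Delta>\<^esub> (?c a \<otimes>\<^bsub>racg \<Delta>\<^esub> (?c b \<otimes>\<^bsub>racg \<Delta>\<^esub> ?c a))) \<otimes>\<^bsub>racg \<Delta>\<^esub> inv\<^bsub>racg \<Delta>\<^esub> ?g)
      \<otimes>\<^bsub>racg \<Delta>\<^esub> (?g \<otimes>\<^bsub>racg \<Delta>\<^esub> (?c a \<otimes>\<^bsub>racg \<Delta>\<^esub> (?c b \<otimes>\<^bsub>racg \<Delta>\<^esub> ?y))) = racg_word \<Delta> u"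
    using car u lists c_cancel[of a] c_cancel[of b] \<open>racg_word \<Delta> (x' @ [b, a] @ y') = _\<close>
    by (simp add: WD.m_assoc WD.inv_cancel)
  ultimately show "racg_word \<Delta> u \<in> K" by simp
qed

lemma all_lifts_delete:
  assumes xy: "all_lifts (x @ [s, s] @ y)"
  shows "all_lifts (x @ y)"
  unfolding all_lifts_def
proof (intro conjI allI impI)
  show l: "x @ y \<in> lists (pverts \<Gamma>)" using xy by (auto simp: all_lifts_def)
  have s: "s \<in> pverts \<Gamma>" using xy by (auto simp: all_lifts_def)
  then obtain a where a: "a \<in> A s" "a \<in> pverts \<Delta>" using part_nonempty part_subset by blast
  fix u assume "lift (x @ y) u"
  then obtain x' y' where u: "u = x' @ y'" "lift x x'" "lift y y'" by (auto simp: lift_append_iff)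
  have "racg_word \<Delta> (x' @ [a, a] @ y') \<in> K"
    using xy lift_appendI[OF u(2) lift_appendI[OF lift_two[OF a(1) a(1)] u(3)]] by (auto simp: all_lifts_def)
  then show "racg_word \<Delta> u \<in> K" using racg_word_square[of a \<Delta> x' y'] a u l lift_lists by auto
qed

lemma all_lifts_steps:
  assumes "(tits_step (parcs \<Gamma>))\<^sup>*\<^sup>* u w" "all_lifts u"
  shows "all_lifts w"
  using assms
proof (induction rule: rtranclp_induct)
  case (step v w)
  from step(2) show ?case
    using step.IH step.prems all_lifts_swap all_lifts_delete by cases blast+
qed

definition near_H :: "nat \<Rightarrow> 'a list \<Rightarrow> bool" where
  "near_H r u \<longleftrightarrow> (\<forall>k\<le>length u. \<exists>v\<in>lists (pverts \<Gamma>). length v \<le> r \<and> racg_word \<Gamma> (take k u @ v) \<in> H)"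

text \<open>The word is read off from a loop in the rose. It leaves \<open>H\<close> only within a petal, so
  its distance from \<open>H\<close> is bounded by the length of the longest petal.\<close>

lemma loop_word:
  assumes "h \<in> H" and r: "\<And>w. w \<in> T \<Longrightarrow> length w \<le> r"
  shows "\<exists>u. racg_word \<Gamma> u = h \<and> all_lifts u \<and> near_H r u"
proof -
  have petal: "near_H r w" if "w \<in> lists (pverts \<Gamma>)" "length w \<le> r" "racg_word \<Gamma> w \<in> H" for w
    unfolding near_H_def
  proof (intro allI impI)
    fix k assume "k \<le> length w"
    with that show "\<exists>v\<in>lists (pverts \<Gamma>). length v \<le> r \<and> racg_word \<Gamma> (take k w @ v) \<in> H"
      by (intro bexI[of _ "drop k w"]) (auto dest: in_set_dropD)
  qed
  from assms(1) show ?thesis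
  proof (induction rule: generate.induct)
    case one
    show ?case using generate.one[of "racg \<Gamma>"] subgroup.one_closed[OF subgroup_K]
      by (intro exI[of _ "[]"]) (auto simp: racg_word_Nil all_lifts_def lift_def near_H_def intro!: bexI[of _ "[]"])
  next
    case (incl g)
    then obtain w where w: "w \<in> T" "g = racg_word \<Gamma> w" by blast
    then have "near_H r w" using T_lists r by (intro petal) (auto intro: generate.incl)
    with w show ?case using all_lifts_petal by blast
  next
    case (inv g)
    then obtain w where w: "w \<in> T" "g = racg_word \<Gamma> w" by blast
    then have wl: "w \<in> lists (pverts \<Gamma>)" using T_lists by auto
    have "inv\<^bsub>racg \<Gamma>\<^esub> g \<in> H" using w(1,2) by (auto intro: generate.inv)
    then have "near_H r (rev w)" using wl w r by (intro petal) (auto simp: racg_word_rev)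
    with w wl show ?case using all_lifts_petal all_lifts_rev by (metis racg_word_rev)
  next
    case (eng g h)
    then obtain u v where uv: "racg_word \<Gamma> u = g" "racg_word \<Gamma> v = h" "all_lifts u" "all_lifts v"
      "near_H r u" "near_H r v" by blast
    then have l: "u \<in> lists (pverts \<Gamma>)" "v \<in> lists (pverts \<Gamma>)" by (auto simp: all_lifts_def)
    have "near_H r (u @ v)" unfolding near_H_def
    proof (intro allI impI)
      fix k assume k: "k \<le> length (u @ v)"
      show "\<exists>z\<in>lists (pverts \<Gamma>). length z \<le> r \<and> racg_word \<Gamma> (take k (u @ v) @ z) \<in> H"
      proof (cases "k \<le> length u")
        case True
        then show ?thesis using uv(5) by (simp add: near_H_def)
      next
        case False
        then have "k - length u \<le> length v" using k by simp
        with uv(6) obtain z where z: "z \<in> lists (pverts \<Gamma>)" "length z \<le> r"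
          "racg_word \<Gamma> (take (k - length u) v @ z) \<in> H" unfolding near_H_def by blast
        have "take (k - length u) v @ z \<in> lists (pverts \<Gamma>)"
          using l z by (auto dest: in_set_takeD)
        then have "racg_word \<Gamma> (u @ take (k - length u) v @ z) \<in> H"
          using l z uv(1) eng(1) subgroup.m_closed[OF subgroup_H] by (simp add: racg_word_append)
        with z False show ?thesis by auto
      qed
    qed
    with uv l all_lifts_append show ?case by (metis racg_word_append)
  qed
qed

lemma petal_bound: "\<exists>r. \<forall>w\<in>T. length w \<le> r"
  using finite_T by (metis finite_imageI finite_nat_set_iff_bounded_le image_eqI)

text \<open>A shortest word \<open>w\<close> for an element of \<open>H\<close> has all its lifts in \<open>K\<close>, because it is
  reached by swaps and deletions from a product of generators. A lift of \<open>w\<close> is itself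
  shortest: the part map would take a shorter word to a shorter word for the same element as
  \<open>w\<close>. So the lift stays close to \<open>K\<close>, and the part map carries this back to \<open>w\<close> and \<open>H\<close>.\<close>

theorem quasiconvex_descends:
  assumes "word_quasiconvex \<Delta> K"
  shows "word_quasiconvex \<Gamma> H"
proof -
  obtain M where M: "\<And>w. w \<in> T \<Longrightarrow> length w \<le> M" using petal_bound by blast
  from assms obtain r where r: "\<And>w k. shortest_word \<Delta> w \<Longrightarrow> racg_word \<Delta> w \<in> K \<Longrightarrow> k \<le> length w \<Longrightarrow>
      \<exists>v\<in>lists (pverts \<Delta>). length v \<le> r \<and> racg_word \<Delta> (take k w @ v) \<in> K"
    unfolding word_quasiconvex_def by blast
  have "\<exists>v\<in>lists (pverts \<Gamma>). length v \<le> r \<and> racg_word \<Gamma> (take k w @ v) \<in> H"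
    if w: "shortest_word \<Gamma> w" "racg_word \<Gamma> w \<in> H" and k: "k \<le> length w" for w k
  proof -
    from loop_word[OF w(2) M] obtain u where u: "racg_word \<Gamma> u = racg_word \<Gamma> w" "all_lifts u" by blast
    then have "u \<in> lists (pverts \<Gamma>)" by (simp add: all_lifts_def)
    with tits_word_problem[OF graph_\<Gamma> u(1)] w(1) all_lifts_steps u(2) have aw: "all_lifts w" by blast
    then have wl: "w \<in> lists (pverts \<Gamma>)" by (simp add: all_lifts_def)
    obtain w' where w': "lift w w'" using lift_exists[OF wl] by blast
    have w'l: "w' \<in> lists (pverts \<Delta>)" "map part_of w' = w" "racg_word \<Delta> w' \<in> K"
      using w' wl aw lift_lists lift_map_part_of by (auto simp: all_lifts_def)
    have "shortest_word \<Delta> w'"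
      unfolding shortest_word_def
    proof (intro conjI ballI impI w'l(1))
      fix v assume v: "v \<in> lists (pverts \<Delta>)" "racg_word \<Delta> v = racg_word \<Delta> w'"
      then have "racg_word \<Gamma> (map part_of v) = racg_word \<Gamma> w" using racg_word_part_of w'l by metis
      then have "length w \<le> length (map part_of v)" using w(1) part_of_lists[OF v(1)] unfolding shortest_word_def by blast
      then show "length w' \<le> length v" using w'l(2) by (metis length_map)
    qed
    from r[OF this w'l(3), of k] obtain v where v: "v \<in> lists (pverts \<Delta>)" "length v \<le> r"
      "racg_word \<Delta> (take k w' @ v) \<in> K" using k w'l(2) by (metis length_map)
    from part_of_K[OF v(3)] obtain z where z: "z \<in> lists (pverts \<Delta>)"
      "racg_word \<Delta> (take k w' @ v) = racg_word \<Delta> z" "racg_word \<Gamma> (map part_of z) \<in> H" by blast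
    have "take k w' @ v \<in> lists (pverts \<Delta>)" using w'l(1) v(1) by (auto dest: in_set_takeD)
    from racg_word_part_of[OF z(2) this z(1)] z(3)
    have "racg_word \<Gamma> (take k w @ map part_of v) \<in> H" by (simp add: w'l(2)[symmetric] take_map)
    then show ?thesis using v part_of_lists[OF v(1)] by (intro bexI[of _ "map part_of v"]) auto
  qed
  then show ?thesis unfolding word_quasiconvex_def by blast
qed

text \<open>Otherwise the steps from a product of generators to a shortest word are all deletions.
  The prefixes of \<open>x y\<close> represent elements that prefixes of \<open>x s s y\<close> represent as well, so
  deletions keep a word close to \<open>H\<close> with the same constant, and \<open>H\<close> would be quasiconvex.\<close>

theorem commuting_pair_exists:
  assumes "\<not> word_quasiconvex \<Gamma> H"
  shows "\<exists>x s t y. (s, t) \<in> parcs \<Gamma> \<and> all_lifts (x @ [s, t] @ y)"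
proof (rule ccontr)
  assume no: "\<not> ?thesis"
  obtain M where M: "\<And>w. w \<in> T \<Longrightarrow> length w \<le> M" using petal_bound by blast
  have near: "near_H M w" if "(tits_step (parcs \<Gamma>))\<^sup>*\<^sup>* u w" "all_lifts u" "near_H M u" for u w
    using that
  proof (induction rule: rtranclp_induct)
    case (step v w)
    then have v: "all_lifts v" "near_H M v" using all_lifts_steps by blast+
    from step(2) show ?case
    proof cases
      case (swap s t x y)
      then show ?thesis using no v by blast
    next
      case (delete x s y)
      then have l: "x \<in> lists (pverts \<Gamma>)" "y \<in> lists (pverts \<Gamma>)" "s \<in> pverts \<Gamma>"
        using v(1) by (auto simp: all_lifts_def)
      show ?thesis unfolding near_H_def delete
      proof (intro allI impI)
        fix k assume k: "k \<le> length (x @ y)"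
        show "\<exists>z\<in>lists (pverts \<Gamma>). length z \<le> M \<and> racg_word \<Gamma> (take k (x @ y) @ z) \<in> H"
        proof (cases "k \<le> length x")
          case True
          then have "k \<le> length v" "take k v = take k (x @ y)" by (simp_all add: delete)
          then show ?thesis using v(2) unfolding near_H_def by metis
        next
          case False
          define j where "j = k - length x"
          have "k + 2 \<le> length v" using k by (simp add: delete)
          with v(2) obtain z where z: "z \<in> lists (pverts \<Gamma>)" "length z \<le> M"
            "racg_word \<Gamma> (take (k + 2) v @ z) \<in> H" by (auto simp: near_H_def)
          have "take (k + 2) v = x @ [s, s] @ take j y" "take k (x @ y) = x @ take j y"
            using False by (auto simp: delete j_def take_Cons' numeral_2_eq_2 Suc_diff_le)
          moreover have "take j y @ z \<in> lists (pverts \<Gamma>)" using l z by (auto dest: in_set_takeD)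
          ultimately show ?thesis using z racg_word_square[of s \<Gamma> x "take j y @ z"] l by auto
        qed
      qed
    qed
  qed simp
  have "\<exists>v\<in>lists (pverts \<Gamma>). length v \<le> M \<and> racg_word \<Gamma> (take k w @ v) \<in> H"
    if w: "shortest_word \<Gamma> w" "racg_word \<Gamma> w \<in> H" and k: "k \<le> length w" for w k
  proof -
    from loop_word[OF w(2) M] obtain u where u: "racg_word \<Gamma> u = racg_word \<Gamma> w" "all_lifts u" "near_H M u"
      by blast
    then have "u \<in> lists (pverts \<Gamma>)" by (simp add: all_lifts_def)
    with tits_word_problem[OF graph_\<Gamma> u(1)] w(1) near u(2,3) have "near_H M w" by blast
    with k show ?thesis by (simp add: near_H_def)
  qed
  then have "word_quasiconvex \<Gamma> H" unfolding word_quasiconvex_def by blast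
  with assms show False by contradiction
qed

end


section \<open>A surface tiled by four copies of a polygon\<close>

text \<open>The polygon is the set where all the affine functions \<open>f c\<close> are nonnegative; its sides
  are indexed by \<open>A \<union> B\<close>. The pairs in \<open>V\<close> are its corners, each between a side from \<open>A\<close> and
  a side from \<open>B\<close>. The point \<open>z\<close> is interior, and \<open>m c\<close> is a point in the interior of side
  \<open>c\<close>. Assumption \<open>cover\<close> says that every point of the polygon lies off all sides except the
  two at some corner. Assumption \<open>coordinates\<close> says that the two functions at a corner are
  affine coordinates of the plane.\<close>

locale mirrored_polygon =
  fixes A B :: "'c set" and V :: "('c \<times> 'c) set" and f :: "'c \<Rightarrow> real \<times> real \<Rightarrow> real"
    and z :: "real \<times> real" and m :: "'c \<Rightarrow> real \<times> real"
  assumes finite_A: "finite A" and finite_B: "finite B" and disjoint: "A \<inter> B = {}" and V_sub: "V \<subseteq> A \<times> B"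
    and affine: "f c ((1 - t) *\<^sub>R p + t *\<^sub>R q) = (1 - t) * f c p + t * f c q"
    and cont_f: "continuous_on X (f c)"
    and bounded_P: "bounded {p. \<forall>c\<in>A \<union> B. 0 \<le> f c p}"
    and cover: "(\<And>c. c \<in> A \<union> B \<Longrightarrow> 0 \<le> f c p) \<Longrightarrow> \<exists>(a, b)\<in>V. \<forall>c\<in>A \<union> B - {a, b}. 0 < f c p"
    and coordinates: "(a, b) \<in> V \<Longrightarrow> \<exists>L. continuous_on UNIV L \<and>
      (\<forall>x y. f a (L (x, y)) = x \<and> f b (L (x, y)) = y) \<and> (\<forall>p. L (f a p, f b p) = p)"
    and corner: "(a, b) \<in> V \<Longrightarrow> \<exists>v. f a v = 0 \<and> f b v = 0 \<and> (\<forall>c\<in>A \<union> B - {a, b}. 0 < f c v)"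
    and centre: "c \<in> A \<union> B \<Longrightarrow> 0 < f c z"
    and side: "c \<in> A \<union> B \<Longrightarrow> f c (m c) = 0"
    and side_pos: "c \<in> A \<union> B \<Longrightarrow> d \<in> A \<union> B \<Longrightarrow> d \<noteq> c \<Longrightarrow> 0 < f d (m c)"
begin

definition P where "P = {p. \<forall>c\<in>A \<union> B. 0 \<le> f c p}"

text \<open>A function that is positive inside the polygon and vanishes exactly on the sides in
  \<open>X\<close>. It measures how far the two sheets of the double along these sides are apart.\<close>

definition height :: "'c set \<Rightarrow> real \<times> real \<Rightarrow> real" where
  "height X p = (\<Prod>c\<in>X. f c p)"

text \<open>Over a point \<open>p\<close> of the polygon there are the points with \<open>\<bar>x\<bar> = height A p\<close> and
  \<open>\<bar>y\<bar> = height B p\<close>. The two values of \<open>x\<close> agree exactly on the sides in \<open>A\<close>, those of \<open>y\<close>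
  on the sides in \<open>B\<close>. So this is the polygon doubled along the sides in \<open>A\<close> and then along
  those in \<open>B\<close>.\<close>

definition S :: "((real \<times> real) \<times> (real \<times> real)) set" where
  "S = {s. fst s \<in> P \<and> \<bar>fst (snd s)\<bar> = height A (fst s) \<and> \<bar>snd (snd s)\<bar> = height B (fst s)}"

definition sheet :: "real \<times> real \<Rightarrow> real \<times> real \<Rightarrow> (real \<times> real) \<times> (real \<times> real)" where
  "sheet \<sigma> p = (p, (fst \<sigma> * height A p, snd \<sigma> * height B p))"

definition signs :: "(real \<times> real) set" where "signs = {1, -1} \<times> {1, -1}"

text \<open>The union of the four tiles around the corner \<open>(a, b)\<close>, without the sides that do not
  meet there.\<close>

definition star :: "'c \<Rightarrow> 'c \<Rightarrow> ((real \<times> real) \<times> (real \<times> real)) set" where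
  "star a b = {s \<in> S. \<forall>c\<in>A \<union> B - {a, b}. 0 < f c (fst s)}"

lemma continuous_on_f [continuous_intros]:
  "continuous_on X g \<Longrightarrow> continuous_on X (\<lambda>x. f c (g x))"
  using continuous_on_compose2[OF cont_f[of UNIV c]] by auto

lemma continuous_on_height [continuous_intros]:
  "continuous_on X g \<Longrightarrow> continuous_on X (\<lambda>x. height Y (g x))"
  unfolding height_def by (intro continuous_intros)

lemma height_nonneg: "p \<in> P \<Longrightarrow> X \<subseteq> A \<union> B \<Longrightarrow> 0 \<le> height X p"
  unfolding height_def P_def by (intro prod_nonneg) auto

lemma height_remove:
  assumes "c \<in> X" "X \<subseteq> A \<union> B"
  shows "height X p = f c p * height (X - {c}) p"
proof -
  have "finite X" using assms(2) finite_A finite_B by (meson finite_Un finite_subset)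
  then show ?thesis using assms(1) by (simp add: height_def prod.remove)
qed

lemma height_pos: "(\<And>c. c \<in> X \<Longrightarrow> 0 < f c p) \<Longrightarrow> 0 < height X p"
  unfolding height_def by (intro prod_pos) auto

lemma height_zero: "c \<in> X \<Longrightarrow> X \<subseteq> A \<union> B \<Longrightarrow> f c p = 0 \<Longrightarrow> height X p = 0"
  using height_remove by simp

lemma sheet_mem_S: "\<sigma> \<in> signs \<Longrightarrow> p \<in> P \<Longrightarrow> sheet \<sigma> p \<in> S"
  using height_nonneg[of p A] height_nonneg[of p B]
  by (auto simp: S_def sheet_def signs_def abs_mult)

lemma fst_sheet [simp]: "fst (sheet \<sigma> p) = p"
  by (simp add: sheet_def)

lemma S_eq_sheets: "S = (\<Union>\<sigma>\<in>signs. sheet \<sigma> ` P)"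
proof
  show "S \<subseteq> (\<Union>\<sigma>\<in>signs. sheet \<sigma> ` P)"
  proof
    fix s assume s: "s \<in> S"
    let ?\<sigma> = "(if 0 \<le> fst (snd s) then 1 else -1 :: real, if 0 \<le> snd (snd s) then 1 else -1 :: real)"
    have "s = sheet ?\<sigma> (fst s)" "?\<sigma> \<in> signs" "fst s \<in> P"
      using s by (auto simp: S_def sheet_def signs_def prod_eq_iff split: if_splits)
    then show "s \<in> (\<Union>\<sigma>\<in>signs. sheet \<sigma> ` P)" by blast
  qed
qed (auto simp: sheet_mem_S)

lemma continuous_on_sheet [continuous_intros]:
  "continuous_on X g \<Longrightarrow> continuous_on X (\<lambda>x. sheet \<sigma> (g x))"
  unfolding sheet_def by (intro continuous_intros)

lemma P_convex: "p \<in> P \<Longrightarrow> q \<in> P \<Longrightarrow> t \<in> {0..1} \<Longrightarrow> (1 - t) *\<^sub>R p + t *\<^sub>R q \<in> P"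
  by (auto simp: P_def affine)

lemma convex_P: "convex P"
  unfolding convex_alt using P_convex by auto

lemma compact_P: "compact P"
proof -
  have "P = (\<Inter>c\<in>A \<union> B. {p. 0 \<le> f c p})" by (auto simp: P_def)
  moreover have "closed {p. 0 \<le> f c p}" for c
    using closed_Collect_le[OF continuous_on_const cont_f[of UNIV c]] by simp
  ultimately have "closed P" by (metis closed_INT)
  then show ?thesis using bounded_P by (simp add: compact_eq_bounded_closed P_def)
qed

lemma centre_mem_P: "z \<in> P"
  using centre by (force simp: P_def)

lemma side_mem_P: "c \<in> A \<union> B \<Longrightarrow> m c \<in> P"
proof -
  assume c: "c \<in> A \<union> B"
  have "0 \<le> f d (m c)" if "d \<in> A \<union> B" for d
    using side[OF c] side_pos[OF c that] by (cases "d = c") auto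
  then show ?thesis by (simp add: P_def)
qed

lemma compact_S: "compact S"
proof -
  have "compact (sheet \<sigma> ` P)" for \<sigma>
    by (rule compact_continuous_image[OF _ compact_P]) (intro continuous_intros)
  then show ?thesis unfolding S_eq_sheets signs_def by (intro compact_UN) auto
qed

lemma openin_star: "openin (top_of_set S) (star a b)"
proof -
  have "star a b = S \<inter> (\<Inter>c\<in>A \<union> B - {a, b}. (\<lambda>s. f c (fst s)) -` {0<..})"
    by (auto simp: star_def)
  moreover have "open (\<Inter>c\<in>A \<union> B - {a, b}. (\<lambda>s. f c (fst s)) -` {0<..})"
    using finite_A finite_B
    by (intro open_INT ballI open_vimage continuous_intros) auto
  ultimately show ?thesis by (metis openin_open_Int)
qed

lemma S_covered: "s \<in> S \<Longrightarrow> \<exists>(a, b)\<in>V. s \<in> star a b"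
  using cover[of "fst s"] by (auto simp: S_def star_def P_def)

text \<open>Dividing by the contributions of the other sides turns the signed heights into \<open>\<plusminus> f a\<close>
  and \<open>\<plusminus> f b\<close>.\<close>

definition chart :: "'c \<Rightarrow> 'c \<Rightarrow> (real \<times> real) \<times> (real \<times> real) \<Rightarrow> real \<times> real" where
  "chart a b s = (fst (snd s) / height (A - {a}) (fst s), snd (snd s) / height (B - {b}) (fst s))"

text \<open>The chart \<open>(\<plusminus> f a, \<plusminus> f b)\<close> unfolds the four tiles into the four quadrants. Its inverse
  \<open>h\<close> recovers the point \<open>M q\<close> of the polygon from the absolute values of the coordinates.
  Along a ray from the origin \<open>M\<close> is affine and starts at the corner, so positivity of the
  other functions \<open>f c\<close> propagates along the segment from the origin to any point of the
  image.\<close>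

lemma star_chart:
  assumes ab: "(a, b) \<in> V"
  shows "\<exists>D h. homeomorphism (star a b) D (chart a b) h \<and> open D \<and> starlike D"
proof -
  from ab V_sub have abAB: "a \<in> A" "b \<in> B" by auto
  from coordinates[OF ab] obtain L where L: "continuous_on UNIV L" "\<And>x y. f a (L (x, y)) = x"
    "\<And>x y. f b (L (x, y)) = y" "\<And>p. L (f a p, f b p) = p" by blast
  define M where "M q = L (\<bar>fst q\<bar>, \<bar>snd q\<bar>)" for q
  define D where "D = {q. \<forall>c\<in>A \<union> B - {a, b}. 0 < f c (M q)}"
  define h where "h q = (M q, (fst q * height (A - {a}) (M q), snd q * height (B - {b}) (M q)))" for q
  have contM: "continuous_on X M" for X
    unfolding M_def by (rule continuous_on_compose2[OF L(1)]) (auto intro!: continuous_intros)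
  have fM: "f a (M q) = \<bar>fst q\<bar>" "f b (M q) = \<bar>snd q\<bar>" for q by (simp_all add: M_def L)
  have posA: "0 < height (A - {a}) p" and posB: "0 < height (B - {b}) p"
    if "\<forall>c\<in>A \<union> B - {a, b}. 0 < f c p" for p
    using that disjoint abAB by (auto intro!: height_pos)
  have hS: "h q \<in> star a b" "chart a b (h q) = q" if "q \<in> D" for q
  proof -
    have q: "\<forall>c\<in>A \<union> B - {a, b}. 0 < f c (M q)" using that by (simp add: D_def)
    then have "M q \<in> P" using fM[of q] unfolding P_def by (auto simp: less_imp_le) (metis DiffI Un_iff abs_ge_zero insertE less_imp_le singletonD)+
    then show "h q \<in> star a b"
      using q posA[OF q] posB[OF q] height_remove[of a A "M q"] height_remove[of b B "M q"] abAB fM[of q]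
      by (simp add: star_def S_def h_def abs_mult)
    show "chart a b (h q) = q" using posA[OF q] posB[OF q] by (simp add: chart_def h_def)
  qed
  have chart: "chart a b s \<in> D" "h (chart a b s) = s" if "s \<in> star a b" for s
  proof -
    have s: "s \<in> S" "\<forall>c\<in>A \<union> B - {a, b}. 0 < f c (fst s)" using that by (auto simp: star_def)
    have "0 \<le> f a (fst s)" "0 \<le> f b (fst s)" using s(1) abAB by (auto simp: S_def P_def)
    then have "\<bar>fst (chart a b s)\<bar> = f a (fst s)" "\<bar>snd (chart a b s)\<bar> = f b (fst s)"
      using s(1) posA[OF s(2)] posB[OF s(2)] height_remove[of a A "fst s"] height_remove[of b B "fst s"] abAB
      by (simp_all add: chart_def S_def abs_div)
    then have M: "M (chart a b s) = fst s" by (simp add: M_def L)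
    then show "chart a b s \<in> D" using s by (simp add: D_def)
    show "h (chart a b s) = s" using posA[OF s(2)] posB[OF s(2)]
      by (simp add: h_def M prod_eq_iff) (simp add: chart_def)
  qed
  have "continuous_on (star a b) (chart a b)"
    unfolding chart_def using posA posB by (intro continuous_intros) (force simp: star_def)+
  moreover have "continuous_on D h"
    unfolding h_def using contM by (intro continuous_intros)
  ultimately have "homeomorphism (star a b) D (chart a b) h"
    using hS chart by (intro homeomorphismI) auto
  moreover have "open D"
  proof -
    have "D = (\<Inter>c\<in>A \<union> B - {a, b}. (\<lambda>q. f c (M q)) -` {0<..})" by (auto simp: D_def)
    then show ?thesis using finite_A finite_B
      by (auto intro!: open_INT open_vimage continuous_intros contM)
  qed
  moreover have "starlike D"
    unfolding starlike_def
  proof (intro bexI ballI subsetI)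
    from corner[OF ab] obtain v where v: "f a v = 0" "f b v = 0" "\<forall>c\<in>A \<union> B - {a, b}. 0 < f c v" by blast
    then have M0: "M 0 = v" using L(4)[of v] by (simp add: M_def)
    then show "0 \<in> D" using v by (simp add: D_def)
    fix q x assume q: "q \<in> D" "x \<in> closed_segment 0 q"
    then obtain t where t: "0 \<le> t" "t \<le> 1" "x = t *\<^sub>R q" by (auto simp: in_segment)
    have "M x = (1 - t) *\<^sub>R v + t *\<^sub>R M q"
      using L(4)[of "(1 - t) *\<^sub>R v + t *\<^sub>R M q"] t
      by (simp add: affine v fM) (simp add: M_def abs_mult)
    then have "f c (M x) = (1 - t) * f c v + t * f c (M q)" for c by (simp add: affine)
    moreover have "0 < (1 - t) * u + t * w" if "0 < u" "0 < w" for u w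
      using t that by (cases "t = 0") (auto intro!: add_nonneg_pos)
    ultimately show "x \<in> D" using v(3) q(1) by (simp add: D_def)
  qed
  ultimately show ?thesis by blast
qed

lemma simply_connected_star:
  assumes "(a, b) \<in> V" shows "simply_connected (star a b)"
proof -
  from star_chart[OF assms] obtain D h where D: "homeomorphism (star a b) D (chart a b) h" "starlike D"
    by blast
  have "simply_connected D" using D(2) by (intro contractible_imp_simply_connected starlike_imp_contractible)
  moreover have "D homeomorphic star a b"
    unfolding homeomorphic_def using homeomorphism_symD[OF D(1)] by blast
  ultimately show ?thesis by (rule homeomorphic_simply_connected[rotated])
qed

lemma connected_S: "Topological_Spaces.connected S"
proof -
  have "Topological_Spaces.connected (sheet \<sigma> ` P)" for \<sigma>
    by (intro connected_continuous_image continuous_intros convex_connected convex_P)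
  moreover have "\<exists>a\<in>A. \<exists>b\<in>B. (a, b) \<in> V" using cover[of z] centre_mem_P V_sub by (auto simp: P_def)
  then obtain a b where ab: "(a, b) \<in> V" "a \<in> A" "b \<in> B" by blast
  from corner[OF ab(1)] obtain v where v: "f a v = 0" "f b v = 0" "\<forall>c\<in>A \<union> B - {a, b}. 0 < f c v" by blast
  then have "v \<in> P" unfolding P_def by (auto simp: less_imp_le) (metis DiffI Un_iff insertE less_imp_le order_refl singletonD)+
  then have "(v, (0, 0)) \<in> sheet \<sigma> ` P" for \<sigma>
    using height_zero[of a A v] height_zero[of b B v] ab v by (intro image_eqI[of _ _ v]) (auto simp: sheet_def)
  then have "(v, (0, 0)) \<in> \<Inter> ((\<lambda>\<sigma>. sheet \<sigma> ` P) ` signs)" by blast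
  then have "\<Inter> ((\<lambda>\<sigma>. sheet \<sigma> ` P) ` signs) \<noteq> {}" by blast
  ultimately show ?thesis unfolding S_eq_sheets by (intro connected_Union) auto
qed

lemma closed_surface_S: "closed_surface S"
  unfolding closed_surface_def
proof (intro conjI ballI compact_S connected_S)
  show "S \<noteq> {}" using sheet_mem_S[OF _ centre_mem_P, of "(1, 1)"] by (auto simp: signs_def)
  fix s assume s: "s \<in> S"
  then obtain a b where ab: "(a, b) \<in> V" "s \<in> star a b" using S_covered by blast
  from star_chart[OF ab(1)] obtain D h where D: "homeomorphism (star a b) D (chart a b) h" "open D" by blast
  have "chart a b s \<in> D" using D(1) ab(2) by (auto simp: homeomorphism_def)
  then obtain e where e: "0 < e" "ball (chart a b s) e \<subseteq> D" using D(2) openE by blast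
  let ?U = "h ` ball (chart a b s) e"
  have hom: "homeomorphism (ball (chart a b s) e) ?U h (chart a b)"
    by (rule homeomorphism_of_subsets[OF homeomorphism_symD[OF D(1)] e(2)]) (auto simp: homeomorphism_def)
  have "openin (top_of_set (star a b)) ?U"
    using homeomorphism_imp_open_map[OF homeomorphism_symD[OF D(1)], of "ball (chart a b s) e"] e(2) D(2)
    by (simp add: openin_open_eq)
  then have "openin (top_of_set S) ?U" using openin_star openin_trans by blast
  moreover have "h (chart a b s) = s" using D(1) ab(2) by (simp add: homeomorphism_def)
  then have "s \<in> ?U" using e(1) by (metis centre_in_ball imageI)
  moreover have "?U homeomorphic (UNIV :: (real^2) set)"
  proof -
    have "?U homeomorphic ball (chart a b s) e"
      unfolding homeomorphic_def using homeomorphism_symD[OF hom] by blast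
    also have "ball (chart a b s) e homeomorphic (UNIV :: (real \<times> real) set)"
      using e(1) by (rule homeomorphic_ball_UNIV)
    also have "(UNIV :: (real \<times> real) set) homeomorphic (UNIV :: (real^2) set)"
      by (simp add: homeomorphic_UNIV_UNIV)
    finally show ?thesis .
  qed
  ultimately show "\<exists>U. openin (top_of_set S) U \<and> s \<in> U \<and> U homeomorphic (UNIV :: (real^2) set)" by blast
qed

end


section \<open>A covering space of the surface\<close>

text \<open>The covering space consists of one copy of the polygon for each element \<open>w\<close> of a group
  \<open>G\<close> that has an involution \<open>g c\<close> for each side \<open>c\<close>; the copies for \<open>w\<close> and \<open>w \<otimes> g c\<close> are
  glued along side \<open>c\<close>. To obtain it as a subspace of a normed space instead of a quotient,
  the copies are separated by coordinates that belong to pairs of a corner \<open>v\<close> and a coset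
  of the subgroup of order four at \<open>v\<close>. A point in the copy for \<open>w\<close> has coordinate
  \<open>corner_weight v p\<close> at the coset of \<open>w\<close> and 0 at the other cosets. The weight vanishes on
  the sides that do not meet at \<open>v\<close>, where the coset may change, and the coset does not
  change across the sides that do meet at \<open>v\<close>.\<close>

definition unit_seq :: "nat \<Rightarrow> (nat \<Rightarrow>\<^sub>C real)" where
  "unit_seq n = Bcontfun (\<lambda>k. if k = n then 1 else 0)"

lemma apply_unit_seq: "apply_bcontfun (unit_seq n) k = (if k = n then 1 else 0)"
proof -
  have "(\<lambda>k. if k = n then 1 else 0 :: real) \<in> bcontfun"
    by (rule bcontfun_normI[where b = 1]) (auto intro: continuous_on_discrete)
  then show ?thesis by (simp add: unit_seq_def Bcontfun_inverse)
qed

lemma continuous_on_apply_bcontfun_at: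
  fixes g :: "'x::topological_space \<Rightarrow> (nat \<Rightarrow>\<^sub>C real)"
  assumes "continuous_on X g"
  shows "continuous_on X (\<lambda>x. apply_bcontfun (g x) n)"
proof -
  have "continuous_on UNIV (\<lambda>h :: nat \<Rightarrow>\<^sub>C real. apply_bcontfun h n)"
    unfolding continuous_on_iff
    by (meson dist_bounded le_less_trans)
  then show ?thesis using assms by (rule continuous_on_compose2) auto
qed

lemma apply_bcontfun_sum: "apply_bcontfun (sum h X) n = (\<Sum>x\<in>X. apply_bcontfun (h x) n)"
  by (induction X rule: infinite_finite_induct) auto

locale polygon_group = mirrored_polygon A B V f z m + Group.group G
  for A B :: "'c set" and V f z m and G (structure) +
  fixes g :: "'c \<Rightarrow> 'g" and sgn :: "'g \<Rightarrow> real \<times> real"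
  assumes g_closed: "c \<in> A \<union> B \<Longrightarrow> g c \<in> carrier G"
    and g_square: "c \<in> A \<union> B \<Longrightarrow> g c \<otimes> g c = \<one>"
    and g_commute: "(a, b) \<in> V \<Longrightarrow> g a \<otimes> g b = g b \<otimes> g a"
    and sgn_one: "sgn \<one> = (1, 1)"
    and sgn_A: "w \<in> carrier G \<Longrightarrow> a \<in> A \<Longrightarrow> sgn (w \<otimes> g a) = (- fst (sgn w), snd (sgn w))"
    and sgn_B: "w \<in> carrier G \<Longrightarrow> b \<in> B \<Longrightarrow> sgn (w \<otimes> g b) = (fst (sgn w), - snd (sgn w))"
    and sgn_signs: "w \<in> carrier G \<Longrightarrow> sgn w \<in> signs"
    and countable_G: "countable (carrier G)"
begin

definition corner_coset :: "'g \<Rightarrow> 'c \<times> 'c \<Rightarrow> 'g set" where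
  "corner_coset w v = {w, w \<otimes> g (fst v), w \<otimes> g (snd v), w \<otimes> g (fst v) \<otimes> g (snd v)}"

definition coset_index :: "('c \<times> 'c) \<times> 'g set \<Rightarrow> nat" where
  "coset_index = to_nat_on ((\<lambda>(v, w). (v, corner_coset w v)) ` (V \<times> carrier G))"

definition corner_weight :: "'c \<times> 'c \<Rightarrow> real \<times> real \<Rightarrow> real" where
  "corner_weight v = height (A \<union> B - {fst v, snd v})"

definition coset_coords :: "'g \<Rightarrow> real \<times> real \<Rightarrow> (nat \<Rightarrow>\<^sub>C real)" where
  "coset_coords w p = (\<Sum>v\<in>V. corner_weight v p *\<^sub>R unit_seq (coset_index (v, corner_coset w v)))"

definition tile :: "'g \<Rightarrow> real \<times> real \<Rightarrow> ((real \<times> real) \<times> (real \<times> real)) \<times> (nat \<Rightarrow>\<^sub>C real)" where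
  "tile w p = (sheet (sgn w) p, coset_coords w p)"

definition tiling where "tiling = {tile w p | w p. w \<in> carrier G \<and> p \<in> P}"

lemma tile_mem_tiling: "w \<in> carrier G \<Longrightarrow> p \<in> P \<Longrightarrow> tile w p \<in> tiling"
  unfolding tiling_def by blast

lemma tilingE:
  assumes "x \<in> tiling" obtains w p where "w \<in> carrier G" "p \<in> P" "x = tile w p"
  using assms unfolding tiling_def by blast

lemma V_letters: "v \<in> V \<Longrightarrow> fst v \<in> A \<and> snd v \<in> B"
  using V_sub by auto

lemma finite_V: "finite V"
  using V_sub finite_A finite_B by (meson finite_SigmaI finite_subset)

lemma coset_index_inj:
  assumes "v \<in> V" "w \<in> carrier G" "v' \<in> V" "w' \<in> carrier G"
  shows "coset_index (v, corner_coset w v) = coset_index (v', corner_coset w' v') \<longleftrightarrow>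
    v = v' \<and> corner_coset w v = corner_coset w' v'"
proof -
  have "countable ((\<lambda>(v, w). (v, corner_coset w v)) ` (V \<times> carrier G))"
    using finite_V countable_G by (intro countable_image countable_SIGMA) (auto intro: countable_finite)
  then have "inj_on coset_index ((\<lambda>(v, w). (v, corner_coset w v)) ` (V \<times> carrier G))"
    unfolding coset_index_def by (rule inj_on_to_nat_on)
  then show ?thesis using assms by (subst inj_on_eq_iff) (auto intro!: image_eqI[of _ _ "(_, _)"])
qed

lemma apply_coset_coords:
  assumes "w \<in> carrier G" "v \<in> V" "w' \<in> carrier G"
  shows "apply_bcontfun (coset_coords w p) (coset_index (v, corner_coset w' v)) =
    (if corner_coset w v = corner_coset w' v then corner_weight v p else 0)"
proof -
  have "apply_bcontfun (coset_coords w p) (coset_index (v, corner_coset w' v)) =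
    (\<Sum>u\<in>V. if u = v then if corner_coset w v = corner_coset w' v then corner_weight v p else 0 else 0)"
    unfolding coset_coords_def apply_bcontfun_sum
    using assms by (intro sum.cong) (auto simp: apply_unit_seq coset_index_inj)
  then show ?thesis using assms(2) finite_V by simp
qed

lemma corner_weight_pos: "(\<And>c. c \<in> A \<union> B - {a, b} \<Longrightarrow> 0 < f c p) \<Longrightarrow> 0 < corner_weight (a, b) p"
  unfolding corner_weight_def by (intro height_pos) auto

lemma corner_weight_pos_iff:
  assumes "p \<in> P"
  shows "0 < corner_weight (a, b) p \<longleftrightarrow> (\<forall>c\<in>A \<union> B - {a, b}. 0 < f c p)"
proof
  assume pos: "0 < corner_weight (a, b) p"
  show "\<forall>c\<in>A \<union> B - {a, b}. 0 < f c p"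
  proof
    fix c assume c: "c \<in> A \<union> B - {a, b}"
    then have "f c p \<noteq> 0" using pos height_zero[of c "A \<union> B - {a, b}" p]
      by (auto simp: corner_weight_def)
    moreover have "0 \<le> f c p" using assms c by (auto simp: P_def)
    ultimately show "0 < f c p" by simp
  qed
next
  assume "\<forall>c\<in>A \<union> B - {a, b}. 0 < f c p"
  then show "0 < corner_weight (a, b) p" by (intro corner_weight_pos) blast
qed

lemma letters_closed: "a \<in> A \<Longrightarrow> g a \<in> carrier G" "b \<in> B \<Longrightarrow> g b \<in> carrier G"
  using g_closed by auto

lemma g_cancel: "c \<in> A \<union> B \<Longrightarrow> x \<in> carrier G \<Longrightarrow> g c \<otimes> (g c \<otimes> x) = x"
  using g_square g_closed by (simp add: m_assoc[symmetric])

lemma corner_coset_mult: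
  assumes ab: "(a, b) \<in> V" and w: "w \<in> carrier G" and c: "c = a \<or> c = b"
  shows "corner_coset (w \<otimes> g c) (a, b) = corner_coset w (a, b)"
proof -
  have "a \<in> A" "b \<in> B" using V_letters[OF ab] by auto
  then show ?thesis using c g_commute[OF ab] w
    by (auto simp: corner_coset_def m_assoc letters_closed g_square g_cancel)
qed

lemma coset_coords_side:
  assumes w: "w \<in> carrier G" and c: "c \<in> A \<union> B" and p: "f c p = 0"
  shows "coset_coords (w \<otimes> g c) p = coset_coords w p"
  unfolding coset_coords_def
proof (rule sum.cong[OF HOL.refl])
  fix v assume v: "v \<in> V"
  obtain a b where ab: "v = (a, b)" by (cases v)
  show "corner_weight v p *\<^sub>R unit_seq (coset_index (v, corner_coset (w \<otimes> g c) v)) =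
      corner_weight v p *\<^sub>R unit_seq (coset_index (v, corner_coset w v))"
  proof (cases "c = a \<or> c = b")
    case True
    then show ?thesis using v corner_coset_mult[OF _ w] by (auto simp: ab)
  next
    case False
    then have "corner_weight v p = 0"
      unfolding corner_weight_def using c p by (intro height_zero[of c]) (auto simp: ab)
    then show ?thesis by simp
  qed
qed

lemma sheet_side:
  assumes w: "w \<in> carrier G" and c: "c \<in> A \<union> B" and p: "f c p = 0"
  shows "sheet (sgn (w \<otimes> g c)) p = sheet (sgn w) p"
proof (cases "c \<in> A")
  case True
  then show ?thesis using height_zero[of c A p] p by (simp add: sheet_def sgn_A[OF w])
next
  case False
  then have "c \<in> B" using c by auto
  then show ?thesis using height_zero[of c B p] p by (simp add: sheet_def sgn_B[OF w])
qed

lemma tile_side: "w \<in> carrier G \<Longrightarrow> c \<in> A \<union> B \<Longrightarrow> f c p = 0 \<Longrightarrow> tile (w \<otimes> g c) p = tile w p"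
  by (simp add: tile_def coset_coords_side sheet_side)

lemma continuous_on_coset_coords [continuous_intros]:
  "continuous_on X h \<Longrightarrow> continuous_on X (\<lambda>x. coset_coords w (h x))"
  unfolding coset_coords_def corner_weight_def by (intro continuous_intros)

lemma continuous_on_tile [continuous_intros]:
  "continuous_on X h \<Longrightarrow> continuous_on X (\<lambda>x. tile w (h x))"
  unfolding tile_def by (intro continuous_intros)

lemma fst_tile [simp]: "fst (tile w p) = sheet (sgn w) p" "snd (tile w p) = coset_coords w p"
  by (simp_all add: tile_def)

lemma corner_exists: "\<exists>a b. (a, b) \<in> V"
  using cover[of z] centre_mem_P by (auto simp: P_def)

lemma fst_tiling: "fst ` tiling = S"
proof -
  obtain a b where ab: "(a, b) \<in> V" using corner_exists by blast
  then have l: "a \<in> A" "b \<in> B" using V_letters by auto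
  have "sgn \<one> = (1, 1)" "sgn (g a) = (-1, 1)" "sgn (g b) = (1, -1)" "sgn (g a \<otimes> g b) = (-1, -1)"
    using sgn_A[of \<one> a] sgn_B[of \<one> b] sgn_B[of "g a" b] l by (simp_all add: sgn_one letters_closed)
  then have "signs \<subseteq> sgn ` carrier G"
    using l by (auto simp: signs_def letters_closed
        intro: rev_image_eqI[of \<one>] rev_image_eqI[of "g a"] rev_image_eqI[of "g b"] rev_image_eqI[of "g a \<otimes> g b"])
  then have "signs = sgn ` carrier G" using sgn_signs by auto
  moreover have "fst ` tiling = (\<Union>\<sigma>\<in>sgn ` carrier G. sheet \<sigma> ` P)"
    by (force simp: tiling_def)
  ultimately show ?thesis by (simp add: S_eq_sheets)
qed

text \<open>The tiles of one sheet around a corner \<open>(a, b)\<close> are the four elements of a coset of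
  the subgroup generated by \<open>g a\<close> and \<open>g b\<close>. The signs \<open>sgn\<close> tell them apart.\<close>

definition corner_elt :: "'g \<Rightarrow> 'c \<Rightarrow> 'c \<Rightarrow> bool \<Rightarrow> bool \<Rightarrow> 'g" where
  "corner_elt w a b i j = w \<otimes> (if i then g a else \<one>) \<otimes> (if j then g b else \<one>)"

lemma corner_elt_props:
  assumes ab: "(a, b) \<in> V" and w: "w \<in> carrier G"
  shows "corner_elt w a b i j \<in> carrier G"
    and "corner_coset (corner_elt w a b i j) (a, b) = corner_coset w (a, b)"
    and "sgn (corner_elt w a b i j) = ((if i then - fst (sgn w) else fst (sgn w)), (if j then - snd (sgn w) else snd (sgn w)))"
    and "f a p = 0 \<Longrightarrow> coset_coords (corner_elt w a b i j) p = coset_coords (corner_elt w a b i' j) p"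
    and "f b p = 0 \<Longrightarrow> coset_coords (corner_elt w a b i j) p = coset_coords (corner_elt w a b i j') p"
proof -
  have l: "a \<in> A" "b \<in> B" using V_letters[OF ab] by auto
  show closed: "corner_elt w a b i j \<in> carrier G" for i j using w l by (simp add: corner_elt_def letters_closed)
  show "corner_coset (corner_elt w a b i j) (a, b) = corner_coset w (a, b)"
    using corner_coset_mult[OF ab, of _ a] corner_coset_mult[OF ab, of _ b] w l
    by (simp add: corner_elt_def letters_closed)
  show "sgn (corner_elt w a b i j) = ((if i then - fst (sgn w) else fst (sgn w)), (if j then - snd (sgn w) else snd (sgn w)))"
    using w l by (simp add: corner_elt_def letters_closed sgn_A sgn_B)
  have a: "corner_elt w a b True j = corner_elt w a b False j \<otimes> g a" for j
    using w l g_commute[OF ab] by (simp add: corner_elt_def letters_closed m_assoc)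
  have b: "corner_elt w a b i True = corner_elt w a b i False \<otimes> g b" for i
    using w l by (simp add: corner_elt_def letters_closed)
  show "coset_coords (corner_elt w a b i j) p = coset_coords (corner_elt w a b i' j) p" if "f a p = 0"
    using coset_coords_side[OF closed _ that, of False j] l by (cases i; cases i') (simp_all add: a)
  show "coset_coords (corner_elt w a b i j) p = coset_coords (corner_elt w a b i j') p" if "f b p = 0"
    using coset_coords_side[OF closed _ that, of i False] l by (cases j; cases j') (simp_all add: b)
qed

lemma corner_coset_elt:
  assumes ab: "(a, b) \<in> V" and "w \<in> carrier G" "w' \<in> carrier G" "corner_coset w' (a, b) = corner_coset w (a, b)"
  shows "\<exists>i j. w' = corner_elt w a b i j"
proof -
  have l: "a \<in> A" "b \<in> B" using V_letters[OF ab] by auto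
  have "w' \<in> corner_coset w (a, b)" using assms(4) by (metis corner_coset_def insertI1)
  then have "w' = corner_elt w a b False False \<or> w' = corner_elt w a b True False \<or>
      w' = corner_elt w a b False True \<or> w' = corner_elt w a b True True"
    using assms(2) l by (auto simp: corner_coset_def corner_elt_def letters_closed)
  then show ?thesis by blast
qed

text \<open>The local inverse of the projection that takes values in the sheet of \<open>w\<close>. Which of
  the four tiles is entered depends on whether the signs of the point agree with those of
  \<open>w\<close>.\<close>

definition star_section :: "'g \<Rightarrow> 'c \<Rightarrow> 'c \<Rightarrow> (real \<times> real) \<times> (real \<times> real) \<Rightarrow>
    ((real \<times> real) \<times> (real \<times> real)) \<times> (nat \<Rightarrow>\<^sub>C real)" where
  "star_section w a b s = (s, coset_coords
     (corner_elt w a b (fst (sgn w) * fst (snd s) < 0) (snd (sgn w) * snd (snd s) < 0)) (fst s))"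

lemma star_zero:
  assumes ab: "(a, b) \<in> V" and s: "s \<in> star a b"
  shows "fst (snd s) = 0 \<Longrightarrow> f a (fst s) = 0" "snd (snd s) = 0 \<Longrightarrow> f b (fst s) = 0"
proof -
  have l: "a \<in> A" "b \<in> B" using V_letters[OF ab] by auto
  have s': "s \<in> S" "\<forall>c\<in>A \<union> B - {a, b}. 0 < f c (fst s)" using s by (auto simp: star_def)
  have pos: "0 < height (A - {a}) (fst s)" "0 < height (B - {b}) (fst s)"
    using s'(2) l disjoint by (auto intro!: height_pos)
  show "f a (fst s) = 0" if "fst (snd s) = 0"
    using s'(1) that pos height_remove[of a A "fst s"] l by (auto simp: S_def)
  show "f b (fst s) = 0" if "snd (snd s) = 0"
    using s'(1) that pos height_remove[of b B "fst s"] l by (auto simp: S_def)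
qed

lemma continuous_on_if_sign:
  fixes h :: "'x::topological_space \<Rightarrow> real" and F :: "bool \<Rightarrow> 'x \<Rightarrow> 'y::topological_space"
  assumes "continuous_on X h" "continuous_on X (F True)" "continuous_on X (F False)"
    and "\<And>x. x \<in> X \<Longrightarrow> h x = 0 \<Longrightarrow> F True x = F False x"
  shows "continuous_on X (\<lambda>x. F (h x < 0) x)"
proof -
  have "continuous_on ({x\<in>X. h x \<le> 0} \<union> {x\<in>X. 0 \<le> h x}) (\<lambda>x. if h x < 0 then F True x else F False x)"
  proof (rule continuous_on_cases_local)
    have eq: "{x\<in>X. h x \<le> 0} \<union> {x\<in>X. 0 \<le> h x} = X" by auto
    show "closedin (top_of_set ({x\<in>X. h x \<le> 0} \<union> {x\<in>X. 0 \<le> h x})) {x\<in>X. h x \<le> 0}"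
      unfolding eq using continuous_closedin_preimage[OF assms(1), of "{..0}"] by (simp add: vimage_def Int_def)
    show "closedin (top_of_set ({x\<in>X. h x \<le> 0} \<union> {x\<in>X. 0 \<le> h x})) {x\<in>X. 0 \<le> h x}"
      unfolding eq using continuous_closedin_preimage[OF assms(1), of "{0..}"] by (simp add: vimage_def Int_def)
    show "continuous_on {x\<in>X. h x \<le> 0} (F True)" "continuous_on {x\<in>X. 0 \<le> h x} (F False)"
      using assms(2,3) by (auto intro: continuous_on_subset)
    show "F True x = F False x"
      if "x \<in> {x\<in>X. h x \<le> 0} \<and> \<not> h x < 0 \<or> x \<in> {x\<in>X. 0 \<le> h x} \<and> h x < 0" for x
      using that assms(4) by auto
  qed
  moreover have "{x\<in>X. h x \<le> 0} \<union> {x\<in>X. 0 \<le> h x} = X" by auto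
  moreover have "(\<lambda>x. if h x < 0 then F True x else F False x) = (\<lambda>x. F (h x < 0) x)" by auto
  ultimately show ?thesis by argo
qed

lemma continuous_on_star_section:
  assumes ab: "(a, b) \<in> V" and w: "w \<in> carrier G"
  shows "continuous_on (star a b) (star_section w a b)"
proof -
  have sg: "fst (sgn w) \<noteq> 0" "snd (sgn w) \<noteq> 0" using sgn_signs[OF w] by (auto simp: signs_def)
  have "continuous_on (star a b) (\<lambda>s. coset_coords (corner_elt w a b i (snd (sgn w) * snd (snd s) < 0)) (fst s))" for i
    using corner_elt_props(5)[OF ab w] star_zero[OF ab] sg
    by (intro continuous_on_if_sign[where F = "\<lambda>j s. coset_coords (corner_elt w a b i j) (fst s)"] continuous_intros) auto
  then have "continuous_on (star a b) (\<lambda>s. coset_coords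
     (corner_elt w a b (fst (sgn w) * fst (snd s) < 0) (snd (sgn w) * snd (snd s) < 0)) (fst s))"
    using corner_elt_props(4)[OF ab w] star_zero[OF ab] sg
    by (intro continuous_on_if_sign[where F = "\<lambda>i s. coset_coords (corner_elt w a b i (snd (sgn w) * snd (snd s) < 0)) (fst s)"]
        continuous_intros) auto
  then show ?thesis unfolding star_section_def by (intro continuous_intros)
qed

lemma star_section_tile:
  assumes ab: "(a, b) \<in> V" and w: "w \<in> carrier G" and s: "s \<in> star a b"
  shows "star_section w a b s = tile (corner_elt w a b (fst (sgn w) * fst (snd s) < 0) (snd (sgn w) * snd (snd s) < 0)) (fst s)"
  using s sgn_signs[OF w] corner_elt_props(3)[OF ab w]
  by (auto simp: star_section_def tile_def sheet_def star_def S_def signs_def prod_eq_iff)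

lemma tile_eq_star_section:
  assumes ab: "(a, b) \<in> V" and w: "w \<in> carrier G" and w': "w' \<in> carrier G" and p: "p \<in> P"
    and coset: "corner_coset w' (a, b) = corner_coset w (a, b)" and s: "sheet (sgn w') p \<in> star a b"
  shows "tile w' p = star_section w a b (sheet (sgn w') p)"
proof -
  obtain i j where ij: "w' = corner_elt w a b i j" using corner_coset_elt[OF ab w w' coset] by blast
  let ?s = "sheet (sgn w') p"
  let ?i = "fst (sgn w) * fst (snd ?s) < 0" and ?j = "snd (sgn w) * snd (snd ?s) < 0"
  have h: "height A p = 0 \<or> 0 < height A p" "height B p = 0 \<or> 0 < height B p"
    using height_nonneg[OF p, of A] height_nonneg[OF p, of B] by auto
  have i: "i = ?i \<or> f a p = 0"
    using star_zero(1)[OF ab s] h sgn_signs[OF w] corner_elt_props(3)[OF ab w, of i j]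
    by (auto simp: ij sheet_def signs_def split: if_splits)
  have j: "j = ?j \<or> f b p = 0"
    using star_zero(2)[OF ab s] h sgn_signs[OF w] corner_elt_props(3)[OF ab w, of i j]
    by (auto simp: ij sheet_def signs_def split: if_splits)
  have "coset_coords (corner_elt w a b i j) p = coset_coords (corner_elt w a b ?i j) p"
    using i by (rule disjE) (erule arg_cong, erule corner_elt_props(4)[OF ab w])
  moreover have "coset_coords (corner_elt w a b ?i j) p = coset_coords (corner_elt w a b ?i ?j) p"
    using j by (rule disjE) (erule arg_cong, erule corner_elt_props(5)[OF ab w])
  ultimately have "coset_coords (corner_elt w a b i j) p = coset_coords (corner_elt w a b ?i ?j) p" by simp
  then show ?thesis by (simp add: tile_def star_section_def ij)
qed

text \<open>The star of a corner is evenly covered. The sheets over it are the sets of points at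
  which the coordinate of one coset at this corner is positive. Thus they are open and
  disjoint, and each consists of four tiles that \<open>star_section\<close> assembles.\<close>

theorem covering_space_tiling: "covering_space tiling fst S"
  unfolding covering_space_def
proof (intro conjI ballI)
  show "continuous_on tiling fst" by (intro continuous_intros)
  show "fst ` tiling = S" by (rule fst_tiling)
  fix s assume "s \<in> S"
  then obtain a b where ab: "(a, b) \<in> V" and s: "s \<in> star a b" using S_covered by blast
  define slice where "slice w = {x \<in> tiling. 0 < apply_bcontfun (snd x) (coset_index ((a, b), corner_coset w (a, b)))}" for w
  have slice: "tile w' p \<in> slice w \<longleftrightarrow> corner_coset w' (a, b) = corner_coset w (a, b) \<and> sheet (sgn w') p \<in> star a b"
    if "w \<in> carrier G" "w' \<in> carrier G" "p \<in> P" for w w' p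
    using that ab apply_coset_coords[OF that(2) ab that(1), of p] corner_weight_pos_iff[OF that(3), of a b]
      sheet_mem_S[OF sgn_signs[OF that(2)] that(3)]
    by (auto simp: slice_def star_def tile_mem_tiling)
  show "\<exists>T. s \<in> T \<and> openin (top_of_set S) T \<and>
      (\<exists>v. \<Union>v = tiling \<inter> fst -` T \<and> (\<forall>u\<in>v. openin (top_of_set tiling) u) \<and> pairwise disjnt v \<and>
        (\<forall>u\<in>v. \<exists>q. homeomorphism u T fst q))"
  proof (intro exI[of _ "star a b"] conjI exI[of _ "slice ` carrier G"] ballI s openin_star)
    show "\<Union> (slice ` carrier G) = tiling \<inter> fst -` star a b"
    proof (intro equalityI subsetI)
      fix x assume "x \<in> \<Union> (slice ` carrier G)"
      then obtain w where w: "w \<in> carrier G" "x \<in> slice w" by blast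
      then obtain w' p where x: "w' \<in> carrier G" "p \<in> P" "x = tile w' p"
        by (auto simp: slice_def elim: tilingE)
      with w slice[OF w(1) x(1,2)] show "x \<in> tiling \<inter> fst -` star a b" by (auto simp: tile_mem_tiling)
    next
      fix x assume x: "x \<in> tiling \<inter> fst -` star a b"
      then obtain w' p where "w' \<in> carrier G" "p \<in> P" "x = tile w' p" by (auto elim: tilingE)
      with x slice[of w' w' p] show "x \<in> \<Union> (slice ` carrier G)" by auto
    qed
    show "pairwise disjnt (slice ` carrier G)"
    proof (rule pairwiseI)
      fix u u' assume "u \<in> slice ` carrier G" "u' \<in> slice ` carrier G" and ne: "u \<noteq> u'"
      then obtain w w' where w: "w \<in> carrier G" "u = slice w" "w' \<in> carrier G" "u' = slice w'" by blast
      show "disjnt u u'"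
      proof (rule ccontr)
        assume "\<not> disjnt u u'"
        then obtain x where x: "x \<in> slice w" "x \<in> slice w'" by (auto simp: disjnt_def w)
        then obtain w'' p where x': "w'' \<in> carrier G" "p \<in> P" "x = tile w'' p"
          by (auto simp: slice_def elim: tilingE)
        have "corner_coset w (a, b) = corner_coset w' (a, b)"
          using x x'(3) slice[OF w(1) x'(1,2)] slice[OF w(3) x'(1,2)] by simp
        with ne w show False by (simp add: slice_def)
      qed
    qed
    fix u assume "u \<in> slice ` carrier G"
    then obtain w where w: "w \<in> carrier G" "u = slice w" by blast
    have "openin (top_of_set tiling) (tiling \<inter> (\<lambda>x. apply_bcontfun (snd x) (coset_index ((a, b), corner_coset w (a, b)))) -` {0<..})"
      by (intro continuous_openin_preimage_gen continuous_on_apply_bcontfun_at continuous_intros)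
    moreover have "tiling \<inter> (\<lambda>x. apply_bcontfun (snd x) (coset_index ((a, b), corner_coset w (a, b)))) -` {0<..} = u"
      by (auto simp: w slice_def)
    ultimately show "openin (top_of_set tiling) u" by simp
    have "homeomorphism u (star a b) fst (star_section w a b)"
    proof (rule homeomorphismI)
      show "continuous_on u fst" by (intro continuous_intros)
      show "continuous_on (star a b) (star_section w a b)" by (rule continuous_on_star_section[OF ab w(1)])
      show "fst ` u \<subseteq> star a b"
      proof
        fix y assume "y \<in> fst ` u"
        then obtain x where x: "x \<in> slice w" "y = fst x" using w by auto
        then obtain w' p where x': "w' \<in> carrier G" "p \<in> P" "x = tile w' p"
          by (auto simp: slice_def elim: tilingE)
        with x slice[OF w(1) x'(1,2)] show "y \<in> star a b" by auto
      qed
      show "star_section w a b ` star a b \<subseteq> u"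
      proof
        fix x assume "x \<in> star_section w a b ` star a b"
        then obtain y where y: "y \<in> star a b" "x = star_section w a b y" by blast
        let ?w = "corner_elt w a b (fst (sgn w) * fst (snd y) < 0) (snd (sgn w) * snd (snd y) < 0)"
        have x: "x = tile ?w (fst y)" using star_section_tile[OF ab w(1) y(1)] y(2) by simp
        have "fst x = y" by (simp add: y star_section_def)
        then have "sheet (sgn ?w) (fst y) = y" by (simp add: x)
        moreover have "fst y \<in> P" using y(1) by (auto simp: star_def S_def)
        ultimately show "x \<in> u"
          using slice[OF w(1) corner_elt_props(1)[OF ab w(1)], of "fst y"] corner_elt_props(2)[OF ab w(1)] y(1)
          by (simp add: x w(2))
      qed
      show "star_section w a b (fst x) = x" if "x \<in> u" for x
      proof -
        have "x \<in> tiling" using that by (simp add: w(2) slice_def)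
        then obtain w' p where x: "w' \<in> carrier G" "p \<in> P" "x = tile w' p" by (rule tilingE)
        then have "corner_coset w' (a, b) = corner_coset w (a, b)" "sheet (sgn w') p \<in> star a b"
          using that slice[OF w(1) x(1,2)] by (simp_all add: w(2))
        from tile_eq_star_section[OF ab w(1) x(1,2) this] show ?thesis by (simp add: x(3) del: fst_tile)(simp add: star_section_def tile_def)
      qed
      show "fst (star_section w a b y) = y" for y by (simp add: star_section_def)
    qed
    then show "\<exists>q. homeomorphism u (star a b) fst q" by blast
  qed
qed

text \<open>The coset coordinates at one corner determine \<open>w\<close> up to the subgroup of order four,
  and the signs determine it within its coset.\<close>

lemma tile_centre_inj:
  assumes "w \<in> carrier G" "w' \<in> carrier G" "tile w z = tile w' z"
  shows "w = w'"
proof -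
  obtain a b where ab: "(a, b) \<in> V" using corner_exists by blast
  have l: "a \<in> A" "b \<in> B" using V_letters[OF ab] by auto
  have eq: "sheet (sgn w) z = sheet (sgn w') z" "coset_coords w z = coset_coords w' z"
    using assms(3) by (simp_all add: tile_def)
  have "0 < height A z" "0 < height B z" using centre by (auto intro!: height_pos)
  then have sg: "sgn w = sgn w'" using eq(1) by (auto simp: sheet_def prod_eq_iff)
  have "0 < corner_weight (a, b) z" using centre by (auto intro!: corner_weight_pos)
  then have "corner_coset w' (a, b) = corner_coset w (a, b)"
    using eq(2) apply_coset_coords[OF assms(1) ab assms(1), of z] apply_coset_coords[OF assms(2) ab assms(1), of z]
    by (auto split: if_splits)
  then obtain i j where ij: "w' = corner_elt w a b i j" using corner_coset_elt[OF ab assms(1,2)] by blast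
  then have "\<not> i" "\<not> j" using sg corner_elt_props(3)[OF ab assms(1), of i j] sgn_signs[OF assms(1)]
    by (auto simp: signs_def split: if_splits)
  then show ?thesis using assms(1) by (simp add: ij corner_elt_def)
qed

end


section \<open>Galleries and the fundamental group\<close>

definition path_in :: "'a::topological_space set \<Rightarrow> (real \<Rightarrow> 'a) \<Rightarrow> 'a \<Rightarrow> 'a \<Rightarrow> bool" where
  "path_in X p x y \<longleftrightarrow> path p \<and> path_image p \<subseteq> X \<and> pathstart p = x \<and> pathfinish p = y"

lemma path_in_join: "path_in X p x y \<Longrightarrow> path_in X q y w \<Longrightarrow> path_in X (p +++ q) x w"
  by (simp add: path_in_def path_image_join)

lemma path_in_mono: "path_in X p x y \<Longrightarrow> X \<subseteq> Y \<Longrightarrow> path_in Y p x y"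
  by (auto simp: path_in_def)

lemma path_in_const: "x \<in> X \<Longrightarrow> path_in X (linepath x x) x x"
  for x :: "'a::real_normed_vector"
  by (simp add: path_in_def)

lemma homotopic_join:
  "homotopic_paths X p p' \<Longrightarrow> homotopic_paths X q q' \<Longrightarrow> path_in Y p x y \<Longrightarrow> path_in Z q y w \<Longrightarrow>
    homotopic_paths X (p +++ q) (p' +++ q')"
  by (rule homotopic_paths_join) (simp_all add: path_in_def)

lemma homotopic_assoc:
  "path_in X p x y \<Longrightarrow> path_in X q y w \<Longrightarrow> path_in X r w v \<Longrightarrow>
    homotopic_paths X (p +++ (q +++ r)) ((p +++ q) +++ r)"
  by (rule homotopic_paths_assoc) (simp_all add: path_in_def)

lemma homotopic_refl: "path_in X p x y \<Longrightarrow> homotopic_paths X p p"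
  by (simp add: path_in_def)

lemma homotopic_sym: "homotopic_paths X p q \<Longrightarrow> homotopic_paths X q p"
  by (simp add: homotopic_paths_sym)

lemma homotopic_const_left:
  "path_in X p x y \<Longrightarrow> homotopic_paths X (linepath x x +++ p) p" for x :: "'a::real_normed_vector"
  by (rule homotopic_paths_lid') (simp_all add: path_in_def)

lemma homotopic_const_right:
  "path_in X p x y \<Longrightarrow> homotopic_paths X (p +++ linepath y y) p" for x :: "'a::real_normed_vector"
  by (rule homotopic_paths_rid') (simp_all add: path_in_def)

lemma linepath_same_comp: "h \<circ> linepath x x = linepath (h x) (h x)"
  for h :: "'a::real_normed_vector \<Rightarrow> 'b::real_normed_vector"
  by (simp add: fun_eq_iff linepath_refl)

text \<open>Equality in the Coxeter group whose generators are the sides of the polygon and in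
  which the sides at a corner commute.\<close>

inductive mirror_equiv :: "'c set \<Rightarrow> ('c \<times> 'c) set \<Rightarrow> 'c list \<Rightarrow> 'c list \<Rightarrow> bool" for C V where
  refl: "u \<in> lists C \<Longrightarrow> mirror_equiv C V u u"
| sym: "mirror_equiv C V u v \<Longrightarrow> mirror_equiv C V v u"
| trans: "mirror_equiv C V u v \<Longrightarrow> mirror_equiv C V v w \<Longrightarrow> mirror_equiv C V u w"
| square: "u \<in> lists C \<Longrightarrow> v \<in> lists C \<Longrightarrow> c \<in> C \<Longrightarrow> mirror_equiv C V (u @ [c, c] @ v) (u @ v)"
| swap: "u \<in> lists C \<Longrightarrow> v \<in> lists C \<Longrightarrow> (a, b) \<in> V \<Longrightarrow>
    mirror_equiv C V (u @ [a, b] @ v) (u @ [b, a] @ v)"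

context mirrored_polygon
begin

definition flip :: "real \<times> real \<Rightarrow> 'c \<Rightarrow> real \<times> real" where
  "flip \<sigma> c = (if c \<in> A then (- fst \<sigma>, snd \<sigma>) else (fst \<sigma>, - snd \<sigma>))"

definition crossing :: "real \<times> real \<Rightarrow> 'c \<Rightarrow> real \<Rightarrow> (real \<times> real) \<times> (real \<times> real)" where
  "crossing \<sigma> c = (sheet \<sigma> \<circ> linepath z (m c)) +++ (sheet (flip \<sigma> c) \<circ> linepath (m c) z)"

primrec gallery :: "real \<times> real \<Rightarrow> 'c list \<Rightarrow> real \<Rightarrow> (real \<times> real) \<times> (real \<times> real)" where
  "gallery \<sigma> [] = linepath (sheet \<sigma> z) (sheet \<sigma> z)"
| "gallery \<sigma> (c # u) = crossing \<sigma> c +++ gallery (flip \<sigma> c) u"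

abbreviation "flips \<equiv> foldl flip"

lemma flip_signs: "\<sigma> \<in> signs \<Longrightarrow> flip \<sigma> c \<in> signs"
  by (auto simp: flip_def signs_def)

lemma flips_signs: "\<sigma> \<in> signs \<Longrightarrow> flips \<sigma> u \<in> signs"
  by (induction u arbitrary: \<sigma>) (simp_all add: flip_signs)

lemma flip_flip [simp]: "flip (flip \<sigma> c) c = \<sigma>"
  by (simp add: flip_def)

lemma sheet_flip: "c \<in> A \<union> B \<Longrightarrow> f c p = 0 \<Longrightarrow> sheet (flip \<sigma> c) p = sheet \<sigma> p"
  using height_zero[of c A p] height_zero[of c B p] by (auto simp: sheet_def flip_def)

lemma in_some_corner: assumes "c \<in> A \<union> B" shows "\<exists>(a, b)\<in>V. c = a \<or> c = b"
proof -
  have "0 \<le> f d (m c)" if "d \<in> A \<union> B" for d using side_mem_P[OF assms] that by (auto simp: P_def)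
  from cover[OF this] obtain a b where "(a, b) \<in> V" "\<forall>d\<in>A \<union> B - {a, b}. 0 < f d (m c)" by blast
  with side[OF assms] assms show ?thesis by (intro bexI[of _ "(a, b)"]) (auto, force+)
qed

lemma segment_pos:
  assumes "0 < f d p" "0 < f d q" "x \<in> closed_segment p q"
  shows "0 < f d x"
proof -
  obtain t where t: "0 \<le> t" "t \<le> 1" "x = (1 - t) *\<^sub>R p + t *\<^sub>R q"
    using assms(3) by (auto simp: in_segment)
  then show ?thesis using assms(1,2)
    by (cases "t = 0") (auto simp: affine intro!: add_nonneg_pos)
qed

lemma path_in_sheet_segment:
  assumes \<sigma>: "\<sigma> \<in> signs" and p: "p \<in> P" and q: "q \<in> P"
  shows "path_in S (sheet \<sigma> \<circ> linepath p q) (sheet \<sigma> p) (sheet \<sigma> q)"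
proof -
  have "path (sheet \<sigma> \<circ> linepath p q)"
    by (intro path_continuous_image continuous_intros) auto
  moreover have "closed_segment p q \<subseteq> P" using p q convex_P by (rule closed_segment_subset)
  then have "sheet \<sigma> ` closed_segment p q \<subseteq> S" using sheet_mem_S[OF \<sigma>] by blast
  ultimately show ?thesis
    by (simp add: path_in_def path_image_compose pathstart_compose pathfinish_compose)
qed

lemma path_in_star_segment:
  assumes \<sigma>: "\<sigma> \<in> signs" and p: "p \<in> P" and q: "q \<in> P"
    and pos: "\<And>d. d \<in> A \<union> B - {a, b} \<Longrightarrow> 0 < f d p \<and> 0 < f d q"
  shows "path_in (star a b) (sheet \<sigma> \<circ> linepath p q) (sheet \<sigma> p) (sheet \<sigma> q)"
proof -
  have "sheet \<sigma> x \<in> star a b" if "x \<in> closed_segment p q" for x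
  proof -
    have "x \<in> P" using closed_segment_subset[OF p q convex_P] that by blast
    then have "sheet \<sigma> x \<in> S" by (rule sheet_mem_S[OF \<sigma>])
    then show ?thesis using segment_pos[of _ p q x] pos that by (simp add: star_def)
  qed
  then have "path_image (sheet \<sigma> \<circ> linepath p q) \<subseteq> star a b" by (auto simp: path_image_compose)
  then show ?thesis using path_in_sheet_segment[OF \<sigma> p q] by (simp add: path_in_def)
qed

lemma path_in_crossing:
  assumes \<sigma>: "\<sigma> \<in> signs" and c: "c \<in> A \<union> B" "c = a \<or> c = b"
  shows "path_in (star a b) (crossing \<sigma> c) (sheet \<sigma> z) (sheet (flip \<sigma> c) z)"
proof -
  have pos: "0 < f d z \<and> 0 < f d (m c)" if "d \<in> A \<union> B - {a, b}" for d
    using that c centre side_pos[OF c(1), of d] by auto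
  have "path_in (star a b) (sheet \<sigma> \<circ> linepath z (m c)) (sheet \<sigma> z) (sheet \<sigma> (m c))"
    using pos centre_mem_P side_mem_P[OF c(1)] \<sigma> by (intro path_in_star_segment)
  moreover have "path_in (star a b) (sheet (flip \<sigma> c) \<circ> linepath (m c) z) (sheet (flip \<sigma> c) (m c)) (sheet (flip \<sigma> c) z)"
    using pos centre_mem_P side_mem_P[OF c(1)] flip_signs[OF \<sigma>] by (intro path_in_star_segment) auto
  moreover have "sheet (flip \<sigma> c) (m c) = sheet \<sigma> (m c)" by (rule sheet_flip[OF c(1) side[OF c(1)]])
  ultimately show ?thesis unfolding crossing_def by (metis path_in_join)
qed

lemma star_sub_S: "star a b \<subseteq> S"
  by (auto simp: star_def)

lemma path_in_crossing_S:
  assumes "\<sigma> \<in> signs" "c \<in> A \<union> B"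
  shows "path_in S (crossing \<sigma> c) (sheet \<sigma> z) (sheet (flip \<sigma> c) z)"
proof -
  obtain a b where "c = a \<or> c = b" by blast
  then show ?thesis using path_in_mono[OF path_in_crossing[OF assms] star_sub_S] by blast
qed

lemma centre_star: "\<sigma> \<in> signs \<Longrightarrow> sheet \<sigma> z \<in> star a b"
  using centre sheet_mem_S centre_mem_P by (auto simp: star_def)

lemma path_in_gallery:
  "\<sigma> \<in> signs \<Longrightarrow> u \<in> lists (A \<union> B) \<Longrightarrow> path_in S (gallery \<sigma> u) (sheet \<sigma> z) (sheet (flips \<sigma> u) z)"
proof (induction u arbitrary: \<sigma> rule: list.induct)
  case Nil
  have "sheet \<sigma> z \<in> S" using centre_star[OF Nil(1)] star_sub_S by blast
  then show ?case unfolding gallery.simps foldl.simps by (rule path_in_const)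
next
  case (Cons c u)
  then show ?case
    using path_in_join[OF path_in_crossing_S[of \<sigma> c] Cons.IH[OF flip_signs[of \<sigma> c]]] by auto
qed

lemma path_in_gallery_star:
  assumes "a \<in> A" "b \<in> B"
  shows "\<sigma> \<in> signs \<Longrightarrow> u \<in> lists {a, b} \<Longrightarrow> path_in (star a b) (gallery \<sigma> u) (sheet \<sigma> z) (sheet (flips \<sigma> u) z)"
proof (induction u arbitrary: \<sigma> rule: list.induct)
  case Nil
  show ?case unfolding gallery.simps foldl.simps using centre_star[OF Nil(1)] by (rule path_in_const)
next
  case (Cons c u)
  then show ?case using assms
    path_in_join[OF path_in_crossing[of \<sigma> c a b] Cons.IH[OF flip_signs[of \<sigma> c]]] by auto
qed

lemma star_homotopic:
  assumes "(a, b) \<in> V" "path_in (star a b) p x y" "path_in (star a b) q x y"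
  shows "homotopic_paths S p q"
proof -
  have "homotopic_paths (star a b) p q"
    using simply_connected_star[OF assms(1)] assms(2,3)
    unfolding simply_connected_eq_homotopic_paths path_in_def by metis
  then show ?thesis using star_sub_S homotopic_paths_subset by blast
qed

lemma gallery_append:
  assumes "u \<in> lists (A \<union> B)" "v \<in> lists (A \<union> B)"
  shows "\<sigma> \<in> signs \<Longrightarrow> homotopic_paths S (gallery \<sigma> (u @ v)) (gallery \<sigma> u +++ gallery (flips \<sigma> u) v)"
  using assms(1)
proof (induction u arbitrary: \<sigma> rule: list.induct)
  case Nil
  show ?case unfolding gallery.simps foldl.simps append_Nil
    by (rule homotopic_sym[OF homotopic_const_left[OF path_in_gallery[OF Nil(1) assms(2)]]])
next
  case (Cons c u)
  then have c: "c \<in> A \<union> B" and u: "u \<in> lists (A \<union> B)" by auto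
  note \<sigma> = flip_signs[OF Cons.prems(1), of c]
  have "homotopic_paths S (crossing \<sigma> c +++ gallery (flip \<sigma> c) (u @ v))
      (crossing \<sigma> c +++ (gallery (flip \<sigma> c) u +++ gallery (flips (flip \<sigma> c) u) v))"
    using Cons.IH[OF \<sigma> u] path_in_crossing_S[OF Cons.prems(1) c] path_in_gallery[OF \<sigma>, of "u @ v"] u assms(2)
    by (intro homotopic_join[OF homotopic_refl]) auto
  also have "homotopic_paths S \<dots> ((crossing \<sigma> c +++ gallery (flip \<sigma> c) u) +++ gallery (flips (flip \<sigma> c) u) v)"
    by (rule homotopic_assoc[OF path_in_crossing_S[OF Cons.prems(1) c] path_in_gallery[OF \<sigma> u]
          path_in_gallery[OF flips_signs[OF \<sigma>] assms(2)]])
  finally show ?case by simp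
qed

text \<open>Two galleries around a corner with the same ends run in the star of the corner, which
  is simply connected. Both kinds of defining relations are of this form.\<close>

lemma gallery_two_cong:
  assumes ab: "(a, b) \<in> V" and \<sigma>: "\<sigma> \<in> signs" and x: "x \<in> lists {a, b}" "y \<in> lists {a, b}"
    and eq: "flips \<sigma> x = flips \<sigma> y" and v: "v \<in> lists (A \<union> B)"
  shows "homotopic_paths S (gallery \<sigma> (x @ v)) (gallery \<sigma> (y @ v))"
proof -
  have l: "a \<in> A" "b \<in> B" using ab V_sub by auto
  then have xy: "x \<in> lists (A \<union> B)" "y \<in> lists (A \<union> B)" using x by auto
  have px: "path_in (star a b) (gallery \<sigma> x) (sheet \<sigma> z) (sheet (flips \<sigma> x) z)"
    "path_in (star a b) (gallery \<sigma> y) (sheet \<sigma> z) (sheet (flips \<sigma> x) z)"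
    using path_in_gallery_star[OF l \<sigma> x(1)] path_in_gallery_star[OF l \<sigma> x(2)] eq by simp_all
  have pv: "path_in S (gallery (flips \<sigma> x) v) (sheet (flips \<sigma> x) z) (sheet (flips (flips \<sigma> x) v) z)"
    by (rule path_in_gallery[OF flips_signs[OF \<sigma>] v])
  have "homotopic_paths S (gallery \<sigma> (x @ v)) (gallery \<sigma> x +++ gallery (flips \<sigma> x) v)"
    by (rule gallery_append[OF xy(1) v \<sigma>])
  also have "homotopic_paths S \<dots> (gallery \<sigma> y +++ gallery (flips \<sigma> x) v)"
    by (rule homotopic_join[OF star_homotopic[OF ab px] homotopic_refl[OF pv] px(1) pv])
  also have "homotopic_paths S \<dots> (gallery \<sigma> (y @ v))"
    using homotopic_sym[OF gallery_append[OF xy(2) v \<sigma>]] by (simp add: eq)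
  finally show ?thesis .
qed

lemma gallery_prefix_cong:
  assumes "u \<in> lists (A \<union> B)" "x \<in> lists (A \<union> B)"
    and "\<And>\<sigma>. \<sigma> \<in> signs \<Longrightarrow> homotopic_paths S (gallery \<sigma> x) (gallery \<sigma> y)"
  shows "\<sigma> \<in> signs \<Longrightarrow> homotopic_paths S (gallery \<sigma> (u @ x)) (gallery \<sigma> (u @ y))"
  using assms(1)
proof (induction u arbitrary: \<sigma> rule: list.induct)
  case (Cons c u)
  then have c: "c \<in> A \<union> B" "u @ x \<in> lists (A \<union> B)" "u \<in> lists (A \<union> B)" using assms(2) by auto
  show ?case
    using homotopic_join[OF homotopic_refl[OF path_in_crossing_S[OF Cons.prems(1) c(1)]]
        Cons.IH[OF flip_signs[OF Cons.prems(1)] c(3)] path_in_crossing_S[OF Cons.prems(1) c(1)]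
        path_in_gallery[OF flip_signs[OF Cons.prems(1)] c(2)]] by simp
qed (simp add: assms)

text \<open>Each relation concerns letters that are sides at one corner, where \<open>gallery_two_cong\<close>
  applies. A square \<open>c c\<close> is treated at any corner on side \<open>c\<close>.\<close>

theorem gallery_cong:
  assumes "mirror_equiv (A \<union> B) V u v" "\<sigma> \<in> signs"
  shows "homotopic_paths S (gallery \<sigma> u) (gallery \<sigma> v)"
  using assms(1,2)
proof (induction arbitrary: \<sigma> rule: mirror_equiv.induct)
  case (refl u)
  then show ?case using homotopic_refl[OF path_in_gallery] by blast
next
  case (sym u v)
  show ?case by (rule homotopic_sym) (rule sym.IH[OF sym.prems])
next
  case (trans u v w)
  show ?case by (rule homotopic_paths_trans) (rule trans.IH[OF trans.prems])+
next
  case (square u v c)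
  obtain a b where ab: "(a, b) \<in> V" "c = a \<or> c = b" using in_some_corner[OF square(3)] by auto
  then have c: "[c, c] \<in> lists {a, b}" by auto
  have "homotopic_paths S (gallery \<sigma> ([c, c] @ v)) (gallery \<sigma> ([] @ v))" if "\<sigma> \<in> signs" for \<sigma>
    by (rule gallery_two_cong[OF ab(1) that c _ _ square(2)]) simp_all
  then show ?case using square by (intro gallery_prefix_cong) auto
next
  case (swap u v a b)
  then have l: "a \<in> A" "b \<in> B" "b \<notin> A" using V_sub disjoint by auto
  have "homotopic_paths S (gallery \<sigma> ([a, b] @ v)) (gallery \<sigma> ([b, a] @ v))" if "\<sigma> \<in> signs" for \<sigma>
    using l by (intro gallery_two_cong[OF swap(3) that _ _ _ swap(2)]) (simp_all add: flip_def)
  then show ?case using swap l by (intro gallery_prefix_cong) auto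
qed

text \<open>Subdividing a path so finely that each piece stays within one star deforms it into a
  gallery.\<close>

lemma path_homotopic_gallery:
  assumes \<gamma>: "path \<gamma>" "path_image \<gamma> \<subseteq> S" and \<sigma>: "\<sigma> \<in> signs" and p: "p \<in> P" "pathstart \<gamma> = sheet \<sigma> p"
  shows "\<exists>u\<in>lists (A \<union> B). \<exists>q\<in>P. pathfinish \<gamma> = sheet (flips \<sigma> u) q \<and>
    homotopic_paths S ((sheet \<sigma> \<circ> linepath z p) +++ \<gamma>)
      (gallery \<sigma> u +++ (sheet (flips \<sigma> u) \<circ> linepath z q))"
proof -
  \<comment> \<open>The claim for the part of the path between two parameters; it is additive, so it only has to be
    checked for short parts.\<close>
  define Q where "Q s t \<longleftrightarrow> (0 \<le> s \<and> s \<le> t \<and> t \<le> 1 \<longrightarrow> (\<forall>\<sigma>\<in>signs. \<forall>p\<in>P. \<gamma> s = sheet \<sigma> p \<longrightarrow>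
    (\<exists>u\<in>lists (A \<union> B). \<exists>q\<in>P. \<gamma> t = sheet (flips \<sigma> u) q \<and>
      homotopic_paths S ((sheet \<sigma> \<circ> linepath z p) +++ subpath s t \<gamma>)
        (gallery \<sigma> u +++ (sheet (flips \<sigma> u) \<circ> linepath z q)))))" for s t
  have sub: "path_in S (subpath s t \<gamma>) (\<gamma> s) (\<gamma> t)" if "0 \<le> s" "s \<le> t" "t \<le> 1" for s t
    using \<gamma> that path_image_subpath_subset[of s t \<gamma>]
    by (auto simp: path_in_def intro: path_subpath)
  have seg: "path_in S (sheet \<sigma> \<circ> linepath z p) (sheet \<sigma> z) (sheet \<sigma> p)" if "\<sigma> \<in> signs" "p \<in> P" for \<sigma> p
    by (rule path_in_sheet_segment[OF that(1) centre_mem_P that(2)])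
  have "Q 0 1"
    using zero_le_one
  proof (induction rule: Bolzano)
    case (trans s t r)
    show ?case unfolding Q_def
    proof (intro impI ballI)
      fix \<sigma> p assume r: "0 \<le> s \<and> s \<le> r \<and> r \<le> 1" and \<sigma>: "\<sigma> \<in> signs" and p: "p \<in> P" "\<gamma> s = sheet \<sigma> p"
      have st: "0 \<le> s" "s \<le> t" "t \<le> r" "r \<le> 1" "t \<le> 1" "0 \<le> t" using trans r by auto
      with trans(1) \<sigma> p obtain u q where u: "u \<in> lists (A \<union> B)" "q \<in> P" "\<gamma> t = sheet (flips \<sigma> u) q"
        "homotopic_paths S ((sheet \<sigma> \<circ> linepath z p) +++ subpath s t \<gamma>)
          (gallery \<sigma> u +++ (sheet (flips \<sigma> u) \<circ> linepath z q))" unfolding Q_def by blast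
      note \<tau> = flips_signs[OF \<sigma>, of u]
      from trans(2) st u \<tau> obtain v q' where v: "v \<in> lists (A \<union> B)" "q' \<in> P" "\<gamma> r = sheet (flips (flips \<sigma> u) v) q'"
        "homotopic_paths S ((sheet (flips \<sigma> u) \<circ> linepath z q) +++ subpath t r \<gamma>)
          (gallery (flips \<sigma> u) v +++ (sheet (flips (flips \<sigma> u) v) \<circ> linepath z q'))" unfolding Q_def by blast
      let ?Z = "sheet \<sigma> \<circ> linepath z p" and ?Y = "sheet (flips \<sigma> u) \<circ> linepath z q"
        and ?X = "sheet (flips (flips \<sigma> u) v) \<circ> linepath z q'"
      have Z: "path_in S ?Z (sheet \<sigma> z) (\<gamma> s)" using seg[OF \<sigma> p(1)] p by simp
      have Y: "path_in S ?Y (sheet (flips \<sigma> u) z) (\<gamma> t)" using seg[OF \<tau> u(2)] u by simp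
      have X: "path_in S ?X (sheet (flips (flips \<sigma> u) v) z) (\<gamma> r)"
        using seg[OF flips_signs[OF \<tau>] v(2)] v by simp
      note gu = path_in_gallery[OF \<sigma> u(1)] and gv = path_in_gallery[OF \<tau> v(1)]
      note s1 = sub[OF st(1,2,5)] and s2 = sub[OF st(6,3,4)]
      have "homotopic_paths S (subpath s t \<gamma> +++ subpath t r \<gamma>) (subpath s r \<gamma>)"
        using \<gamma> st by (intro homotopic_join_subpaths1) auto
      then have "homotopic_paths S (?Z +++ subpath s r \<gamma>) (?Z +++ (subpath s t \<gamma> +++ subpath t r \<gamma>))"
        using homotopic_sym by (intro homotopic_join[OF homotopic_refl[OF Z] _ Z sub]) (use st in auto)
      also have "homotopic_paths S \<dots> ((?Z +++ subpath s t \<gamma>) +++ subpath t r \<gamma>)"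
        by (rule homotopic_assoc[OF Z s1 s2])
      also have "homotopic_paths S \<dots> ((gallery \<sigma> u +++ ?Y) +++ subpath t r \<gamma>)"
        by (rule homotopic_join[OF u(4) homotopic_refl[OF s2] path_in_join[OF Z s1] s2])
      also have "homotopic_paths S \<dots> (gallery \<sigma> u +++ (?Y +++ subpath t r \<gamma>))"
        by (rule homotopic_sym[OF homotopic_assoc[OF gu Y s2]])
      also have "homotopic_paths S \<dots> (gallery \<sigma> u +++ (gallery (flips \<sigma> u) v +++ ?X))"
        by (rule homotopic_join[OF homotopic_refl[OF gu] v(4) gu path_in_join[OF Y s2]])
      also have "homotopic_paths S \<dots> ((gallery \<sigma> u +++ gallery (flips \<sigma> u) v) +++ ?X)"
        by (rule homotopic_assoc[OF gu gv X])
      also have "homotopic_paths S \<dots> (gallery \<sigma> (u @ v) +++ ?X)"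
        by (rule homotopic_join[OF homotopic_sym[OF gallery_append[OF u(1) v(1) \<sigma>]] homotopic_refl[OF X] path_in_join[OF gu gv] X])
      finally show "\<exists>u\<in>lists (A \<union> B). \<exists>q\<in>P. \<gamma> r = sheet (flips \<sigma> u) q \<and>
          homotopic_paths S (?Z +++ subpath s r \<gamma>) (gallery \<sigma> u +++ (sheet (flips \<sigma> u) \<circ> linepath z q))"
        using u v by (intro bexI[of _ "u @ v"] bexI[of _ q']) auto
    qed
  next
    case (local x)
    then have x: "x \<in> {0..1}" by simp
    then have "\<gamma> x \<in> S" using \<gamma>(2) by (auto simp: path_image_def)
    then obtain a b where ab: "(a, b) \<in> V" "\<gamma> x \<in> star a b" using S_covered by blast
    then have l: "a \<in> A" "b \<in> B" using V_sub by auto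
    have "openin (top_of_set {0..1}) ({0..1} \<inter> \<gamma> -` star a b)"
      using \<gamma> openin_star by (intro continuous_openin_preimage[of _ _ S]) (auto simp: path_def path_image_def)
    then obtain d where d: "0 < d" "\<And>y. y \<in> {0..1} \<Longrightarrow> dist y x < d \<Longrightarrow> \<gamma> y \<in> star a b"
      unfolding openin_euclidean_subtopology_iff using x ab(2) by (metis IntD2 IntI vimage_eq)
    have "Q s t" if "s \<le> x" "x \<le> t" "t - s < d" for s t
      unfolding Q_def
    proof (intro impI ballI)
      fix \<sigma> p assume st: "0 \<le> s \<and> s \<le> t \<and> t \<le> 1" and \<sigma>: "\<sigma> \<in> signs" and p: "p \<in> P" "\<gamma> s = sheet \<sigma> p"
      have in_star: "\<gamma> y \<in> star a b" if "y \<in> {s..t}" for y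
        using that st \<open>s \<le> x\<close> \<open>x \<le> t\<close> \<open>t - s < d\<close> by (intro d(2)) (auto simp: dist_real_def)
      then have "\<gamma> t \<in> S" using st star_sub_S by auto
      then obtain \<tau> q where q: "\<tau> \<in> signs" "q \<in> P" "\<gamma> t = sheet \<tau> q" by (auto simp: S_eq_sheets)
      \<comment> \<open>Any two tiles at a corner are joined by crossing each of the two sides at most once.\<close>
      define u where "u = (if fst \<tau> = fst \<sigma> then [] else [a]) @ (if snd \<tau> = snd \<sigma> then [] else [b])"
      have u: "u \<in> lists {a, b}" "flips \<sigma> u = \<tau>"
        using \<sigma> q(1) l disjoint by (auto simp: u_def signs_def flip_def)
      have "path_in (star a b) (subpath s t \<gamma>) (sheet \<sigma> p) (sheet \<tau> q)"
        using sub[of s t] st p q in_star by (auto simp: path_in_def path_image_subpath)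
      moreover have "path_in (star a b) (sheet \<sigma> \<circ> linepath z p) (sheet \<sigma> z) (sheet \<sigma> p)"
        using in_star[of s] st p centre by (intro path_in_star_segment \<sigma> centre_mem_P) (auto simp: star_def)
      moreover have "path_in (star a b) (sheet \<tau> \<circ> linepath z q) (sheet \<tau> z) (sheet \<tau> q)"
        using in_star[of t] st q centre by (intro path_in_star_segment q centre_mem_P) (auto simp: star_def)
      moreover have "path_in (star a b) (gallery \<sigma> u) (sheet \<sigma> z) (sheet \<tau> z)"
        using path_in_gallery_star[OF l \<sigma> u(1)] u(2) by simp
      ultimately have "homotopic_paths S ((sheet \<sigma> \<circ> linepath z p) +++ subpath s t \<gamma>)
          (gallery \<sigma> u +++ (sheet (flips \<sigma> u) \<circ> linepath z q))"
        unfolding u(2) using star_homotopic[OF ab(1)] path_in_join by blast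
      moreover have "u \<in> lists (A \<union> B)" using u(1) l by auto
      ultimately show "\<exists>u\<in>lists (A \<union> B). \<exists>q\<in>P. \<gamma> t = sheet (flips \<sigma> u) q \<and>
          homotopic_paths S ((sheet \<sigma> \<circ> linepath z p) +++ subpath s t \<gamma>)
            (gallery \<sigma> u +++ (sheet (flips \<sigma> u) \<circ> linepath z q))"
        using q u(2) by blast
    qed
    then show ?case using d(1) by blast
  qed
  then show ?thesis using \<sigma> p unfolding Q_def pathstart_def pathfinish_def by (simp add: subpath_trivial)
qed

lemma sheet_centre_inj: "sheet \<sigma> z = sheet \<tau> q \<Longrightarrow> \<sigma> = \<tau> \<and> q = z"
proof -
  assume eq: "sheet \<sigma> z = sheet \<tau> q"
  have "0 < height A z" "0 < height B z" using centre by (auto intro!: height_pos)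
  moreover have q: "q = z" using arg_cong[OF eq, of fst] by simp
  ultimately show ?thesis using eq unfolding q by (simp add: sheet_def prod_eq_iff)
qed

theorem loop_homotopic_gallery:
  assumes "path_in S \<gamma> (sheet \<sigma> z) (sheet \<sigma> z)" and \<sigma>: "\<sigma> \<in> signs"
  shows "\<exists>u\<in>lists (A \<union> B). flips \<sigma> u = \<sigma> \<and> homotopic_paths S \<gamma> (gallery \<sigma> u)"
proof -
  obtain u q where u: "u \<in> lists (A \<union> B)" "q \<in> P" "sheet \<sigma> z = sheet (flips \<sigma> u) q"
    "homotopic_paths S ((sheet \<sigma> \<circ> linepath z z) +++ \<gamma>) (gallery \<sigma> u +++ (sheet (flips \<sigma> u) \<circ> linepath z q))"
    using path_homotopic_gallery[of \<gamma> \<sigma> z] assms centre_mem_P by (auto simp: path_in_def)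
  from sheet_centre_inj[OF u(3)] have eq: "flips \<sigma> u = \<sigma>" "q = z" by auto
  have "homotopic_paths S \<gamma> ((sheet \<sigma> \<circ> linepath z z) +++ \<gamma>)"
    unfolding linepath_same_comp by (rule homotopic_sym[OF homotopic_const_left[OF assms(1)]])
  also have "homotopic_paths S \<dots> (gallery \<sigma> u +++ linepath (sheet \<sigma> z) (sheet \<sigma> z))"
    using u(4) unfolding eq linepath_same_comp .
  also have "homotopic_paths S \<dots> (gallery \<sigma> u)"
    using homotopic_const_right[OF path_in_gallery[OF \<sigma> u(1)]] by (simp add: eq)
  finally show ?thesis using u(1) eq by blast
qed

end


section \<open>Fundamental groups\<close>

lemma carrier_fundamental_group:
  "carrier (fundamental_group X x) = {{q. homotopic_paths X p q} | p. path_in X p x x}"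
  by (auto simp: fundamental_group_def quotient_def loops_at_def path_in_def)

lemma mult_fundamental_group:
  assumes p: "path_in X p x x" and q: "path_in X q x x"
  shows "{r. homotopic_paths X p r} \<otimes>\<^bsub>fundamental_group X x\<^esub> {r. homotopic_paths X q r}
    = {r. homotopic_paths X (p +++ q) r}"
proof -
  have "{r. homotopic_paths X (p' +++ q') r} = {r. homotopic_paths X (p +++ q) r}"
    if "homotopic_paths X p p'" "homotopic_paths X q q'" for p' q'
    using homotopic_join[OF that p q] homotopic_sym homotopic_paths_trans by blast
  moreover have "p \<in> {r. homotopic_paths X p r}" "q \<in> {r. homotopic_paths X q r}"
    using homotopic_refl[OF p] homotopic_refl[OF q] by auto
  ultimately have "(\<Union>p'\<in>{r. homotopic_paths X p r}. \<Union>q'\<in>{r. homotopic_paths X q r}.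
      {r. homotopic_paths X (p' +++ q') r}) = {r. homotopic_paths X (p +++ q) r}" by blast
  then show ?thesis by (simp add: fundamental_group_def)
qed

section \<open>The fundamental group of the tiled surface\<close>

context polygon_group
begin

definition gallery_elt :: "'c list \<Rightarrow> 'g" where
  "gallery_elt u = foldr (\<lambda>c x. g c \<otimes> x) u \<one>"

lemma gallery_elt_simps [simp]:
  "gallery_elt [] = \<one>" "gallery_elt (c # u) = g c \<otimes> gallery_elt u"
  by (simp_all add: gallery_elt_def)

lemma gallery_elt_closed: "u \<in> lists (A \<union> B) \<Longrightarrow> gallery_elt u \<in> carrier G"
  by (induction u rule: list.induct) (auto simp: g_closed)

lemma gallery_elt_append:
  "u \<in> lists (A \<union> B) \<Longrightarrow> v \<in> lists (A \<union> B) \<Longrightarrow> gallery_elt (u @ v) = gallery_elt u \<otimes> gallery_elt v"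
  by (induction u rule: list.induct) (auto simp: g_closed gallery_elt_closed m_assoc)

lemma sgn_mult: "w \<in> carrier G \<Longrightarrow> c \<in> A \<union> B \<Longrightarrow> sgn (w \<otimes> g c) = flip (sgn w) c"
  using sgn_A sgn_B by (auto simp: flip_def)

primrec lifted_gallery :: "'g \<Rightarrow> 'c list \<Rightarrow> real \<Rightarrow> ((real \<times> real) \<times> (real \<times> real)) \<times> (nat \<Rightarrow>\<^sub>C real)" where
  "lifted_gallery w [] = linepath (tile w z) (tile w z)"
| "lifted_gallery w (c # u) =
     ((tile w \<circ> linepath z (m c)) +++ (tile (w \<otimes> g c) \<circ> linepath (m c) z)) +++ lifted_gallery (w \<otimes> g c) u"

lemma path_in_tile_segment:
  assumes "w \<in> carrier G" "p \<in> P" "q \<in> P"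
  shows "path_in tiling (tile w \<circ> linepath p q) (tile w p) (tile w q)"
proof -
  have "path (tile w \<circ> linepath p q)"
    by (intro path_continuous_image continuous_intros) auto
  moreover have "closed_segment p q \<subseteq> P" using assms(2,3) convex_P by (rule closed_segment_subset)
  then have "tile w ` closed_segment p q \<subseteq> tiling" using tile_mem_tiling[OF assms(1)] by blast
  ultimately show ?thesis
    by (simp add: path_in_def path_image_compose pathstart_compose pathfinish_compose)
qed

lemma path_in_lifted_gallery:
  "w \<in> carrier G \<Longrightarrow> u \<in> lists (A \<union> B) \<Longrightarrow>
    path_in tiling (lifted_gallery w u) (tile w z) (tile (w \<otimes> gallery_elt u) z)"
proof (induction u arbitrary: w rule: list.induct)
  case Nil
  then show ?case using tile_mem_tiling[OF Nil(1) centre_mem_P]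
    unfolding lifted_gallery.simps gallery_elt_simps r_one[OF Nil(1)] by (intro path_in_const)
next
  case (Cons c u)
  then have c: "c \<in> A \<union> B" and u: "u \<in> lists (A \<union> B)" by auto
  have wc: "w \<otimes> g c \<in> carrier G" using Cons.prems(1) g_closed[OF c] by simp
  have "path_in tiling (tile w \<circ> linepath z (m c)) (tile w z) (tile w (m c))"
    by (rule path_in_tile_segment[OF Cons.prems(1) centre_mem_P side_mem_P[OF c]])
  moreover have "path_in tiling (tile (w \<otimes> g c) \<circ> linepath (m c) z) (tile w (m c)) (tile (w \<otimes> g c) z)"
    using path_in_tile_segment[OF wc side_mem_P[OF c] centre_mem_P]
    by (simp add: tile_side[OF Cons.prems(1) c side[OF c]])
  moreover have "path_in tiling (lifted_gallery (w \<otimes> g c) u) (tile (w \<otimes> g c) z) (tile (w \<otimes> gallery_elt (c # u)) z)"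
    using Cons.IH[OF wc u] Cons.prems(1) g_closed[OF c] gallery_elt_closed[OF u] by (simp add: m_assoc)
  ultimately show ?case unfolding lifted_gallery.simps by (intro path_in_join)
qed

lemma fst_lifted_gallery:
  "w \<in> carrier G \<Longrightarrow> u \<in> lists (A \<union> B) \<Longrightarrow> fst \<circ> lifted_gallery w u = gallery (sgn w) u"
proof (induction u arbitrary: w rule: list.induct)
  case Nil
  show ?case by (simp add: fun_eq_iff linepath_refl)
next
  case (Cons c u)
  then have c: "c \<in> A \<union> B" and u: "u \<in> lists (A \<union> B)" by auto
  have wc: "w \<otimes> g c \<in> carrier G" using Cons.prems(1) g_closed[OF c] by simp
  have "fst \<circ> (tile x \<circ> l) = sheet (sgn x) \<circ> l" for x and l :: "real \<Rightarrow> real \<times> real"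
    by (simp add: fun_eq_iff)
  with Cons.IH[OF wc u] show ?case
    by (simp only: path_compose_join crossing_def sgn_mult[OF Cons.prems(1) c]
        lifted_gallery.simps gallery.simps)
qed

text \<open>The gallery of \<open>u\<close> lifts to a path in the covering space that ends in the tile of the
  element that \<open>u\<close> represents. Lifts of homotopic paths with the same start have the same
  end.\<close>

theorem gallery_homotopic_imp_eq:
  assumes u: "u \<in> lists (A \<union> B)" and v: "v \<in> lists (A \<union> B)"
    and hom: "homotopic_paths S (gallery (1, 1) u) (gallery (1, 1) v)"
  shows "gallery_elt u = gallery_elt v"
proof -
  have l: "path_in tiling (lifted_gallery \<one> u) (tile \<one> z) (tile (\<one> \<otimes> gallery_elt u) z)"
    "path_in tiling (lifted_gallery \<one> v) (tile \<one> z) (tile (\<one> \<otimes> gallery_elt v) z)"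
    using path_in_lifted_gallery[OF one_closed] u v by auto
  have f: "fst (lifted_gallery \<one> u t) = gallery (1, 1) u t" "fst (lifted_gallery \<one> v t) = gallery (1, 1) v t" for t
    using fst_lifted_gallery[OF one_closed u] fst_lifted_gallery[OF one_closed v]
    by (simp_all add: fun_eq_iff sgn_one)
  have o: "(1, 1) \<in> signs" by (simp add: signs_def)
  have "pathfinish (lifted_gallery \<one> u) = pathfinish (lifted_gallery \<one> v)"
    using l path_in_gallery[OF o u] path_in_gallery[OF o v]
    by (intro covering_space_monodromy[OF covering_space_tiling _ _ _ _ hom])
      (simp_all add: path_in_def f)
  then have "tile (gallery_elt u) z = tile (gallery_elt v) z"
    using l u v by (simp add: path_in_def gallery_elt_closed)
  then show ?thesis using tile_centre_inj gallery_elt_closed u v by blast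
qed

end

text \<open>The elements \<open>g c\<close> generate a Coxeter group with no relations beyond those that are
  visible at the corners. The generated subgroup may be smaller than \<open>G\<close>, which allows \<open>G\<close>
  to be the Coxeter group of a larger graph.\<close>

locale polygon_presentation = polygon_group A B V f z m G g sgn
  for A B :: "'c set" and V f z m and G (structure) and g :: "'c \<Rightarrow> 'g" and sgn +
  assumes presentation: "u \<in> lists (A \<union> B) \<Longrightarrow> v \<in> lists (A \<union> B) \<Longrightarrow> gallery_elt u = gallery_elt v
    \<Longrightarrow> mirror_equiv (A \<union> B) V u v"
begin

abbreviation "base \<equiv> sheet (1, 1) z"

text \<open>The words whose galleries return to the tile where they started. Their elements form
  the kernel of the map that records the parities of the numbers of letters from \<open>A\<close> and
  from \<open>B\<close>.\<close>

definition closed_galleries where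
  "closed_galleries = {u \<in> lists (A \<union> B). flips (1, 1) u = (1, 1)}"

definition gallery_class :: "'c list \<Rightarrow> (real \<Rightarrow> (real \<times> real) \<times> (real \<times> real)) set" where
  "gallery_class u = {q. homotopic_paths S (gallery (1, 1) u) q}"

definition elt_class :: "'g \<Rightarrow> (real \<Rightarrow> (real \<times> real) \<times> (real \<times> real)) set" where
  "elt_class w = gallery_class (SOME u. u \<in> closed_galleries \<and> gallery_elt u = w)"

lemma one_signs: "(1, 1) \<in> signs" by (simp add: signs_def)

lemma gallery_class_cong:
  assumes "u \<in> closed_galleries" "v \<in> closed_galleries" "gallery_elt u = gallery_elt v"
  shows "gallery_class u = gallery_class v"
proof -
  have "homotopic_paths S (gallery (1, 1) u) (gallery (1, 1) v)"
    using assms presentation one_signs by (intro gallery_cong) (auto simp: closed_galleries_def)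
  then show ?thesis unfolding gallery_class_def
    using homotopic_sym homotopic_paths_trans by blast
qed

lemma elt_class_eq:
  assumes "u \<in> closed_galleries" shows "elt_class (gallery_elt u) = gallery_class u"
proof -
  let ?v = "SOME v. v \<in> closed_galleries \<and> gallery_elt v = gallery_elt u"
  have "?v \<in> closed_galleries \<and> gallery_elt ?v = gallery_elt u"
    by (rule someI_ex) (use assms in blast)
  then show ?thesis unfolding elt_class_def using assms by (intro gallery_class_cong) auto
qed

lemma path_in_closed_gallery: "u \<in> closed_galleries \<Longrightarrow> path_in S (gallery (1, 1) u) base base"
  using path_in_gallery[OF one_signs, of u] by (auto simp: closed_galleries_def)

lemma closed_galleries_append:
  "u \<in> closed_galleries \<Longrightarrow> v \<in> closed_galleries \<Longrightarrow> u @ v \<in> closed_galleries"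
  by (auto simp: closed_galleries_def)

text \<open>A closed gallery represents a loop. It is well defined on group elements by
  \<open>gallery_cong\<close>, injective by \<open>gallery_homotopic_imp_eq\<close>, and surjective by
  \<open>loop_homotopic_gallery\<close>.\<close>

theorem fundamental_group_iso:
  "elt_class \<in> iso (G\<lparr>carrier := gallery_elt ` closed_galleries\<rparr>) (fundamental_group S base)"
proof (rule isoI)
  show "elt_class \<in> hom (G\<lparr>carrier := gallery_elt ` closed_galleries\<rparr>) (fundamental_group S base)"
  proof (rule homI)
    fix x assume "x \<in> carrier (G\<lparr>carrier := gallery_elt ` closed_galleries\<rparr>)"
    then obtain u where u: "u \<in> closed_galleries" "x = gallery_elt u" by auto
    then show "elt_class x \<in> carrier (fundamental_group S base)"
      using path_in_closed_gallery[OF u(1)] by (auto simp: elt_class_eq gallery_class_def carrier_fundamental_group)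
  next
    fix x y assume "x \<in> carrier (G\<lparr>carrier := gallery_elt ` closed_galleries\<rparr>)"
      "y \<in> carrier (G\<lparr>carrier := gallery_elt ` closed_galleries\<rparr>)"
    then obtain u v where uv: "u \<in> closed_galleries" "x = gallery_elt u" "v \<in> closed_galleries" "y = gallery_elt v"
      by auto
    then have l: "u \<in> lists (A \<union> B)" "v \<in> lists (A \<union> B)" "flips (1, 1) u = (1, 1)"
      by (simp_all add: closed_galleries_def)
    have "x \<otimes> y = gallery_elt (u @ v)" using l by (simp add: uv gallery_elt_append)
    then have "elt_class (x \<otimes> y) = gallery_class (u @ v)"
      using elt_class_eq[OF closed_galleries_append[OF uv(1,3)]] by simp
    moreover have "homotopic_paths S (gallery (1, 1) (u @ v)) (gallery (1, 1) u +++ gallery (1, 1) v)"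
      using gallery_append[OF l(1,2) one_signs] l(3) by simp
    then have "gallery_class (u @ v) = {r. homotopic_paths S (gallery (1, 1) u +++ gallery (1, 1) v) r}"
      unfolding gallery_class_def using homotopic_sym homotopic_paths_trans by blast
    moreover have "\<dots> = elt_class x \<otimes>\<^bsub>fundamental_group S base\<^esub> elt_class y"
      using mult_fundamental_group[OF path_in_closed_gallery[OF uv(1)] path_in_closed_gallery[OF uv(3)]] uv
      by (simp add: elt_class_eq gallery_class_def)
    ultimately show "elt_class (x \<otimes>\<^bsub>G\<lparr>carrier := gallery_elt ` closed_galleries\<rparr>\<^esub> y) =
        elt_class x \<otimes>\<^bsub>fundamental_group S base\<^esub> elt_class y" by simp
  qed
  show "bij_betw elt_class (carrier (G\<lparr>carrier := gallery_elt ` closed_galleries\<rparr>)) (carrier (fundamental_group S base))"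
    unfolding bij_betw_def
  proof
    show "inj_on elt_class (carrier (G\<lparr>carrier := gallery_elt ` closed_galleries\<rparr>))"
    proof (rule inj_onI)
      fix x y assume "x \<in> carrier (G\<lparr>carrier := gallery_elt ` closed_galleries\<rparr>)"
        "y \<in> carrier (G\<lparr>carrier := gallery_elt ` closed_galleries\<rparr>)" and eq: "elt_class x = elt_class y"
      then obtain u v where uv: "u \<in> closed_galleries" "x = gallery_elt u" "v \<in> closed_galleries" "y = gallery_elt v"
        by auto
      have "gallery (1, 1) v \<in> gallery_class u"
        using eq uv homotopic_refl[OF path_in_closed_gallery[OF uv(3)]] by (simp add: elt_class_eq gallery_class_def)
      then show "x = y" using gallery_homotopic_imp_eq[of u v] uv
        by (simp add: gallery_class_def closed_galleries_def)
    qed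
    show "elt_class ` carrier (G\<lparr>carrier := gallery_elt ` closed_galleries\<rparr>) = carrier (fundamental_group S base)"
    proof (intro equalityI subsetI)
      fix X assume "X \<in> elt_class ` carrier (G\<lparr>carrier := gallery_elt ` closed_galleries\<rparr>)"
      then obtain u where u: "u \<in> closed_galleries" "X = elt_class (gallery_elt u)" by auto
      then show "X \<in> carrier (fundamental_group S base)"
        using path_in_closed_gallery[OF u(1)] by (auto simp: elt_class_eq gallery_class_def carrier_fundamental_group)
    next
      fix X assume "X \<in> carrier (fundamental_group S base)"
      then obtain p where p: "path_in S p base base" "X = {q. homotopic_paths S p q}"
        by (auto simp: carrier_fundamental_group)
      from loop_homotopic_gallery[OF p(1) one_signs] obtain u where
        u: "u \<in> closed_galleries" "homotopic_paths S p (gallery (1, 1) u)" by (auto simp: closed_galleries_def)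
      then have "X = gallery_class u" unfolding p(2) gallery_class_def
        using homotopic_sym homotopic_paths_trans by blast
      then show "X \<in> elt_class ` carrier (G\<lparr>carrier := gallery_elt ` closed_galleries\<rparr>)"
        using u(1) elt_class_eq by auto
    qed
  qed
qed

end

section \<open>Transport to the space of bounded sequences\<close>

lemma closed_surface_homeomorphic:
  assumes "closed_surface X" "X homeomorphic Y"
  shows "closed_surface Y"
proof -
  from assms(2) obtain h k where hom: "homeomorphism X Y h k" unfolding homeomorphic_def by blast
  then have Y: "Y = h ` X" "continuous_on X h" by (auto simp: homeomorphism_def)
  show ?thesis unfolding closed_surface_def
  proof (intro conjI ballI)
    show "Y \<noteq> {}" "compact Y" "Topological_Spaces.connected Y"
      using assms(1) unfolding Y(1) closed_surface_def
      by (auto intro: compact_continuous_image connected_continuous_image Y(2))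
    fix y assume "y \<in> Y"
    then have "k y \<in> X" "h (k y) = y" using hom by (auto simp: homeomorphism_def)
    with assms(1) obtain U where U: "openin (top_of_set X) U" "k y \<in> U" "U homeomorphic (UNIV :: (real^2) set)"
      unfolding closed_surface_def by blast
    then have "U \<subseteq> X" using openin_imp_subset by blast
    then have "homeomorphism U (h ` U) h k"
      using hom by (intro homeomorphism_of_subsets[OF hom]) (auto simp: homeomorphism_def)
    then have "h ` U homeomorphic U" by (metis homeomorphic_def homeomorphism_symD)
    then have "h ` U homeomorphic (UNIV :: (real^2) set)" using U(3) by (rule homeomorphic_trans)
    moreover have "openin (top_of_set Y) (h ` U)" by (rule homeomorphism_imp_open_map[OF hom U(1)])
    moreover have "y \<in> h ` U" using U(2) \<open>h (k y) = y\<close> by force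
    ultimately show "\<exists>U. openin (top_of_set Y) U \<and> y \<in> U \<and> U homeomorphic (UNIV :: (real^2) set)" by blast
  qed
qed

lemma fundamental_group_homeomorphic:
  fixes X :: "'x::t2_space set" and Y :: "'y::t2_space set"
  assumes hom: "homeomorphism X Y h k" and x: "x \<in> X"
  shows "fundamental_group X x \<cong> fundamental_group Y (h x)"
proof -
  have conts: "continuous_on X h" "continuous_on Y k" "\<And>a. a \<in> X \<Longrightarrow> h a \<in> Y" "\<And>a. a \<in> Y \<Longrightarrow> k a \<in> X"
    "\<And>a. a \<in> X \<Longrightarrow> k (h a) = a" "\<And>a. a \<in> Y \<Longrightarrow> h (k a) = a"
    using hom by (auto simp: homeomorphism_def)
  have hhom: "homotopic_paths Y (h \<circ> p) (h \<circ> q)" if "homotopic_paths X p q" for p q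
    using that conts by (intro homotopic_paths_continuous_image) auto
  have khom: "homotopic_paths X (k \<circ> p) (k \<circ> q)" if "homotopic_paths Y p q" for p q
    using that conts by (intro homotopic_paths_continuous_image) auto
  have hin: "path_in Y (h \<circ> p) (h a) (h b)" if "path_in X p a b" for p a b
    using that conts unfolding path_in_def
    by (auto simp: path_image_compose pathstart_compose pathfinish_compose
        intro!: path_continuous_image intro: continuous_on_subset)
  have kin: "path_in X (k \<circ> p) (k a) (k b)" if "path_in Y p a b" for p a b
    using that conts unfolding path_in_def
    by (auto simp: path_image_compose pathstart_compose pathfinish_compose
        intro!: path_continuous_image intro: continuous_on_subset)
  have kh: "homotopic_paths X (k \<circ> (h \<circ> p)) p" if "path_in X p a b" for p a b
  proof (rule homotopic_paths_eq)
    show "path (k \<circ> (h \<circ> p))" using kin[OF hin[OF that]] by (simp add: path_in_def)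
    show "path_image (k \<circ> (h \<circ> p)) \<subseteq> X" using kin[OF hin[OF that]] by (simp add: path_in_def)
    show "(k \<circ> (h \<circ> p)) t = p t" if "t \<in> {0..1}" for t
      using \<open>path_in X p a b\<close> that conts(5)[of "p t"] by (auto simp: path_in_def path_image_def image_subset_iff)
  qed
  have hk: "homotopic_paths Y (h \<circ> (k \<circ> p)) p" if "path_in Y p a b" for p a b
  proof (rule homotopic_paths_eq)
    show "path (h \<circ> (k \<circ> p))" using hin[OF kin[OF that]] by (simp add: path_in_def)
    show "path_image (h \<circ> (k \<circ> p)) \<subseteq> Y" using hin[OF kin[OF that]] by (simp add: path_in_def)
    show "(h \<circ> (k \<circ> p)) t = p t" if "t \<in> {0..1}" for t
      using \<open>path_in Y p a b\<close> that conts(6)[of "p t"] by (auto simp: path_in_def path_image_def image_subset_iff)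
  qed
  define \<Phi> where "\<Phi> C = (\<Union>p\<in>C. {q. homotopic_paths Y (h \<circ> p) q})" for C
  have \<Phi>: "\<Phi> {q. homotopic_paths X p q} = {q. homotopic_paths Y (h \<circ> p) q}" if "path_in X p x x" for p
  proof -
    have "{q. homotopic_paths Y (h \<circ> p') q} = {q. homotopic_paths Y (h \<circ> p) q}" if "homotopic_paths X p p'" for p'
      using hhom[OF that] homotopic_sym homotopic_paths_trans by blast
    then show ?thesis unfolding \<Phi>_def using homotopic_refl[OF that] by blast
  qed
  have "\<Phi> \<in> iso (fundamental_group X x) (fundamental_group Y (h x))"
  proof (rule isoI)
    show "\<Phi> \<in> hom (fundamental_group X x) (fundamental_group Y (h x))"
    proof (rule homI)
      fix C assume "C \<in> carrier (fundamental_group X x)"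
      then show "\<Phi> C \<in> carrier (fundamental_group Y (h x))" using \<Phi> hin by (auto simp: carrier_fundamental_group)
    next
      fix C D assume "C \<in> carrier (fundamental_group X x)" "D \<in> carrier (fundamental_group X x)"
      then obtain p q where pq: "path_in X p x x" "path_in X q x x" "C = {r. homotopic_paths X p r}"
        "D = {r. homotopic_paths X q r}" by (auto simp: carrier_fundamental_group)
      then show "\<Phi> (C \<otimes>\<^bsub>fundamental_group X x\<^esub> D) = \<Phi> C \<otimes>\<^bsub>fundamental_group Y (h x)\<^esub> \<Phi> D"
        using hin by (simp add: mult_fundamental_group \<Phi> path_in_join[of X p x x q x] path_compose_join)
    qed
    show "bij_betw \<Phi> (carrier (fundamental_group X x)) (carrier (fundamental_group Y (h x)))"
      unfolding bij_betw_def
    proof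
      show "inj_on \<Phi> (carrier (fundamental_group X x))"
      proof (rule inj_onI)
        fix C D assume "C \<in> carrier (fundamental_group X x)" "D \<in> carrier (fundamental_group X x)" and eq: "\<Phi> C = \<Phi> D"
        then obtain p q where pq: "path_in X p x x" "path_in X q x x" "C = {r. homotopic_paths X p r}"
          "D = {r. homotopic_paths X q r}" by (auto simp: carrier_fundamental_group)
        then have "homotopic_paths Y (h \<circ> p) (h \<circ> q)" using eq \<Phi> homotopic_refl[OF hin[OF pq(2)]] by auto
        then have "homotopic_paths X p q"
          using khom kh[OF pq(1)] kh[OF pq(2)] homotopic_sym homotopic_paths_trans by metis
        then show "C = D" unfolding pq using homotopic_sym homotopic_paths_trans by blast
      qed
      show "\<Phi> ` carrier (fundamental_group X x) = carrier (fundamental_group Y (h x))"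
      proof (intro equalityI subsetI)
        fix D assume "D \<in> \<Phi> ` carrier (fundamental_group X x)"
        then show "D \<in> carrier (fundamental_group Y (h x))" using \<Phi> hin by (auto simp: carrier_fundamental_group)
      next
        fix D assume "D \<in> carrier (fundamental_group Y (h x))"
        then obtain p where p: "path_in Y p (h x) (h x)" "D = {q. homotopic_paths Y p q}" by (auto simp: carrier_fundamental_group)
        have kp: "path_in X (k \<circ> p) x x" using kin[OF p(1)] conts(5)[OF x] by simp
        have "D = \<Phi> {q. homotopic_paths X (k \<circ> p) q}" unfolding \<Phi>[OF kp] p(2)
          using hk[OF p(1)] homotopic_sym homotopic_paths_trans by blast
        then show "D \<in> \<Phi> ` carrier (fundamental_group X x)" using kp by (auto simp: carrier_fundamental_group)
      qed
    qed
  qed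
  then show ?thesis by (auto simp: is_iso_def)
qed

text \<open>The surface is constructed in \<open>\<real>\<^sup>4\<close>, whereas closed surface subgroups are defined by
  surfaces in the space of bounded sequences. The four coordinates become the first four
  entries of a sequence.\<close>

definition to_seq :: "(real \<times> real) \<times> (real \<times> real) \<Rightarrow> (nat \<Rightarrow>\<^sub>C real)" where
  "to_seq s = fst (fst s) *\<^sub>R unit_seq 0 + snd (fst s) *\<^sub>R unit_seq 1
     + fst (snd s) *\<^sub>R unit_seq 2 + snd (snd s) *\<^sub>R unit_seq 3"

lemma to_seq_homeomorphism:
  assumes "compact X"
  shows "\<exists>k. homeomorphism X (to_seq ` X) to_seq k"
proof -
  have "apply_bcontfun (to_seq s) 0 = fst (fst s)" "apply_bcontfun (to_seq s) 1 = snd (fst s)"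
    "apply_bcontfun (to_seq s) 2 = fst (snd s)" "apply_bcontfun (to_seq s) 3 = snd (snd s)" for s
    by (simp_all add: to_seq_def apply_unit_seq)
  then have "inj to_seq" by (intro injI prod_eqI) metis+
  moreover have "continuous_on X to_seq" unfolding to_seq_def by (intro continuous_intros)
  ultimately show ?thesis using homeomorphism_compact[OF assms] by (meson inj_on_subset subset_UNIV)
qed

theorem (in polygon_presentation) closed_surface_group:
  assumes "infinite (gallery_elt ` closed_galleries)"
  shows "\<exists>(X :: (nat \<Rightarrow>\<^sub>C real) set) x. closed_surface X \<and> x \<in> X \<and> infinite (carrier (fundamental_group X x)) \<and>
    G\<lparr>carrier := gallery_elt ` closed_galleries\<rparr> \<cong> fundamental_group X x"
proof -
  obtain k where k: "homeomorphism S (to_seq ` S) to_seq k" using to_seq_homeomorphism[OF compact_S] by blast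
  have base: "base \<in> S" using sheet_mem_S[OF one_signs centre_mem_P] .
  have "G\<lparr>carrier := gallery_elt ` closed_galleries\<rparr> \<cong> fundamental_group S base"
    using fundamental_group_iso by (auto simp: is_iso_def)
  then have iso: "G\<lparr>carrier := gallery_elt ` closed_galleries\<rparr> \<cong> fundamental_group (to_seq ` S) (to_seq base)"
    using fundamental_group_homeomorphic[OF k base] by (rule iso_trans)
  then obtain \<phi> where "bij_betw \<phi> (gallery_elt ` closed_galleries) (carrier (fundamental_group (to_seq ` S) (to_seq base)))"
    by (auto simp: is_iso_def iso_def)
  then have "infinite (carrier (fundamental_group (to_seq ` S) (to_seq base)))"
    using assms bij_betw_finite by blast
  moreover have "closed_surface (to_seq ` S)"
    using closed_surface_homeomorphic[OF closed_surface_S] k unfolding homeomorphic_def by blast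
  ultimately show ?thesis using iso base by blast
qed


section \<open>A polygon with prescribed sides\<close>

text \<open>The sides are the tangents to the parabola \<open>y = x\<^sup>2\<close> at \<open>n - 1\<close> points, whose
  abscissas are one apart and symmetric around 0, and the horizontal line through the first
  and the last of these points. The tangents at abscissas \<open>k\<close> and \<open>l\<close> meet in the point
  \<open>((k + l) / 2, k l)\<close>, which lies below the tangents at all abscissas strictly between \<open>k\<close>
  and \<open>l\<close> and above those at the remaining ones. Therefore two tangents meet in a corner of
  the polygon only if they are consecutive.\<close>

definition max_abscissa :: "nat \<Rightarrow> real" where
  "max_abscissa n = (real n - 2) / 2"

definition abscissa :: "nat \<Rightarrow> nat \<Rightarrow> real" where
  "abscissa n i = real i - max_abscissa n"

definition polygon_side :: "nat \<Rightarrow> nat \<Rightarrow> real \<times> real \<Rightarrow> real" where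
  "polygon_side n i p = (if i = n - 1 then (max_abscissa n)\<^sup>2 - snd p
     else snd p - 2 * abscissa n i * fst p + (abscissa n i)\<^sup>2)"

definition cyclic_adj :: "nat \<Rightarrow> nat \<Rightarrow> nat \<Rightarrow> bool" where
  "cyclic_adj n i j \<longleftrightarrow> j = Suc i \<or> i = Suc j \<or> (i = 0 \<and> j = n - 1) \<or> (j = 0 \<and> i = n - 1)"

context
  fixes n :: nat
  assumes n: "4 \<le> n"
begin

private abbreviation "K \<equiv> max_abscissa n"

lemma K_ge_1: "1 \<le> K"
  using n by (simp add: max_abscissa_def)

lemma abscissa_0: "abscissa n 0 = - K"
  by (simp add: abscissa_def)

lemma abscissa_last: "abscissa n (n - 2) = K"
  using n by (simp add: abscissa_def max_abscissa_def of_nat_diff field_simps)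

lemma last_not_top: "n - 2 \<noteq> n - Suc 0"
  using n by linarith

lemma abscissa_bounds:
  assumes "i < n - 1" shows "- K \<le> abscissa n i" "abscissa n i \<le> K"
proof -
  show "- K \<le> abscissa n i" by (simp add: abscissa_def)
  have "real i \<le> real (n - 2)" using assms by simp
  then show "abscissa n i \<le> K" by (subst abscissa_last[symmetric]) (simp add: abscissa_def)
qed

lemma abscissa_diff: "abscissa n j - abscissa n i = real j - real i"
  by (simp add: abscissa_def)

lemma abscissa_eq_iff: "abscissa n i = abscissa n j \<longleftrightarrow> i = j"
  by (simp add: abscissa_def)

lemma abscissa_inner:
  assumes "i < n - 1" "i \<noteq> 0" "i \<noteq> n - 2" shows "- K < abscissa n i" "abscissa n i < K"
proof -
  have "abscissa n i \<noteq> abscissa n 0" "abscissa n i \<noteq> abscissa n (n - 2)" using assms by (simp_all add: abscissa_eq_iff)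
  with abscissa_bounds[OF assms(1)] show "- K < abscissa n i" "abscissa n i < K" by (auto simp: abscissa_0 abscissa_last)
qed

lemma polygon_side_affine:
  "polygon_side n i ((1 - t) *\<^sub>R p + t *\<^sub>R q) = (1 - t) * polygon_side n i p + t * polygon_side n i q"
  by (auto simp: polygon_side_def algebra_simps)

lemma continuous_on_polygon_side: "continuous_on X (polygon_side n i)"
proof -
  have "polygon_side n i = (if i = n - 1 then (\<lambda>p. K\<^sup>2 - snd p)
      else (\<lambda>p. snd p - 2 * abscissa n i * fst p + (abscissa n i)\<^sup>2))"
    by (auto simp: polygon_side_def fun_eq_iff)
  then show ?thesis by (auto intro!: continuous_intros)
qed

lemma bounded_polygon: "bounded {p. \<forall>i<n. 0 \<le> polygon_side n i p}"
proof (rule bounded_subset)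
  show "bounded ({-K..K} \<times> {-(K\<^sup>2)..K\<^sup>2})" by (intro bounded_Times) auto
  show "{p. \<forall>i<n. 0 \<le> polygon_side n i p} \<subseteq> {-K..K} \<times> {-(K\<^sup>2)..K\<^sup>2}"
  proof
    fix p assume p: "p \<in> {p. \<forall>i<n. 0 \<le> polygon_side n i p}"
    then have "0 \<le> polygon_side n (n - 1) p" "0 \<le> polygon_side n 0 p" "0 \<le> polygon_side n (n - 2) p"
      using n by auto
    then have *: "snd p \<le> K * K" "0 \<le> snd p + 2 * (K * fst p) + K * K" "0 \<le> snd p - 2 * (K * fst p) + K * K"
      using n last_not_top by (simp_all add: polygon_side_def abscissa_0 abscissa_last power2_eq_square)
    then have "K * fst p \<le> K * K" "- (K * fst p) \<le> K * K" by linarith+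
    then have "fst p \<le> K" "- fst p \<le> K"
      using K_ge_1 mult_le_cancel_left_pos[of K "fst p" K] mult_le_cancel_left_pos[of K "- fst p" K]
      by simp_all
    moreover have "- (K * K) \<le> snd p" using *(2,3) by linarith
    ultimately show "p \<in> {-K..K} \<times> {-(K\<^sup>2)..K\<^sup>2}" using *(1)
      by (cases p) (auto simp: power2_eq_square)
  qed
qed

lemma tangent_zeros:
  assumes "i < j" "j < n - 1" "polygon_side n i p = 0" "polygon_side n j p = 0"
    and pos: "\<And>l. l < n \<Longrightarrow> 0 \<le> polygon_side n l p"
  shows "j = Suc i"
proof (rule ccontr)
  assume "j \<noteq> Suc i"
  then have ij: "Suc i < j" using assms(1) by simp
  let ?k = "abscissa n i" and ?l = "abscissa n j"
  have l: "?l \<ge> ?k + 2" "abscissa n (Suc i) = ?k + 1" using ij by (simp_all add: abscissa_def)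
  have eqs: "snd p = 2 * ?k * fst p - ?k\<^sup>2" "snd p = 2 * ?l * fst p - ?l\<^sup>2"
    using assms by (simp_all add: polygon_side_def)
  then have "(?l - ?k) * (2 * fst p - (?k + ?l)) = 0" by (simp add: algebra_simps power2_eq_square)
  then have x: "2 * fst p = ?k + ?l" using l by auto
  have "0 \<le> polygon_side n (Suc i) p" using pos[of "Suc i"] ij assms(2) by simp
  then have "0 \<le> snd p - (?k + 1) * (2 * fst p) + (?k + 1)\<^sup>2"
    using ij assms(2) by (simp add: polygon_side_def l algebra_simps)
  moreover have "snd p = ?k * (2 * fst p) - ?k\<^sup>2" using eqs(1) by simp
  ultimately have "0 \<le> ?k - ?l + 1" unfolding x by (simp add: algebra_simps power2_eq_square)
  with l show False by simp
qed

text \<open>A tangent at an inner abscissa meets the horizontal line outside the strip \<open>\<bar>x\<bar> \<le> K\<close>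
  to which the first and the last tangent confine the top side, because
  \<open>K\<^sup>2 + k\<^sup>2 > 2 K \<bar>k\<bar>\<close>.\<close>

lemma top_zeros:
  assumes "i < n - 1" "polygon_side n i p = 0" "polygon_side n (n - 1) p = 0"
    and pos: "\<And>l. l < n \<Longrightarrow> 0 \<le> polygon_side n l p"
  shows "i = 0 \<or> i = n - 2"
proof (rule ccontr)
  assume "\<not> (i = 0 \<or> i = n - 2)"
  then have k: "- K < abscissa n i" "abscissa n i < K" using abscissa_inner[OF assms(1)] by auto
  let ?k = "abscissa n i"
  have y: "snd p = K\<^sup>2" "2 * ?k * fst p = K\<^sup>2 + ?k\<^sup>2" using assms by (auto simp: polygon_side_def)
  have "0 \<le> snd p + 2 * (K * fst p) + K * K" "0 \<le> snd p - 2 * (K * fst p) + K * K"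
    using pos[of 0] pos[of "n - 2"] n last_not_top
    by (simp_all add: polygon_side_def abscissa_0 abscissa_last power2_eq_square)
  then have "K * fst p \<le> K * K" "- (K * fst p) \<le> K * K"
    using y(1) unfolding power2_eq_square by linarith+
  then have x: "fst p \<le> K" "- K \<le> fst p"
    using K_ge_1 mult_le_cancel_left_pos[of K "fst p" K] mult_le_cancel_left_pos[of K "- fst p" K]
    by simp_all
  have "K\<^sup>2 + ?k\<^sup>2 > 2 * K * \<bar>?k\<bar>"
    using k zero_less_power2[of "K - \<bar>?k\<bar>"] by (auto simp: power2_diff)
  moreover have "2 * ?k * fst p \<le> 2 * K * \<bar>?k\<bar>"
  proof -
    have "?k * fst p \<le> \<bar>?k\<bar> * \<bar>fst p\<bar>" by (metis abs_ge_self abs_mult)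
    also have "\<dots> \<le> \<bar>?k\<bar> * K" using x by (intro mult_left_mono) auto
    finally show ?thesis by (simp add: mult.commute)
  qed
  ultimately show False using y(2) by linarith
qed

lemma zeros_adjacent:
  assumes "i < n" "j < n" "i \<noteq> j" "polygon_side n i p = 0" "polygon_side n j p = 0"
    and pos: "\<And>l. l < n \<Longrightarrow> 0 \<le> polygon_side n l p"
  shows "cyclic_adj n i j"
proof -
  have *: "cyclic_adj n i j" if "i < j" "j < n" "polygon_side n i p = 0" "polygon_side n j p = 0" for i j
  proof (cases "j = n - 1")
    case True
    then show ?thesis using top_zeros[of i p] that pos by (auto simp: cyclic_adj_def)
  next
    case False
    then show ?thesis using tangent_zeros[of i j p] that pos by (auto simp: cyclic_adj_def)
  qed
  show ?thesis using *[of i j] *[of j i] assms(1-5) by (cases "i < j") (auto simp: cyclic_adj_def)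
qed

lemma polygon_coordinates:
  assumes "i < n" "j < n" "cyclic_adj n i j"
  shows "\<exists>L. continuous_on UNIV L \<and> (\<forall>x y. polygon_side n i (L (x, y)) = x \<and> polygon_side n j (L (x, y)) = y) \<and>
    (\<forall>p. L (polygon_side n i p, polygon_side n j p) = p)"
proof -
  define al where "al i = (if i = n - 1 then 0 else - 2 * abscissa n i)" for i
  define be :: "nat \<Rightarrow> real" where "be i = (if i = n - 1 then -1 else 1)" for i
  define ga where "ga i = (if i = n - 1 then K\<^sup>2 else (abscissa n i)\<^sup>2)" for i
  have side: "polygon_side n i p = al i * fst p + be i * snd p + ga i" for i p
    by (simp add: polygon_side_def al_def be_def ga_def)
  \<comment> \<open>The determinant of the linear system whose solution is the inverse map.\<close>
  define d where "d = al i * be j - al j * be i"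
  have "abscissa n i \<noteq> abscissa n j" using assms n by (auto simp: abscissa_eq_iff cyclic_adj_def)
  have top: "abscissa n l \<noteq> 0 \<and> l \<noteq> n - 1" if "cyclic_adj n l (n - 1) \<or> cyclic_adj n (n - 1) l" "l < n" for l
  proof -
    have "l = 0 \<or> l = n - 2" using that n unfolding cyclic_adj_def by linarith
    then show ?thesis using K_ge_1 abscissa_0 abscissa_last n by auto
  qed
  have d: "d \<noteq> 0"
  proof (cases "i = n - 1 \<or> j = n - 1")
    case True
    then show ?thesis using top[of i] top[of j] assms by (auto simp: d_def al_def be_def)
  next
    case False
    then show ?thesis using \<open>abscissa n i \<noteq> abscissa n j\<close> by (simp add: d_def al_def be_def)
  qed
  define L where "L q = ((be j * (fst q - ga i) - be i * (snd q - ga j)) / d,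
      (al i * (snd q - ga j) - al j * (fst q - ga i)) / d)" for q
  have "continuous_on UNIV L" unfolding L_def using d by (intro continuous_intros) auto
  moreover have "polygon_side n i (L (x, y)) = x" "polygon_side n j (L (x, y)) = y" for x y
  proof -
    have "al i * (be j * (x - ga i) - be i * (y - ga j)) + be i * (al i * (y - ga j) - al j * (x - ga i)) = d * (x - ga i)"
      "al j * (be j * (x - ga i) - be i * (y - ga j)) + be j * (al i * (y - ga j) - al j * (x - ga i)) = d * (y - ga j)"
      unfolding d_def by (simp_all add: algebra_simps)
    then show "polygon_side n i (L (x, y)) = x" "polygon_side n j (L (x, y)) = y"
      using d by (simp_all add: side L_def add_divide_distrib[symmetric])
  qed
  moreover have "L (polygon_side n i p, polygon_side n j p) = p" for p
  proof -
    have "be j * (al i * fst p + be i * snd p) - be i * (al j * fst p + be j * snd p) = d * fst p"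
      "al i * (al j * fst p + be j * snd p) - al j * (al i * fst p + be i * snd p) = d * snd p"
      unfolding d_def by (simp_all add: algebra_simps)
    then show ?thesis using d by (simp add: L_def side prod_eq_iff)
  qed
  ultimately show ?thesis by blast
qed

lemma polygon_corner:
  assumes "i < n" "j < n" "cyclic_adj n i j"
  shows "\<exists>v. polygon_side n i v = 0 \<and> polygon_side n j v = 0 \<and> (\<forall>l<n. l \<noteq> i \<longrightarrow> l \<noteq> j \<longrightarrow> 0 < polygon_side n l v)"
proof -
  have tangents: "\<exists>v. polygon_side n i v = 0 \<and> polygon_side n (Suc i) v = 0 \<and>
      (\<forall>l<n. l \<noteq> i \<longrightarrow> l \<noteq> Suc i \<longrightarrow> 0 < polygon_side n l v)" if "Suc i < n - 1" for i
  proof (intro exI conjI allI impI)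
    let ?k = "abscissa n i" and ?v = "(abscissa n i + 1 / 2, abscissa n i * (abscissa n i + 1))"
    have k1: "abscissa n (Suc i) = ?k + 1" by (simp add: abscissa_def)
    show "polygon_side n i ?v = 0" "polygon_side n (Suc i) ?v = 0"
      using that by (simp_all add: polygon_side_def k1 field_simps power2_eq_square)
    fix l assume l: "l < n" "l \<noteq> i" "l \<noteq> Suc i"
    show "0 < polygon_side n l ?v"
    proof (cases "l = n - 1")
      case True
      have "0 \<le> (K + ?k) * (K - ?k - 1)" using abscissa_bounds[of i] abscissa_bounds[of "Suc i"] that
        by (intro mult_nonneg_nonneg) (simp_all add: k1)
      then show ?thesis using True K_ge_1 by (simp add: polygon_side_def algebra_simps power2_eq_square)
    next
      case False
      have "polygon_side n l ?v = (abscissa n l - ?k) * (abscissa n l - ?k - 1)"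
        using False by (simp add: polygon_side_def field_simps power2_eq_square)
      also have "\<dots> = (real l - real i) * (real l - real i - 1)" by (simp only: abscissa_diff)
      also have "\<dots> > 0"
      proof (cases "l < i")
        case True then show ?thesis by (intro mult_neg_neg) auto
      next
        case False then show ?thesis using l by (intro mult_pos_pos) auto
      qed
      finally show ?thesis .
    qed
  qed
  have top: "\<exists>v. polygon_side n i v = 0 \<and> polygon_side n (n - 1) v = 0 \<and>
      (\<forall>l<n. l \<noteq> i \<longrightarrow> l \<noteq> n - 1 \<longrightarrow> 0 < polygon_side n l v)" if "i = 0 \<or> i = n - 2" for i
  proof (intro exI conjI allI impI)
    let ?k = "abscissa n i" and ?v = "(abscissa n i, (abscissa n i)\<^sup>2)"
    have k: "?k\<^sup>2 = K\<^sup>2" using that by (auto simp: abscissa_0 abscissa_last)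
    show "polygon_side n i ?v = 0" "polygon_side n (n - 1) ?v = 0"
      using that n k by (auto simp: polygon_side_def power2_eq_square)
    fix l assume l: "l < n" "l \<noteq> i" "l \<noteq> n - 1"
    have "polygon_side n l ?v = (abscissa n l - ?k)\<^sup>2"
      using l by (simp add: polygon_side_def power2_eq_square algebra_simps)
    then show "0 < polygon_side n l ?v" using l by (simp add: abscissa_eq_iff)
  qed
  consider "j = Suc i" "j < n - 1" | "i = Suc j" "i < n - 1" | "j = n - 1" "i = 0 \<or> i = n - 2"
    | "i = n - 1" "j = 0 \<or> j = n - 2"
    using assms n unfolding cyclic_adj_def by linarith
  then show ?thesis
  proof cases
    case 1 then show ?thesis using tangents[of i] by blast
  next
    case 2 then show ?thesis using tangents[of j] by blast
  next
    case 3 then show ?thesis using top[of i] by blast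
  next
    case 4 then show ?thesis using top[of j] by blast
  qed
qed

lemma polygon_centre: "i < n \<Longrightarrow> 0 < polygon_side n i (0, K\<^sup>2 / 2)"
  using K_ge_1 by (auto simp: polygon_side_def add_pos_nonneg)

text \<open>On a tangent the point of contact would almost do, but at the first and the last
  abscissa it is a corner. So it is moved towards the middle by \<open>q\<close>, which depends on the
  abscissa linearly and is at most 1/4, less than the distance 1/2 to the neighbouring
  corner.\<close>

lemma polygon_side_point:
  assumes "i < n"
  shows "\<exists>m. polygon_side n i m = 0 \<and> (\<forall>l<n. l \<noteq> i \<longrightarrow> 0 < polygon_side n l m)"
proof (cases "i = n - 1")
  case True
  then show ?thesis using K_ge_1
    by (intro exI[of _ "(0, K\<^sup>2)"]) (auto simp: polygon_side_def add_pos_nonneg)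
next
  case False
  let ?k = "abscissa n i"
  define q where "q = ?k / (4 * K)"
  define x where "x = ?k - q"
  have i: "i < n - 1" using assms False by simp
  have xk: "\<bar>q\<bar> \<le> 1 / 4" using abscissa_bounds[OF i] K_ge_1 by (auto simp: q_def field_simps abs_le_iff)
  show ?thesis
  proof (intro exI[of _ "(x, 2 * ?k * x - ?k\<^sup>2)"] conjI allI impI)
    show "polygon_side n i (x, 2 * ?k * x - ?k\<^sup>2) = 0" using False by (simp add: polygon_side_def)
    fix l assume l: "l < n" "l \<noteq> i"
    show "0 < polygon_side n l (x, 2 * ?k * x - ?k\<^sup>2)"
    proof (cases "l = n - 1")
      case True
      have "?k\<^sup>2 \<le> K\<^sup>2" using abscissa_bounds[OF i] K_ge_1 by (intro power2_le_iff_abs_le[THEN iffD2]) auto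
      moreover have "2 * ?k * x = 2 * ?k\<^sup>2 - ?k\<^sup>2 / (2 * K)" using K_ge_1
        by (simp add: x_def q_def field_simps power2_eq_square)
      moreover have "0 < K\<^sup>2 - ?k\<^sup>2 + ?k\<^sup>2 / (2 * K)"
      proof (cases "?k = 0")
        case False
        then have "0 < ?k\<^sup>2 / (2 * K)" using K_ge_1 by simp
        with \<open>?k\<^sup>2 \<le> K\<^sup>2\<close> show ?thesis by linarith
      qed (use K_ge_1 in simp)
      ultimately show ?thesis using True by (simp add: polygon_side_def)
    next
      case False
      have "polygon_side n l (x, 2 * ?k * x - ?k\<^sup>2) = (abscissa n l - ?k) * (abscissa n l - ?k + 2 * q)"
        using False unfolding x_def by (simp add: polygon_side_def algebra_simps power2_eq_square)
      also have "\<dots> = (real l - real i) * (real l - real i + 2 * q)" by (simp only: abscissa_diff)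
      also have "\<dots> > 0"
      proof (cases "l < i")
        case True
        then have "real l - real i \<le> -1" by linarith
        with xk show ?thesis by (intro mult_neg_neg) linarith+
      next
        case False
        then have "1 \<le> real l - real i" using l by linarith
        with xk show ?thesis by (intro mult_pos_pos) linarith+
      qed
      finally show ?thesis .
    qed
  qed
qed

text \<open>The sides are numbered along the cycle. Adjacent sides have different colours, so two
  sides that meet form a pair in \<open>V\<close>, and the sides of one colour are disjoint.\<close>

lemma mirrored_polygon_exists:
  fixes A B :: "'c set"
  assumes e: "distinct e" "length e = n" "set e = A \<union> B" and AB: "A \<inter> B = {}"
    and V: "V = {(a, b). a \<in> A \<and> b \<in> B \<and> (\<exists>i<n. \<exists>j<n. a = e ! i \<and> b = e ! j \<and> cyclic_adj n i j)}"
    and colour: "\<And>i j. i < n \<Longrightarrow> j < n \<Longrightarrow> cyclic_adj n i j \<Longrightarrow> e ! i \<in> A \<longleftrightarrow> e ! j \<in> B"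
  shows "\<exists>f z m. mirrored_polygon A B V f z m"
proof -
  define ix where "ix c = (THE i. i < n \<and> e ! i = c)" for c
  have ix: "ix (e ! i) = i" if "i < n" for i
    unfolding ix_def using e that by (intro the_equality) (auto simp: nth_eq_iff_index_eq)
  have ix_lt: "ix c < n" "e ! ix c = c" if "c \<in> A \<union> B" for c
    using that e(2,3) ix by (metis in_set_conv_nth)+
  have all: "(\<forall>c\<in>A \<union> B. Q (ix c)) \<longleftrightarrow> (\<forall>i<n. Q i)" for Q
    using ix ix_lt e(2,3) by (metis nth_mem)
  have V_iff: "(a, b) \<in> V \<longleftrightarrow> a \<in> A \<and> b \<in> B \<and> cyclic_adj n (ix a) (ix b)" for a b
    unfolding V using ix ix_lt by (auto; metis UnI1 UnI2)
  define f where "f c = polygon_side n (ix c)" for c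
  define m where "m c = (SOME m. polygon_side n (ix c) m = 0 \<and> (\<forall>l<n. l \<noteq> ix c \<longrightarrow> 0 < polygon_side n l m))" for c
  have m: "polygon_side n (ix c) (m c) = 0 \<and> (\<forall>l<n. l \<noteq> ix c \<longrightarrow> 0 < polygon_side n l (m c))" if "c \<in> A \<union> B" for c
    unfolding m_def by (rule someI_ex) (rule polygon_side_point[OF ix_lt(1)[OF that]])
  have ix_inj: "ix c = ix d \<longleftrightarrow> c = d" if "c \<in> A \<union> B" "d \<in> A \<union> B" for c d
    using ix_lt that by metis
  have neighbour: "\<exists>j<n. cyclic_adj n i j" if "i < n" for i
    using that n by (cases "i = 0") (auto simp: cyclic_adj_def intro: exI[of _ "i - 1"] exI[of _ 1])
  have nbA: "\<exists>b. (a, b) \<in> V" if a: "a \<in> A" for a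
  proof -
    obtain j where j: "j < n" "cyclic_adj n (ix a) j" using neighbour ix_lt(1) a by blast
    then have "e ! j \<in> B" using colour[of "ix a" j] ix_lt a by auto
    then show ?thesis using j ix V_iff a by auto
  qed
  have adj_sym: "cyclic_adj n i j \<Longrightarrow> cyclic_adj n j i" for i j by (auto simp: cyclic_adj_def)
  have nbB: "\<exists>a. (a, b) \<in> V" if b: "b \<in> B" for b
  proof -
    obtain j where j: "j < n" "cyclic_adj n (ix b) j" using neighbour ix_lt(1) b by blast
    then have "e ! j \<in> A" using colour[OF j(1) ix_lt(1) adj_sym[OF j(2)]] ix_lt b by auto
    then show ?thesis using j ix V_iff b adj_sym by auto
  qed
  have "mirrored_polygon A B V f (0, K\<^sup>2 / 2) m"
  proof
    show "finite A" "finite B" using e(3) by (metis List.finite_set finite_Un)+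
    show "A \<inter> B = {}" by (rule AB)
    show "V \<subseteq> A \<times> B" using V by auto
    show "f c ((1 - t) *\<^sub>R p + t *\<^sub>R q) = (1 - t) * f c p + t * f c q" for c t p q
      unfolding f_def by (rule polygon_side_affine)
    show "continuous_on X (f c)" for X c unfolding f_def by (rule continuous_on_polygon_side)
    have "{p. \<forall>c\<in>A \<union> B. 0 \<le> f c p} = {p. \<forall>i<n. 0 \<le> polygon_side n i p}"
      unfolding f_def by (intro Collect_cong all)
    then show "bounded {p. \<forall>c\<in>A \<union> B. 0 \<le> f c p}" using bounded_polygon by simp
    show "\<exists>(a, b)\<in>V. \<forall>c\<in>A \<union> B - {a, b}. 0 < f c p" if pos: "\<And>c. c \<in> A \<union> B \<Longrightarrow> 0 \<le> f c p" for p
    proof -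
      have pos': "0 \<le> polygon_side n l p" if "l < n" for l
        using pos all[of "\<lambda>i. 0 \<le> polygon_side n i p"] that unfolding f_def by blast
      have adj: "cyclic_adj n (ix c) (ix d)" if "c \<in> A \<union> B" "d \<in> A \<union> B" "c \<noteq> d" "f c p = 0" "f d p = 0" for c d
        using that ix_lt ix_inj pos' unfolding f_def by (intro zeros_adjacent[of _ _ p]) auto
      have oneA: "a = a'" if "a \<in> A" "a' \<in> A" "f a p = 0" "f a' p = 0" for a a'
        using adj[of a a'] colour[of "ix a" "ix a'"] ix_lt that AB by (metis IntI UnI1 empty_iff)
      have oneB: "b = b'" if "b \<in> B" "b' \<in> B" "f b p = 0" "f b' p = 0" for b b'
        using adj[of b b'] colour[of "ix b" "ix b'"] ix_lt that AB by (metis IntI UnI2 empty_iff)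
      \<comment> \<open>If fewer than two functions vanish at \<open>p\<close>, any corner on the side that contains \<open>p\<close>, or
        any corner at all, will do.\<close>
      have "\<exists>a b. (a, b) \<in> V \<and> (\<forall>c\<in>A \<union> B. f c p = 0 \<longrightarrow> c = a \<or> c = b)"
      proof (cases "\<exists>a\<in>A. f a p = 0")
        case True
        then obtain a where a: "a \<in> A" "f a p = 0" by blast
        show ?thesis
        proof (cases "\<exists>b\<in>B. f b p = 0")
          case True
          then obtain b where b: "b \<in> B" "f b p = 0" by blast
          then have "a \<noteq> b" using a AB by blast
          then have "(a, b) \<in> V" using adj[of a b] a b V_iff by auto
          then show ?thesis using a b oneA oneB by blast
        next
          case False
          then show ?thesis using a nbA[OF a(1)] oneA by blast
        qed
      next
        case noA: False
        show ?thesis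
        proof (cases "\<exists>b\<in>B. f b p = 0")
          case True
          then show ?thesis using noA nbB oneB by blast
        next
          case False
          have "e ! 0 \<in> A \<or> e ! 0 \<in> B" using e n by (metis UnE gr0I nth_mem not_numeral_le_zero)
          then obtain a b where "(a, b) \<in> V" using nbA nbB by blast
          then show ?thesis using noA False by blast
        qed
      qed
      then obtain a b where ab: "(a, b) \<in> V" "\<And>c. c \<in> A \<union> B \<Longrightarrow> f c p = 0 \<Longrightarrow> c = a \<or> c = b" by blast
      have "0 < f c p" if "c \<in> A \<union> B - {a, b}" for c
        using pos[of c] ab(2)[of c] that by force
      with ab(1) show ?thesis by blast
    qed
    show "\<exists>L. continuous_on UNIV L \<and> (\<forall>x y. f a (L (x, y)) = x \<and> f b (L (x, y)) = y) \<and> (\<forall>p. L (f a p, f b p) = p)"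
      if "(a, b) \<in> V" for a b
      unfolding f_def using that V_iff ix_lt by (intro polygon_coordinates) auto
    show "\<exists>v. f a v = 0 \<and> f b v = 0 \<and> (\<forall>c\<in>A \<union> B - {a, b}. 0 < f c v)" if ab: "(a, b) \<in> V" for a b
    proof -
      have l: "a \<in> A \<union> B" "b \<in> A \<union> B" using ab V_iff by auto
      from polygon_corner[of "ix a" "ix b"] obtain v where "polygon_side n (ix a) v = 0" "polygon_side n (ix b) v = 0"
        "\<forall>l<n. l \<noteq> ix a \<longrightarrow> l \<noteq> ix b \<longrightarrow> 0 < polygon_side n l v" using ab V_iff ix_lt l by blast
      then show ?thesis unfolding f_def using ix_lt ix_inj l by (intro exI[of _ v]) auto
    qed
    show "0 < f c (0, K\<^sup>2 / 2)" if "c \<in> A \<union> B" for c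
      unfolding f_def by (rule polygon_centre[OF ix_lt(1)[OF that]])
    show "f c (m c) = 0" if "c \<in> A \<union> B" for c using m[OF that] by (simp add: f_def)
    show "0 < f d (m c)" if "c \<in> A \<union> B" "d \<in> A \<union> B" "d \<noteq> c" for c d
      using m[OF that(1)] ix_lt(1)[OF that(2)] ix_inj[OF that(2,1)] that(3) by (simp add: f_def)
  qed
  then show ?thesis by blast
qed

end


section \<open>The surface subgroup\<close>

lemma cycle_enumeration:
  assumes "cycle_graph G" "tail G = fst" "head G = snd"
  shows "\<exists>e. distinct e \<and> 3 \<le> length e \<and> set e = verts G \<and>
    (\<forall>x y. (x, y) \<in> arcs G \<longleftrightarrow>
      (\<exists>i<length e. \<exists>j<length e. x = e ! i \<and> y = e ! j \<and> cyclic_adj (length e) i j))"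
proof -
  from assms(1) obtain p where p: "pre_digraph.cycle G p" "3 \<le> length p" "verts G = tail G ` set p"
    "arcs G = set p \<union> (set p)\<inverse>" unfolding cycle_graph_def by blast
  then obtain u where u: "pre_digraph.cas G u p u" "distinct (tl (pre_digraph.awalk_verts G u p))"
    unfolding pre_digraph.cycle_def pre_digraph.awalk_def by blast
  define n where "n = length p"
  define e where "e = map fst p"
  have n: "3 \<le> n" "length e = n" "p \<noteq> []" using p(2) by (auto simp: n_def e_def)
  have ends: "q \<noteq> [] \<Longrightarrow> fst (q ! 0) = v \<and> snd (last q) = w" if "pre_digraph.cas G v q w" for v q w
    using that by (induction q arbitrary: v) (auto simp: pre_digraph.cas.simps assms)
  have cas: "Suc i < length q \<Longrightarrow> snd (q ! i) = fst (q ! Suc i)" if "pre_digraph.cas G v q w" for v q w i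
    using that
  proof (induction q arbitrary: v i)
    case (Cons f q)
    then have q: "pre_digraph.cas G (snd f) q w" by (simp add: pre_digraph.cas.simps assms)
    show ?case
    proof (cases i)
      case 0
      then show ?thesis using ends[OF q] Cons.prems(1) by auto
    next
      case (Suc j)
      then show ?thesis using Cons.IH[where i = j] q Cons.prems(1) by simp
    qed
  qed simp
  have aw: "pre_digraph.awalk_verts G v q = v # map snd q" if "pre_digraph.cas G v q w" for v q w
    using that by (induction q arbitrary: v) (auto simp: pre_digraph.awalk_verts.simps pre_digraph.cas.simps assms)
  have dist: "distinct (map snd p)" using u(2) aw[OF u(1)] by simp
  have last: "snd (p ! (n - 1)) = fst (p ! 0)"
    using ends[OF u(1)] n(3) by (simp add: n_def last_conv_nth)
  have step: "snd (p ! i) = e ! (Suc i mod n)" if "i < n" for i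
  proof (cases "Suc i = n")
    case True
    then have "i = n - 1" by simp
    then show ?thesis using last n True by (simp add: e_def n_def)
  next
    case False
    then show ?thesis using cas[OF u(1), of i] that by (simp add: e_def n_def)
  qed
  have rot: "map snd p = rotate1 e"
    using n by (intro nth_equalityI) (auto simp: nth_rotate1 step n_def)
  then have "distinct e" using dist by simp
  moreover have "set e = verts G" by (simp add: p(3) e_def assms)
  moreover have "(x, y) \<in> arcs G \<longleftrightarrow> (\<exists>i<n. \<exists>j<n. x = e ! i \<and> y = e ! j \<and> cyclic_adj n i j)" for x y
  proof -
    have setp: "(x, y) \<in> set p \<longleftrightarrow> (\<exists>i<n. x = e ! i \<and> y = e ! (Suc i mod n))" for x y
      using step by (force simp: in_set_conv_nth n_def e_def prod_eq_iff)
    have adj: "cyclic_adj n i j \<longleftrightarrow> j = Suc i mod n \<or> i = Suc j mod n" if "i < n" "j < n" for i j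
      using that n(1) by (cases "Suc i = n"; cases "Suc j = n") (auto simp: cyclic_adj_def)
    have "(x, y) \<in> arcs G \<longleftrightarrow> (\<exists>i<n. x = e ! i \<and> y = e ! (Suc i mod n)) \<or> (\<exists>j<n. y = e ! j \<and> x = e ! (Suc j mod n))"
      unfolding p(4) using setp by auto
    also have "\<dots> \<longleftrightarrow> (\<exists>i<n. \<exists>j<n. x = e ! i \<and> y = e ! j \<and> cyclic_adj n i j)"
    proof -
      have lt: "Suc i mod n < n" for i using n(1) by simp
      show ?thesis
      proof
        assume "(\<exists>i<n. x = e ! i \<and> y = e ! (Suc i mod n)) \<or> (\<exists>j<n. y = e ! j \<and> x = e ! (Suc j mod n))"
        then show "\<exists>i<n. \<exists>j<n. x = e ! i \<and> y = e ! j \<and> cyclic_adj n i j"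
          using adj lt by (elim disjE exE conjE) blast+
      next
        assume "\<exists>i<n. \<exists>j<n. x = e ! i \<and> y = e ! j \<and> cyclic_adj n i j"
        then show "(\<exists>i<n. x = e ! i \<and> y = e ! (Suc i mod n)) \<or> (\<exists>j<n. y = e ! j \<and> x = e ! (Suc j mod n))"
          using adj by blast
      qed
    qed
    finally show ?thesis .
  qed
  ultimately show ?thesis using n by (intro exI[of _ e]) auto
qed

lemma (in Group.group) conjugate_subgroup:
  assumes N: "subgroup N G" and g: "g \<in> carrier G"
  defines "M \<equiv> (\<lambda>n. g \<otimes> n \<otimes> inv g) ` N"
  shows "subgroup M G" "G\<lparr>carrier := M\<rparr> \<cong> G\<lparr>carrier := N\<rparr>"
proof -
  have Nc: "n \<in> carrier G" if "n \<in> N" for n using subgroup.mem_carrier[OF N that] .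
  have mult: "(g \<otimes> n \<otimes> inv g) \<otimes> (g \<otimes> m \<otimes> inv g) = g \<otimes> (n \<otimes> m) \<otimes> inv g" if "n \<in> N" "m \<in> N" for n m
    using that Nc g by (simp add: m_assoc inv_cancel)
  show sub: "subgroup M G"
  proof (rule subgroupI)
    show "M \<subseteq> carrier G" using Nc g by (auto simp: M_def)
    show "M \<noteq> {}" using subgroup.one_closed[OF N] by (auto simp: M_def)
    show "inv a \<in> M" if "a \<in> M" for a
    proof -
      obtain n where n: "n \<in> N" "a = g \<otimes> n \<otimes> inv g" using \<open>a \<in> M\<close> unfolding M_def by blast
      then have "inv a = g \<otimes> inv n \<otimes> inv g" using Nc g by (simp add: inv_mult_group m_assoc)
      then show ?thesis using subgroup.m_inv_closed[OF N n(1)] by (auto simp: M_def)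
    qed
    show "a \<otimes> b \<in> M" if "a \<in> M" "b \<in> M" for a b
      using that mult subgroup.m_closed[OF N] by (auto simp: M_def)
  qed
  have "(\<lambda>n. g \<otimes> n \<otimes> inv g) \<in> iso (G\<lparr>carrier := N\<rparr>) (G\<lparr>carrier := M\<rparr>)"
  proof (rule isoI)
    show "(\<lambda>n. g \<otimes> n \<otimes> inv g) \<in> hom (G\<lparr>carrier := N\<rparr>) (G\<lparr>carrier := M\<rparr>)"
      by (rule homI) (auto simp: M_def mult)
    have "inj_on (\<lambda>n. g \<otimes> n \<otimes> inv g) N"
      using Nc g by (intro inj_onI) simp
    then show "bij_betw (\<lambda>n. g \<otimes> n \<otimes> inv g) (carrier (G\<lparr>carrier := N\<rparr>)) (carrier (G\<lparr>carrier := M\<rparr>))"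
      by (simp add: bij_betw_def M_def)
  qed
  then have "G\<lparr>carrier := N\<rparr> \<cong> G\<lparr>carrier := M\<rparr>" by (auto simp: is_iso_def)
  then show "G\<lparr>carrier := M\<rparr> \<cong> G\<lparr>carrier := N\<rparr>"
    by (rule Group.group.iso_sym[OF subgroup.subgroup_is_group[OF N is_group]])
qed

definition parity_sign :: "'b set \<Rightarrow> 'b list \<Rightarrow> real" where
  "parity_sign X u = (-1) ^ length (filter (\<lambda>x. x \<in> X) u)"

lemma parity_sign_append [simp]: "parity_sign X (u @ v) = parity_sign X u * parity_sign X v"
  by (simp add: parity_sign_def power_add)

lemma parity_sign_Cons [simp]: "parity_sign X (x # u) = (if x \<in> X then - parity_sign X u else parity_sign X u)"
  by (simp add: parity_sign_def)

lemma parity_sign_Nil [simp]: "parity_sign X [] = 1"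
  by (simp add: parity_sign_def)

lemma parity_sign_cases: "parity_sign X u = 1 \<or> parity_sign X u = -1"
  by (induction u) auto

lemma parity_sign_even: "parity_sign X u = 1 \<longleftrightarrow> even (length (filter (\<lambda>x. x \<in> X) u))"
  by (simp add: parity_sign_def minus_one_power_iff)

lemma parity_sign_racg_word:
  assumes "racg_word \<Delta> u = racg_word \<Delta> v" "u \<in> lists (pverts \<Delta>)" "v \<in> lists (pverts \<Delta>)"
  shows "parity_sign X u = parity_sign X v"
  by (rule racg_word_eq_induct[OF assms, where Q = "\<lambda>u v. parity_sign X u = parity_sign X v"]) auto

text \<open>Parities are invariant under the defining relations, so the choice of the word does
  not matter.\<close>

definition racg_sign :: "'b pair_pre_digraph \<Rightarrow> 'b set \<Rightarrow> 'b sword set \<Rightarrow> real" where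
  "racg_sign \<Delta> X w = parity_sign X (SOME u. u \<in> lists (pverts \<Delta>) \<and> racg_word \<Delta> u = w)"

lemma racg_sign_word:
  assumes "u \<in> lists (pverts \<Delta>)"
  shows "racg_sign \<Delta> X (racg_word \<Delta> u) = parity_sign X u"
proof -
  let ?v = "SOME v. v \<in> lists (pverts \<Delta>) \<and> racg_word \<Delta> v = racg_word \<Delta> u"
  have "?v \<in> lists (pverts \<Delta>) \<and> racg_word \<Delta> ?v = racg_word \<Delta> u" by (rule someI_ex) (use assms in blast)
  then show ?thesis unfolding racg_sign_def using assms by (intro parity_sign_racg_word) auto
qed

lemma (in mirrored_polygon) flips_parity:
  "u \<in> lists (A \<union> B) \<Longrightarrow> flips \<sigma> u = (parity_sign A u * fst \<sigma>, parity_sign B u * snd \<sigma>)"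
  using disjoint by (induction u arbitrary: \<sigma> rule: list.induct) (auto simp: flip_def)

text \<open>Deleting the letters outside \<open>C\<close> from all words turns a derivation of \<open>u = v\<close> over \<open>\<Delta>\<close>
  into one over the subgraph induced by \<open>C\<close>.\<close>

lemma racg_word_mirror_equiv:
  assumes C: "C \<subseteq> pverts \<Delta>" and V: "\<And>a b. (a, b) \<in> parcs \<Delta> \<Longrightarrow> a \<in> C \<Longrightarrow> b \<in> C \<Longrightarrow> (a, b) \<in> V \<or> (b, a) \<in> V"
    and uv: "racg_word \<Delta> u = racg_word \<Delta> v" "u \<in> lists C" "v \<in> lists C"
  shows "mirror_equiv C V u v"
proof -
  let ?f = "filter (\<lambda>c. c \<in> C)"
  have lists: "?f u \<in> lists C" for u by auto
  have "mirror_equiv C V (?f u) (?f v)"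
  proof (rule racg_word_eq_induct[OF uv(1), where Q = "\<lambda>u v. mirror_equiv C V (?f u) (?f v)"])
    show "u \<in> lists (pverts \<Delta>)" "v \<in> lists (pverts \<Delta>)" using uv(2,3) C by auto
    show "mirror_equiv C V (?f u) (?f u)" for u by (rule mirror_equiv.refl[OF lists])
    show "mirror_equiv C V (?f v) (?f u)" if "mirror_equiv C V (?f u) (?f v)" for u v
      using that by (rule mirror_equiv.sym)
    show "mirror_equiv C V (?f u) (?f w)" if "mirror_equiv C V (?f u) (?f v)" "mirror_equiv C V (?f v) (?f w)" for u v w
      using that by (rule mirror_equiv.trans)
    show "mirror_equiv C V (?f (u @ [s, s] @ v)) (?f (u @ v))" for u v s
      using mirror_equiv.square[of "?f u" C "?f v" s V] mirror_equiv.refl[of "?f (u @ v)" C V] lists by auto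
    show "mirror_equiv C V (?f (u @ [s, t] @ v)) (?f (u @ [t, s] @ v))" if "(s, t) \<in> parcs \<Delta>" for u v s t
    proof (cases "s \<in> C \<and> t \<in> C")
      case True
      then show ?thesis
        using V[OF that] mirror_equiv.swap[of "?f u" C "?f v" s t V] lists
          mirror_equiv.sym[OF mirror_equiv.swap[of "?f u" C "?f v" t s V]] by auto
    next
      case False
      then have "?f (u @ [s, t] @ v) = ?f (u @ [t, s] @ v)" by auto
      then show ?thesis using mirror_equiv.refl[of "?f (u @ [t, s] @ v)" C V] lists
        by (simp only:)
    qed
  qed
  moreover have "?f u = u" "?f v = v" using uv(2,3) by (auto simp: filter_id_conv in_lists_conv_set)
  ultimately show ?thesis by simp
qed

text \<open>The powers of \<open>c d\<close> for two letters that do not commute show that the surface subgroup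
  is infinite. Their words are reduced, since a letter never meets another occurrence of
  itself without being blocked by the other letter.\<close>

lemma reduced_alternating:
  assumes "c \<noteq> d" "(c, d) \<notin> E" "(d, c) \<notin> E"
  shows "reduced E (concat (replicate k [c, d]))"
proof (induction k)
  case (Suc k)
  have "cancel_letter E d (concat (replicate k [c, d])) = None" using assms by (cases k) auto
  with Suc assms show ?case by auto
qed simp

lemma alternating_words_distinct:
  assumes graph: "pair_graph \<Delta>" and cd: "c \<noteq> d" "(c, d) \<notin> parcs \<Delta>" "c \<in> pverts \<Delta>" "d \<in> pverts \<Delta>"
    and eq: "racg_word \<Delta> (concat (replicate k [c, d])) = racg_word \<Delta> (concat (replicate l [c, d]))"
  shows "k = l"
proof -
  interpret commutation "parcs \<Delta>" using graph by (rule commutation_pair_graph)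
  have dc: "(d, c) \<notin> parcs \<Delta>" using cd(2) E_sym by blast
  have l: "concat (replicate k [c, d]) \<in> lists (pverts \<Delta>)" for k using cd by (induction k) auto
  have "length (concat (replicate k [c, d])) = length (concat (replicate l [c, d]))"
    using swap_steps_length[OF racg_word_normal_word[OF graph eq l l]]
      normal_word_reduced[OF reduced_alternating[OF cd(1,2) dc]] by simp
  then show ?thesis by (simp add: length_concat sum_list_replicate)
qed

context generalization
begin

text \<open>The polygon has the vertices of the cycle as its sides; the cycle has length at least
  4, since it is bipartite. The closed galleries represent the words with even numbers of
  letters from both parts. Their conjugates by a lift of \<open>x\<close> lie in \<open>K\<close> by \<open>even_word_mem\<close>.\<close>

theorem surface_subgroup:
  assumes cyc: "cycle_connectors \<Gamma> \<Delta> A" and st: "(s, t) \<in> parcs \<Gamma>" and xy: "all_lifts (x @ [s, t] @ y)"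
  shows "\<exists>M. M \<subseteq> K \<and> closed_surface_subgroup (racg \<Delta>) M"
proof -
  interpret D: pair_graph \<Delta> by (rule graph_\<Delta>)
  interpret Ga: pair_graph \<Gamma> by (rule graph_\<Gamma>)
  let ?V = "{(a, b). a \<in> A s \<and> b \<in> A t \<and> (a, b) \<in> parcs \<Delta>}" and ?C = "A s \<union> A t"
  have stv: "s \<in> pverts \<Gamma>" "t \<in> pverts \<Gamma>" "s \<noteq> t"
    using st Ga.in_arcsD1 Ga.in_arcsD2 Ga.pair_no_loops by fastforce+
  have xl: "x \<in> lists (pverts \<Gamma>)" using xy by (auto simp: all_lifts_def)
  obtain x' where x': "lift x x'" using lift_exists[OF xl] by blast
  have x'l: "x' \<in> lists (pverts \<Delta>)" using lift_lists[OF x' xl] .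
  define h where "h = racg_word \<Delta> x'"
  have hc: "h \<in> carrier (racg \<Delta>)" unfolding h_def by (rule racg_word_carrier[OF x'l])
  interpret sq: commuting_squares "racg \<Delta>"
    "{n \<in> carrier (racg \<Delta>). h \<otimes>\<^bsub>racg \<Delta>\<^esub> n \<otimes>\<^bsub>racg \<Delta>\<^esub> inv\<^bsub>racg \<Delta>\<^esub> h \<in> K}"
    "\<lambda>a. racg_word \<Delta> [a]" "A s" "A t" ?V
    unfolding h_def using st xy x' by (rule commuting_squares_conj)
  have Cv: "?C \<subseteq> pverts \<Delta>" using part_subset stv by auto
  then have Cl: "u \<in> lists (pverts \<Delta>)" if "u \<in> lists ?C" for u using that by auto
  have same: "(a, b) \<notin> parcs \<Delta>" if "a \<in> A s \<and> b \<in> A s \<or> a \<in> A t \<and> b \<in> A t" for a b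
    using that partite stv unfolding gamma_partite_def by blast
  have arc_V: "(a, b) \<in> ?V \<or> (b, a) \<in> ?V" if "(a, b) \<in> parcs \<Delta>" "a \<in> ?C" "b \<in> ?C" for a b
  proof -
    have "(b, a) \<in> parcs \<Delta>" using that(1) D.pair_sym_arcs by (auto simp: symmetric_def dest: symD)
    then show ?thesis using that same by blast
  qed
  let ?G = "part_subgraph \<Delta> A s t"
  have G: "verts ?G = ?C" "arcs ?G = {(a, b). (a, b) \<in> parcs \<Delta> \<and> a \<in> ?C \<and> b \<in> ?C}" "tail ?G = fst" "head ?G = snd"
    by (auto simp: part_subgraph_def)
  obtain a0 b0 where "(a0, b0) \<in> ?V" using sq.neighbour_A sq.nonempty by blast
  then have "arcs ?G \<noteq> {}" unfolding G by blast
  then have "cycle_graph ?G" using cyc stv unfolding cycle_connectors_def by blast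
  from cycle_enumeration[OF this G(3,4)] obtain e where e: "distinct e" "3 \<le> length e" "set e = ?C"
    and e_arcs: "\<And>x y. (x, y) \<in> arcs ?G \<longleftrightarrow>
      (\<exists>i<length e. \<exists>j<length e. x = e ! i \<and> y = e ! j \<and> cyclic_adj (length e) i j)"
    unfolding G(1) by blast
  define n where "n = length e"
  have colour: "e ! i \<in> A s \<longleftrightarrow> e ! j \<in> A t" if "i < n" "j < n" "cyclic_adj n i j" for i j
  proof -
    have "(e ! i, e ! j) \<in> arcs ?G" unfolding e_arcs using that n_def by blast
    then have "(e ! i, e ! j) \<in> ?V \<or> (e ! j, e ! i) \<in> ?V" using arc_V unfolding G by blast
    then show ?thesis using sq.disjoint by auto
  qed
  have mem: "e ! i \<in> A s \<or> e ! i \<in> A t" if "i < n" for i using e(3) that n_def nth_mem by blast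
  have n4: "4 \<le> n"
  proof (rule ccontr)
    assume "\<not> 4 \<le> n"
    then have "n = 3" using e(2) by (simp add: n_def)
    then show False using colour[of 0 1] colour[of 1 2] colour[of 2 0] mem[of 0] mem[of 1] mem[of 2] sq.disjoint
      by (auto simp: cyclic_adj_def)
  qed
  have V_eq: "?V = {(a, b). a \<in> A s \<and> b \<in> A t \<and> (\<exists>i<n. \<exists>j<n. a = e ! i \<and> b = e ! j \<and> cyclic_adj n i j)}"
    using e_arcs unfolding G n_def by auto
  obtain f z m where "mirrored_polygon (A s) (A t) ?V f z m"
    using mirrored_polygon_exists[OF n4 e(1) n_def[symmetric] e(3) sq.disjoint V_eq colour] by blast
  then interpret mp: mirrored_polygon "A s" "A t" ?V f z m .
  let ?sgn = "\<lambda>w. (racg_sign \<Delta> (A s) w, racg_sign \<Delta> (A t) w)"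
  interpret pg: polygon_group "A s" "A t" ?V f z m "racg \<Delta>" "\<lambda>a. racg_word \<Delta> [a]" ?sgn
  proof
    show "?sgn \<one>\<^bsub>racg \<Delta>\<^esub> = (1, 1)"
      using racg_sign_word[of "[]" \<Delta>] by (simp add: racg_word_Nil)
    have sign: "racg_sign \<Delta> X (w \<otimes>\<^bsub>racg \<Delta>\<^esub> racg_word \<Delta> [a]) =
        (if a \<in> X then - racg_sign \<Delta> X w else racg_sign \<Delta> X w)"
      if "w \<in> carrier (racg \<Delta>)" "a \<in> ?C" for X w a
    proof -
      obtain u where u: "u \<in> lists (pverts \<Delta>)" "w = racg_word \<Delta> u" using \<open>w \<in> carrier (racg \<Delta>)\<close>
        by (auto simp: racg_carrier)
      have a: "[a] \<in> lists (pverts \<Delta>)" using that(2) Cv by auto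
      then have "u @ [a] \<in> lists (pverts \<Delta>)" using u(1) by simp
      then show ?thesis using racg_sign_word[of "u @ [a]" \<Delta> X] racg_sign_word[OF u(1), of X]
        by (simp add: racg_word_append[OF u(1) a] u(2))
    qed
    show "?sgn (w \<otimes>\<^bsub>racg \<Delta>\<^esub> racg_word \<Delta> [a]) = (- fst (?sgn w), snd (?sgn w))"
      if "w \<in> carrier (racg \<Delta>)" "a \<in> A s" for w a using sign[OF that(1), of a] that(2) sq.disjoint by auto
    show "?sgn (w \<otimes>\<^bsub>racg \<Delta>\<^esub> racg_word \<Delta> [b]) = (fst (?sgn w), - snd (?sgn w))"
      if "w \<in> carrier (racg \<Delta>)" "b \<in> A t" for w b using sign[OF that(1), of b] that(2) sq.disjoint by auto
    show "?sgn w \<in> mp.signs" if "w \<in> carrier (racg \<Delta>)" for w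
      using parity_sign_cases unfolding racg_sign_def mp.signs_def by fastforce
    have "countable (lists (pverts \<Delta>))" using D.pair_finite_verts by (intro countable_lists countable_finite)
    then show "countable (carrier (racg \<Delta>))" unfolding racg_carrier by (rule countable_image)
  qed (fact sq.c_closed, fact sq.c_square, fact sq.E_commute)
  have elt: "pg.gallery_elt u = racg_word \<Delta> u" if "u \<in> lists ?C" for u
    using that
  proof (induction u rule: list.induct)
    case (Cons c u)
    then have "[c] \<in> lists (pverts \<Delta>)" "u \<in> lists (pverts \<Delta>)" using Cl Cv by auto
    then show ?case using Cons racg_word_append[of "[c]" \<Delta> u] by simp
  qed (simp add: racg_word_Nil)
  interpret pp: polygon_presentation "A s" "A t" ?V f z m "racg \<Delta>" "\<lambda>a. racg_word \<Delta> [a]" ?sgn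
  proof
    fix u v assume uv: "u \<in> lists ?C" "v \<in> lists ?C" "pg.gallery_elt u = pg.gallery_elt v"
    show "mirror_equiv ?C ?V u v"
      by (rule racg_word_mirror_equiv[OF Cv arc_V]) (use uv elt in auto)
  qed
  have closed_iff: "u \<in> pp.closed_galleries \<longleftrightarrow> u \<in> lists ?C \<and> parity_sign (A s) u = 1 \<and> parity_sign (A t) u = 1" for u
    unfolding pp.closed_galleries_def mem_Collect_eq
    by (rule conj_cong[OF HOL.refl]) (simp only: mp.flips_parity prod.sel mult_1_right prod.inject)
  let ?N = "pg.gallery_elt ` pp.closed_galleries"
  have N: "subgroup ?N (racg \<Delta>)"
  proof (rule WD.subgroupI)
    show "?N \<subseteq> carrier (racg \<Delta>)" using pg.gallery_elt_closed by (auto simp: closed_iff)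
    show "?N \<noteq> {}" using closed_iff[of "[]"] by auto
    show "inv\<^bsub>racg \<Delta>\<^esub> a \<in> ?N" if "a \<in> ?N" for a
    proof -
      obtain u where u: "u \<in> pp.closed_galleries" "a = pg.gallery_elt u" using \<open>a \<in> ?N\<close> by blast
      then have ul: "u \<in> lists ?C" "rev u \<in> lists ?C" by (auto simp: closed_iff)
      have "parity_sign X (rev u) = parity_sign X u" for X by (simp add: parity_sign_def rev_filter[symmetric])
      then have "rev u \<in> pp.closed_galleries" using u(1) ul by (simp add: closed_iff)
      moreover have "inv\<^bsub>racg \<Delta>\<^esub> a = pg.gallery_elt (rev u)"
        using ul by (simp add: u(2) elt racg_word_rev[OF Cl])
      ultimately show ?thesis by blast
    qed
    show "a \<otimes>\<^bsub>racg \<Delta>\<^esub> b \<in> ?N" if "a \<in> ?N" "b \<in> ?N" for a b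
    proof -
      obtain u v where uv: "u \<in> pp.closed_galleries" "a = pg.gallery_elt u" "v \<in> pp.closed_galleries" "b = pg.gallery_elt v"
        using \<open>a \<in> ?N\<close> \<open>b \<in> ?N\<close> by blast
      then have "a \<otimes>\<^bsub>racg \<Delta>\<^esub> b = pg.gallery_elt (u @ v)"
        using pg.gallery_elt_append[of u v] by (simp add: closed_iff)
      then show ?thesis using pp.closed_galleries_append[OF uv(1,3)] by blast
    qed
  qed
  have N_sub: "h \<otimes>\<^bsub>racg \<Delta>\<^esub> a \<otimes>\<^bsub>racg \<Delta>\<^esub> inv\<^bsub>racg \<Delta>\<^esub> h \<in> K" if "a \<in> ?N" for a
  proof -
    obtain u where u: "u \<in> pp.closed_galleries" "a = pg.gallery_elt u" using \<open>a \<in> ?N\<close> by blast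
    then have "a = racg_word \<Delta> u" using elt by (simp add: closed_iff)
    note u = u(1) this
    have "racg_word \<Delta> u \<in> {n \<in> carrier (racg \<Delta>). h \<otimes>\<^bsub>racg \<Delta>\<^esub> n \<otimes>\<^bsub>racg \<Delta>\<^esub> inv\<^bsub>racg \<Delta>\<^esub> h \<in> K}"
    proof (rule sq.even_word_mem)
      show "racg_word \<Delta> [] = \<one>\<^bsub>racg \<Delta>\<^esub>" by (rule racg_word_Nil)
      show "racg_word \<Delta> (xs @ [x]) = racg_word \<Delta> xs \<otimes>\<^bsub>racg \<Delta>\<^esub> racg_word \<Delta> [x]"
        if "xs \<in> lists ?C" "x \<in> ?C" for xs x using that Cl Cv by (intro racg_word_append) auto
    qed (use u(1) in \<open>auto simp: closed_iff parity_sign_even\<close>)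
    then show ?thesis by (simp add: u(2))
  qed
  have "infinite ?N"
  proof -
    have len: "0 < n" "1 < n" "2 < n" using n4 by auto
    \<comment> \<open>Two vertices at distance 2 on the cycle belong to the same part, so they do not commute and
      the powers of their product are even words.\<close>
    define c where "c = e ! 0" define d where "d = e ! 2"
    have cd: "c \<in> ?C" "d \<in> ?C" using mem len by (auto simp: c_def d_def)
    have ne: "c \<noteq> d" using e(1) len by (simp add: c_def d_def n_def nth_eq_iff_index_eq)
    have same_part: "c \<in> A s \<and> d \<in> A s \<or> c \<in> A t \<and> d \<in> A t"
      using colour[of 0 1] colour[of 1 2] mem[of 0] mem[of 1] mem[of 2] len sq.disjoint
      by (auto simp: cyclic_adj_def c_def d_def)
    let ?w = "\<lambda>k. concat (replicate k [c, d])"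
    have wl: "?w k \<in> lists ?C" for k using cd by (induction k) auto
    have "parity_sign (A s) (?w k) = 1 \<and> parity_sign (A t) (?w k) = 1" for k
      using same_part sq.disjoint by (induction k) auto
    then have "?w k \<in> pp.closed_galleries" for k using wl by (simp add: closed_iff)
    then have "range (\<lambda>k. pg.gallery_elt (?w k)) \<subseteq> ?N" by blast
    moreover have "inj (\<lambda>k. pg.gallery_elt (?w k))"
    proof (rule injI)
      fix k l assume "pg.gallery_elt (?w k) = pg.gallery_elt (?w l)"
      then have "racg_word \<Delta> (?w k) = racg_word \<Delta> (?w l)" using elt[OF wl] by simp
      then show "k = l"
        using cd Cv by (intro alternating_words_distinct[OF graph_\<Delta> ne same[OF same_part]]) auto
    qed
    ultimately show ?thesis using finite_subset range_inj_infinite by blast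
  qed
  from pp.closed_surface_group[OF this] obtain X :: "(nat \<Rightarrow>\<^sub>C real) set" and p where X:
    "closed_surface X" "p \<in> X" "infinite (carrier (fundamental_group X p))"
    "(racg \<Delta>)\<lparr>carrier := ?N\<rparr> \<cong> fundamental_group X p" by blast
  let ?M = "(\<lambda>a. h \<otimes>\<^bsub>racg \<Delta>\<^esub> a \<otimes>\<^bsub>racg \<Delta>\<^esub> inv\<^bsub>racg \<Delta>\<^esub> h) ` ?N"
  have "subgroup ?M (racg \<Delta>)" by (rule WD.conjugate_subgroup(1)[OF N hc])
  moreover have "(racg \<Delta>)\<lparr>carrier := ?M\<rparr> \<cong> fundamental_group X p"
    using WD.conjugate_subgroup(2)[OF N hc] X(4) by (rule iso_trans)
  ultimately have "closed_surface_subgroup (racg \<Delta>) ?M" unfolding closed_surface_subgroup_def using X by blast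
  moreover have "?M \<subseteq> K" using N_sub by blast
  ultimately show ?thesis by blast
qed

end

theorem theorem6p2:
  fixes \<Gamma> :: "'a pair_pre_digraph"
    and \<Delta> :: "'b pair_pre_digraph"
    and A :: "'a \<Rightarrow> 'b set"
    and T :: "'a list set"
    and H :: "'a sword set set"
    and Hbar :: "'b sword set set"
  assumes "pair_graph \<Gamma>"
    and "pair_graph \<Delta>"
    and "gamma_partite \<Gamma> \<Delta> A"
    and "cycle_connectors \<Gamma> \<Delta> A"
    and "finite T"
    and "T \<subseteq> lists (pverts \<Gamma>)"
    and "H = generate (racg \<Gamma>) (racg_word \<Gamma> ` T)"
    and "\<not> quasiconvex (racg \<Gamma>) (racg_gens \<Gamma>) H"
    and "is_generalization \<Delta> A T Hbar"
  shows "\<not> quasiconvex (racg \<Delta>) (racg_gens \<Delta>) Hbar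
       \<and> (\<exists>K. K \<subseteq> Hbar \<and> closed_surface_subgroup (racg \<Delta>) K)"
proof -
  interpret generalization \<Gamma> \<Delta> A T Hbar
    by (rule generalization.intro) (use assms in auto)
  have H: "\<not> word_quasiconvex \<Gamma> (generate (racg \<Gamma>) (racg_word \<Gamma> ` T))"
    using assms(7,8) word_quasiconvex_imp_quasiconvex[OF subgroup_H] by blast
  then have "\<not> word_quasiconvex \<Delta> Hbar" using quasiconvex_descends by blast
  then have "\<not> quasiconvex (racg \<Delta>) (racg_gens \<Delta>) Hbar"
    using quasiconvex_imp_word_quasiconvex[OF subgroup_K] by blast
  moreover obtain x s t y where "(s, t) \<in> parcs \<Gamma>" "all_lifts (x @ [s, t] @ y)"
    using commuting_pair_exists[OF H] by blast
  then have "\<exists>K. K \<subseteq> Hbar \<and> closed_surface_subgroup (racg \<Delta>) K"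
    using surface_subgroup[OF assms(4)] by blast
  ultimately show ?thesis by blast
qed


end
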